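(* Let $k$ be a positive integer and $\epsilon>0$, and let $p_1<p_2<\cdots$ be the sequence of prime numbers. Then for all sufficiently large integers $h$ (depending on $k$ and $\epsilon$) there exist an integer $n$ and a set $\mathscr{J}\subseteq\{n+1,\dots,\lfloor(1+\epsilon)n\rfloor\}$ such that \[ h=\sum_{i=1}^{n}\lfloor\sqrt[k]{p_i}\rfloor+\sum_{j\in\mathscr{J}}\lfloor\sqrt[k]{p_j}\rfloor. \] *)

theory Defs
  imports Complex_Main "HOL-Computational_Algebra.Primes" "HOL-Library.Infinite_Set"
begin

text \<open>The i-th prime, 1-indexed: p 1 = 2, p 2 = 3, ... (via the increasing
  enumeration of the infinite set of primes, which is 0-indexed).\<close>
definition nth_prime :: "nat \<Rightarrow> nat" where
  "nth_prime i = enumerate {p::nat. prime p} (i - 1)"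

end

theory Submission
  imports Defs "HOL-Analysis.Analysis" "HOL-Number_Theory.Prime_Powers"
    "HOL-Computational_Algebra.Squarefree" "HOL-Real_Asymp.Real_Asymp"
begin

text \<open>Write \<open>a\<^sub>j\<close> for the integer part of the \<open>k\<close>-th root of the \<open>j\<close>-th prime, \<open>m\<^sub>n\<close> for the integer part
  of \<open>(1 + \<epsilon>)n\<close> and \<open>T\<close> for the sum of the \<open>a\<^sub>j\<close> over the window \<open>n < j \<le> m\<^sub>n\<close>. It suffices that
  the subset sums of each late window fill an interval around \<open>T/2\<close> of length a few times the largest term: with
  \<open>n\<close> maximal such that \<open>a\<^sub>1 + \<dots> + a\<^sub>n + T/2 \<le> h\<close>, what is left of \<open>h\<close> lies in that interval.

  A window takes many distinct values (only a Chebyshev lower bound is needed), so by pigeonhole many disjoint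
  pairs of terms have one common small difference \<open>g\<close>. Choosing one term from each of these pairs, and from further
  pairs whose differences are multiples of \<open>g\<close>, gives subset sums in a long progression modulo \<open>g\<close>. Fewer
  than \<open>g\<close> additional terms reach all residues modulo \<open>g\<close>, provided that no prime \<open>q\<close> dividing \<open>g\<close>
  divides almost all terms; the remaining terms extend the resulting interval greedily.

  For \<open>k = 1\<close> the proviso is trivial. For \<open>k \<ge> 2\<close>, if \<open>q\<close> divided almost all terms, then the fractional
  part of \<open>p\<^sup>1\<^sup>/\<^sup>k / q\<close> would be at most \<open>1/2\<close> for almost all primes \<open>p\<close> of the window. This contradicts
  a power saving in the sum of \<open>\<Lambda>(n) e(\<theta> n\<^sup>1\<^sup>/\<^sup>k)\<close>, which follows from Vaughan's identity: all inner
  sums that occur are over phases with small monotone derivative, so the Kusmin--Landau inequality suffices.\<close>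

section \<open>Exponential sums with a smooth phase\<close>

text \<open>All losses are powers of l = ln n. The terms of a window are at most about n^(1/k) l^2,
  and the number of their distinct values is at least n^(1/k) divided by a power of l, by counting
  integers between consecutive k-th powers. So the values are dense up to a power of l, and the
  common difference \<open>g\<close>, hence every prime \<open>q\<close> to be excluded, is bounded
  by a power of l. A saving of a fixed power of n with a loss linear in \<open>q\<close> therefore
  settles divisibility for all these \<open>q\<close>.

  What k \<ge> 2 provides is c = 1/k \<le> 1/2: for d m about x, one step of m raises the phase
  \<theta> (d m)^c by about \<theta> c d x^(c-1), which is at most 1/2 once d is at most the square
  root of x. In the bilinear sums one of the two variables is always that small up to a constant,
  and the difference of two phases is again a multiple of n^c, with a coefficient that stays small
  inside a dyadic block. So first-derivative information is enough throughout.\<close>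

lemma cot_antimono:
  fixes x y :: real
  assumes "0 < x" "x \<le> y" "y < pi"
  shows "cot y \<le> cot x"
proof -
  have s: "sin x > 0" "sin y > 0" using assms by (auto intro!: sin_gt_zero)
  have "sin (y - x) \<ge> 0" using assms by (intro sin_ge_zero) auto
  hence "0 \<le> sin (y - x) / (sin x * sin y)" using s by simp
  also have "\<dots> = cot x - cot y" using s by (simp add: cot_def sin_diff field_simps)
  finally show ?thesis by simp
qed

lemma cot_le_inverse:
  fixes x :: real
  assumes "0 < x" "x < pi"
  shows "cot x \<le> 1 / x"
proof -
  have "x * cos x \<le> sin x"
  proof -
    have "0 \<le> x" using assms by simp
    hence "(\<lambda>t. sin t - t * cos t) 0 \<le> (\<lambda>t. sin t - t * cos t) x"
    proof (rule DERIV_nonneg_imp_nondecreasing)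
      fix t assume "0 \<le> t" "t \<le> x"
      moreover have "((\<lambda>t. sin t - t * cos t) has_real_derivative t * sin t) (at t)"
        by (auto intro!: derivative_eq_intros)
      ultimately show "\<exists>y. ((\<lambda>t. sin t - t * cos t) has_real_derivative y) (at t) \<and> 0 \<le> y"
        using assms by (intro exI[of _ "t * sin t"]) (auto intro!: mult_nonneg_nonneg sin_ge_zero)
    qed
    thus ?thesis by simp
  qed
  moreover have "sin x > 0" using assms by (auto intro!: sin_gt_zero)
  ultimately show ?thesis using assms by (simp add: cot_def field_simps)
qed

text \<open>The real part of 1 / (1 - e^(2iu)) is the constant 1/2, so two such inverses differ by
  i/2 times a difference of cotangents.\<close>

lemma inverse_one_minus_cis:
  assumes "sin u \<noteq> 0"
  shows "Complex (1/2) (cot u / 2) * (1 - cis (2 * u)) = 1"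
proof -
  have c: "cos (2*u) = 1 - 2 * (sin u)\<^sup>2" and s: "cot u * sin (2*u) = 2 - 2 * (sin u)\<^sup>2"
    using assms cos_squared_eq[of u] by (simp_all add: cos_double_sin sin_double cot_def power2_eq_square)
  have "cot u * (1 - cos (2*u)) = sin (2*u)"
    using assms by (simp add: c sin_double cot_def power2_eq_square)
  thus ?thesis using s c by (simp add: complex_eq_iff algebra_simps)
qed

text \<open>Writing
  \<open>e\<^sub>n = (e\<^sub>n - e\<^sub>n\<^sub>+\<^sub>1) z\<^sub>n\<close> with \<open>z\<^sub>n = (1 - e\<^sub>n\<^sub>+\<^sub>1 / e\<^sub>n)\<^sup>-\<^sup>1 = 1/2 + (i/2) cot(\<pi> g\<^sub>n)\<close>,
  partial summation bounds the sum by the total variation of the monotone sequence \<open>cot(\<pi> g\<^sub>n)\<close>.\<close>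
lemma kusmin_landau:
  fixes \<phi> :: "nat \<Rightarrow> real" and l :: real
  defines "g \<equiv> \<lambda>n. \<phi> (Suc n) - \<phi> n"
  assumes l: "0 < l" "l \<le> 1/2"
    and bounds: "\<And>n. a \<le> n \<Longrightarrow> n < b \<Longrightarrow> l \<le> g n \<and> g n \<le> 1/2"
    and anti: "\<And>n. a \<le> n \<Longrightarrow> Suc n < b \<Longrightarrow> g (Suc n) \<le> g n"
  shows "norm (\<Sum>n=a..b. cis (2 * pi * \<phi> n)) \<le> 2 / l"
proof (cases "a < b")
  case False
  hence "{a..b} = {} \<or> {a..b} = {a}" by auto
  moreover have "1 \<le> 2 / l" using l by (simp add: field_simps)
  ultimately show ?thesis using l by auto
next
  case True
  define e where "e n = cis (2 * pi * \<phi> n)" for n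
  define z where "z n = Complex (1/2) (cot (pi * g n) / 2)" for n
  have rng: "0 < pi * g n" "pi * g n \<le> pi / 2" if "a \<le> n" "n < b" for n
    using bounds[OF that] l by auto
  have e_eq: "e n = (e n - e (Suc n)) * z n" if "a \<le> n" "n < b" for n
  proof -
    have "sin (pi * g n) \<noteq> 0" using rng[OF that] by (intro less_imp_neq[symmetric] sin_gt_zero) auto
    from inverse_one_minus_cis[OF this] have "z n * (1 - cis (2 * (pi * g n))) = 1"
      by (simp add: z_def)
    moreover have "e (Suc n) = e n * cis (2 * (pi * g n))"
      by (simp add: e_def g_def cis_mult algebra_simps)
    ultimately have "(e n - e (Suc n)) * z n = e n * (z n * (1 - cis (2 * (pi * g n))))"
      by (simp add: algebra_simps)
    thus ?thesis by (simp only: \<open>z n * (1 - cis (2 * (pi * g n))) = 1\<close> mult_1_right)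
  qed
  have cot_nonneg: "cot (pi * g n) \<ge> 0" if "a \<le> n" "n < b" for n
    unfolding cot_def using rng[OF that] pi_gt_zero
    by (intro divide_nonneg_nonneg cos_ge_zero sin_ge_zero) linarith+
  have nz: "norm (z n) \<le> 1/2 + cot (pi * g n) / 2" if "a \<le> n" "n < b" for n
    using cmod_le[of "z n"] cot_nonneg[OF that] by (simp add: z_def)
  \<comment> \<open>Partial summation in closed form: the subtracted terms are the boundary
    contribution, and what remains is a sum of terms \<open>e m\<close> times an increment of
    \<open>z\<close>. As \<open>g\<close> decreases, cot(pi g) increases, so its total variation
    telescopes to the right-hand side.\<close>
  have claim: "norm ((\<Sum>n=a..Suc (a+d). e n) - (e (Suc (a+d)) + e a * z a - e (Suc (a+d)) * z (a+d)))
                 \<le> (cot (pi * g (a+d)) - cot (pi * g a)) / 2" if "a + d < b" for d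
    using that
  proof (induction d)
    case 0
    have "e a = (e a - e (Suc a)) * z a" using e_eq[of a] True by simp
    hence "(\<Sum>n=a..Suc a. e n) - (e (Suc a) + e a * z a - e (Suc a) * z a) = 0"
      by (simp add: algebra_simps)
    thus ?case by simp
  next
    case (Suc d)
    define m where "m = Suc (a+d)"
    have m: "a \<le> m" "m < b" using Suc.prems by (auto simp: m_def)
    have IH: "norm ((\<Sum>n=a..m. e n) - (e m + e a * z a - e m * z (a+d)))
                 \<le> (cot (pi * g (a+d)) - cot (pi * g a)) / 2"
      using Suc by (simp add: m_def)
    have "(\<Sum>n=a..Suc m. e n) = (\<Sum>n=a..m. e n) + e (Suc m)" using m by simp
    hence "(\<Sum>n=a..Suc m. e n) - (e (Suc m) + e a * z a - e (Suc m) * z m)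
        = ((\<Sum>n=a..m. e n) - (e m + e a * z a - e m * z (a+d))) + e m * (z m - z (a+d))"
      using e_eq[OF m] by (simp add: algebra_simps)
    also have "norm \<dots> \<le> (cot (pi * g (a+d)) - cot (pi * g a)) / 2 + norm (z m - z (a+d))"
      by (rule order_trans[OF norm_triangle_ineq]) (use IH in \<open>simp add: norm_mult e_def\<close>)
    also have "norm (z m - z (a+d)) = \<bar>cot (pi * g m) - cot (pi * g (a+d))\<bar> / 2"
      by (simp add: z_def cmod_def abs_divide flip: diff_divide_distrib)
    also have "\<dots> = (cot (pi * g m) - cot (pi * g (a+d))) / 2"
    proof -
      have "cot (pi * g (a+d)) \<le> cot (pi * g m)"
        using anti[of "a+d"] m rng[of "a+d"] rng[OF m] by (intro cot_antimono) (auto simp: m_def)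
      thus ?thesis by simp
    qed
    finally show ?case by (simp add: m_def field_simps)
  qed
  define d where "d = b - 1 - a"
  have d: "a + d < b" "Suc (a+d) = b" using True by (auto simp: d_def)
  have "norm (\<Sum>n=a..b. e n) \<le> norm (e b + e a * z a - e b * z (a+d)) + (cot (pi * g (a+d)) - cot (pi * g a)) / 2"
    using claim[OF d(1)] norm_triangle_sub[of "\<Sum>n=a..b. e n" "e b + e a * z a - e b * z (a+d)"]
    unfolding d(2) by linarith
  also have "norm (e b + e a * z a - e b * z (a+d)) \<le> 1 + norm (z a) + norm (z (a+d))"
    by (rule order_trans[OF norm_triangle_ineq4]) (auto simp: norm_mult e_def intro!: order_trans[OF norm_triangle_ineq])
  finally have "norm (\<Sum>n=a..b. e n) \<le> 2 + cot (pi * g (a+d))"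
    using nz[of a] nz[of "a+d"] True d by (simp add: field_simps)
  also have "cot (pi * g (a+d)) \<le> 1 / (pi * g (a+d))"
    using rng[of "a+d"] d by (intro cot_le_inverse) auto
  also have "\<dots> \<le> 1 / l"
  proof -
    have "1 * l \<le> pi * g (a+d)"
      using bounds[of "a+d"] d l pi_ge_two by (intro mult_mono) auto
    thus ?thesis using l by (auto simp: field_simps)
  qed
  also have "2 \<le> 1 / l" using l by (simp add: field_simps)
  finally show ?thesis by (simp add: e_def)
qed

lemma powr_diff_bounds:
  fixes c a b :: real
  assumes c: "0 < c" "c \<le> 1" and ab: "0 < a" "a \<le> b"
  shows "c * b powr (c - 1) * (b - a) \<le> b powr c - a powr c"
    and "b powr c - a powr c \<le> c * a powr (c - 1) * (b - a)"
proof -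
  have "c * b powr (c - 1) * (b - a) \<le> b powr c - a powr c \<and>
    b powr c - a powr c \<le> c * a powr (c - 1) * (b - a)"
  proof (cases "a = b")
    case False
    hence "\<exists>z. a < z \<and> z < b \<and> b powr c - a powr c = (b - a) * (c * z powr (c - 1))"
      using ab by (intro MVT2) (auto intro!: derivative_eq_intros)
    then obtain z where z: "a < z" "z < b"
      "b powr c - a powr c = c * z powr (c - 1) * (b - a)" by (auto simp: algebra_simps)
    have "b powr (c - 1) \<le> z powr (c - 1)" "z powr (c - 1) \<le> a powr (c - 1)"
      using z ab c by (auto intro!: powr_mono2')
    thus ?thesis using z c ab by (auto intro!: mult_left_mono mult_right_mono)
  qed auto
  thus "c * b powr (c - 1) * (b - a) \<le> b powr c - a powr c"
    and "b powr c - a powr c \<le> c * a powr (c - 1) * (b - a)" by auto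
qed

lemma powr_Suc_diff:
  fixes c :: real
  assumes c: "0 < c" "c \<le> 1" and n: "n \<ge> (1::nat)"
  shows "c * real (Suc n) powr (c - 1) \<le> real (Suc n) powr c - real n powr c"
    and "real (Suc n) powr c - real n powr c \<le> c * real n powr (c - 1)"
  using powr_diff_bounds[OF c, of "real n" "real (Suc n)"] n by simp_all

text \<open>By concavity the increments of the phase decrease: \<open>small\<close> keeps the first
  at most 1/2, and all are at least about c D B^(c-1), whose reciprocal is the bound. The factor 4
  is the 2 of \<open>kusmin_landau\<close> times the 2 lost in replacing \<open>Suc B\<close> by
  \<open>B\<close>.\<close>

lemma exp_sum_powr_bound:
  fixes c D :: real
  assumes c: "0 < c" "c \<le> 1" and D: "D > 0" and A: "1 \<le> A" and AB: "A \<le> B"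
    and small: "D * c * real A powr (c - 1) \<le> 1/2"
  shows "norm (\<Sum>n=A..B. cis (2 * pi * (D * real n powr c))) \<le> 4 * real B powr (1 - c) / (c * D)"
proof -
  define l where "l = D * c * real (Suc B) powr (c - 1)"
  have l: "0 < l" using D c by (simp add: l_def)
  have anti: "real m powr (c - 1) \<le> real n powr (c - 1)" if "1 \<le> n" "n \<le> m" for m n :: nat
    using that c by (intro powr_mono2') auto
  have "l \<le> D * c * real A powr (c - 1)"
    unfolding l_def using D c A AB by (intro mult_left_mono anti) auto
  hence l2: "l \<le> 1/2" using small by linarith
  have "norm (\<Sum>n=A..B. cis (2 * pi * (D * real n powr c))) \<le> 2 / l"
  proof (rule kusmin_landau[OF l l2])
    fix n assume n: "A \<le> n" "n < B"
    have "l \<le> D * (c * real (Suc n) powr (c - 1))"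
      unfolding l_def using n D c anti[of "Suc n" "Suc B"] by simp
    also have "\<dots> \<le> D * (real (Suc n) powr c - real n powr c)"
      using powr_Suc_diff(1)[of c n] c n A D by (intro mult_left_mono) auto
    finally have 1: "l \<le> D * real (Suc n) powr c - D * real n powr c" by (simp add: right_diff_distrib)
    have "D * (real (Suc n) powr c - real n powr c) \<le> D * (c * real n powr (c - 1))"
      using powr_Suc_diff(2)[of c n] c n A D by (intro mult_left_mono) auto
    also have "\<dots> \<le> D * (c * real A powr (c - 1))"
      using c D A n by (intro mult_left_mono anti) auto
    finally have "D * real (Suc n) powr c - D * real n powr c \<le> 1/2"
      using small by (simp add: algebra_simps)
    with 1 show "l \<le> D * real (Suc n) powr c - D * real n powr c \<and>
      D * real (Suc n) powr c - D * real n powr c \<le> 1 / 2" by blast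
  next
    fix n assume n: "A \<le> n" "Suc n < B"
    have "real (Suc (Suc n)) powr c - real (Suc n) powr c \<le> real (Suc n) powr c - real n powr c"
      using powr_Suc_diff(1)[of c n] powr_Suc_diff(2)[of c "Suc n"] c n A by simp
    from mult_left_mono[OF this, of D] D
    show "D * real (Suc (Suc n)) powr c - D * real (Suc n) powr c
      \<le> D * real (Suc n) powr c - D * real n powr c" by (simp add: algebra_simps)
  qed
  also have "2 / l = 2 * real (Suc B) powr (1 - c) / (c * D)"
    using powr_minus_divide[of "real (Suc B)" "1 - c"] by (simp add: l_def mult_ac)
  also have "\<dots> \<le> 2 * (2 * real B powr (1 - c)) / (c * D)"
  proof -
    have "real (Suc B) powr (1 - c) \<le> (2 * real B) powr (1 - c)"
      using A AB c by (intro powr_mono2) auto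
    also have "\<dots> = 2 powr (1 - c) * real B powr (1 - c)" by (simp add: powr_mult)
    also have "\<dots> \<le> 2 powr 1 * real B powr (1 - c)"
      using c by (intro mult_right_mono powr_mono) auto
    finally show ?thesis using c D by (intro divide_right_mono) auto
  qed
  finally show ?thesis by simp
qed

section \<open>Vaughan's identity and Chebyshev's lower bound\<close>

definition moebius_mu :: "nat \<Rightarrow> real" where
  "moebius_mu n = (if squarefree n then (-1) ^ card (prime_factors n) else 0)"

lemma moebius_mu_1 [simp]: "moebius_mu (Suc 0) = 1"
  using squarefree_1[where 'a = nat] by (simp add: moebius_mu_def)

lemma abs_moebius_mu_le: "\<bar>moebius_mu n\<bar> \<le> 1"
  by (simp add: moebius_mu_def)

lemma moebius_mu_times_prime:
  assumes "prime p" "\<not> p dvd d" "d > 0"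
  shows "moebius_mu (p * d) = - moebius_mu d"
proof -
  have cop: "coprime p d" using assms by (simp add: prime_imp_coprime)
  have "squarefree (p * d) \<longleftrightarrow> squarefree d"
    using assms cop squarefree_mult_coprime[of p d] squarefree_prime[of p] squarefree_multD(2)[of p d]
    by blast
  moreover have "prime_factors (p * d) = insert p (prime_factors d)"
    using assms by (subst prime_factors_product) (auto simp: prime_prime_factors)
  moreover have "p \<notin> prime_factors d" using assms by auto
  ultimately show ?thesis by (simp add: moebius_mu_def)
qed

text \<open>Fix a prime p dividing n. A divisor that is neither in \<open>D0\<close> nor p times an
  element of \<open>D0\<close> is divisible by p^2 and has weight zero; multiplication by p flips
  the sign on \<open>D0\<close>, so the two halves cancel.\<close>

lemma sum_moebius_mu_divisors:
  assumes "n > 0"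
  shows "(\<Sum>d | d dvd n. moebius_mu d) = (if n = 1 then 1 else 0)"
proof (cases "n = 1")
  case True
  hence "{d. d dvd n} = {1}" by auto
  thus ?thesis using True by simp
next
  case False
  then obtain p where p: "prime p" "p dvd n" using prime_factor_nat by blast
  define D0 where "D0 = {d. p * d dvd n \<and> \<not> p dvd d}"
  have fin: "finite {d. d dvd n}" using assms by simp
  have D0: "D0 \<subseteq> {d. d dvd n}" by (auto simp: D0_def dest: dvd_mult_right)
  have inj: "inj_on ((*) p) D0" using p by (auto simp: inj_on_def)
  have pos: "d > 0" if "d dvd n" for d using that assms by (auto intro: Nat.gr0I)
  have "(\<Sum>d | d dvd n. moebius_mu d) = (\<Sum>d\<in>D0 \<union> (*) p ` D0. moebius_mu d)"
  proof (rule sum.mono_neutral_right)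
    show "\<forall>d\<in>{d. d dvd n} - (D0 \<union> (*) p ` D0). moebius_mu d = 0"
    proof
      fix d assume d: "d \<in> {d. d dvd n} - (D0 \<union> (*) p ` D0)"
      have "p dvd d"
      proof (rule ccontr)
        assume "\<not> p dvd d"
        moreover from this have "p * d dvd n" using d p by (intro divides_mult) (auto simp: prime_imp_coprime)
        ultimately show False using d by (auto simp: D0_def)
      qed
      then obtain e where e: "d = p * e" by auto
      have "p dvd e" using d e by (auto simp: D0_def)
      hence "p ^ 2 dvd d" using e by (auto simp: power2_eq_square)
      moreover have "\<not> is_unit p" using p(1) not_prime_unit by blast
      ultimately have "\<not> squarefree d" by (rule not_squarefreeI)
      thus "moebius_mu d = 0" by (simp add: moebius_mu_def)
    qed
  qed (use fin D0 in \<open>auto simp: D0_def\<close>)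
  also have "\<dots> = (\<Sum>d\<in>D0. moebius_mu d) + (\<Sum>d\<in>(*) p ` D0. moebius_mu d)"
    using finite_subset[OF D0 fin] by (intro sum.union_disjoint) (auto simp: D0_def)
  also have "(\<Sum>d\<in>(*) p ` D0. moebius_mu d) = (\<Sum>d\<in>D0. - moebius_mu d)"
    using p D0 pos by (subst sum.reindex[OF inj]) (auto intro!: sum.cong moebius_mu_times_prime simp: D0_def)
  finally show ?thesis using False by (simp add: sum_negf)
qed

lemma sum_divisors_swap:
  fixes h :: "nat \<Rightarrow> nat \<Rightarrow> 'a :: comm_monoid_add"
  assumes "n > 0"
  shows "(\<Sum>e | e dvd n. \<Sum>d | d dvd n div e. h d e) = (\<Sum>d | d dvd n. \<Sum>e | e dvd n div d. h d e)"
proof -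
  have fin: "finite {d. d dvd m}" if "m dvd n" for m
    using that assms by (intro finite_divisors_nat) (auto intro: Nat.gr0I)
  have fin': "finite {d. d dvd n div m}" if "m dvd n" for m
    using that by (intro fin) (auto elim!: dvdE)
  have "(\<Sum>e | e dvd n. \<Sum>d | d dvd n div e. h d e) = (\<Sum>(e,d)\<in>{(e,d). e * d dvd n}. h d e)"
  proof (subst sum.Sigma)
    show "(\<Sum>(e,d)\<in>(SIGMA e:{e. e dvd n}. {d. d dvd n div e}). h d e) = (\<Sum>(e,d)\<in>{(e,d). e * d dvd n}. h d e)"
      using assms by (intro sum.cong) (auto simp: dvd_div_iff_mult mult.commute dest: dvd_mult_left dvd_mult_right)
  qed (use fin[of n] fin' in auto)
  also have "\<dots> = (\<Sum>(d,e)\<in>{(d,e). d * e dvd n}. h d e)"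
    by (rule sum.reindex_bij_witness[of _ prod.swap prod.swap]) (auto simp: mult.commute)
  also have "\<dots> = (\<Sum>d | d dvd n. \<Sum>e | e dvd n div d. h d e)"
  proof (subst sum.Sigma)
    show "(\<Sum>(d,e)\<in>{(d,e). d * e dvd n}. h d e) = (\<Sum>(d,e)\<in>(SIGMA d:{d. d dvd n}. {e. e dvd n div d}). h d e)"
      using assms by (intro sum.cong) (auto simp: dvd_div_iff_mult mult.commute dest: dvd_mult_left dvd_mult_right)
  qed (use fin[of n] fin' in auto)
  finally show ?thesis .
qed

text \<open>As U < n, the divisor e = n survives the restriction U < e. The condition n / e = 1 is
  expanded into a sum of Moebius values over d, which is split at \<open>U\<close>. For d \<le> U
  the sum over e is completed to all e, which gives the logarithm, and the part e \<le> U is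
  subtracted; d > U leaves the bilinear term.\<close>

lemma vaughan_identity:
  assumes n: "U < n"
  shows "mangoldt n =
      (\<Sum>d | d dvd n. of_bool (d \<le> U) * moebius_mu d * ln (real (n div d)))
    - (\<Sum>d | d dvd n. of_bool (d \<le> U) * moebius_mu d * (\<Sum>e | e dvd n div d. of_bool (e \<le> U) * mangoldt e))
    + (\<Sum>e | e dvd n. of_bool (U < e) * mangoldt e * (\<Sum>d | d dvd n div e. of_bool (U < d) * moebius_mu d))"
proof -
  have n0: "n > 0" using n by simp
  have pos: "n div d > 0" if "d dvd n" for d using that n0 by (auto elim!: dvdE)
  have fin: "finite {d. d dvd n}" using n0 by simp
  have "mangoldt n = (\<Sum>e\<in>{n}. of_bool (U < e) * mangoldt e * (if n div e = 1 then 1 else 0) :: real)"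
    using n by simp
  also have "\<dots> = (\<Sum>e | e dvd n. of_bool (U < e) * mangoldt e * (if n div e = 1 then 1 else 0))"
    using n0 fin by (intro sum.mono_neutral_left) (auto elim!: dvdE)
  also have "\<dots> = (\<Sum>e | e dvd n. of_bool (U < e) * mangoldt e * (\<Sum>d | d dvd n div e. moebius_mu d))"
    using pos by (intro sum.cong) (auto simp: sum_moebius_mu_divisors)
  also have "\<dots> = (\<Sum>e | e dvd n. (\<Sum>d | d dvd n div e. of_bool (U < e) * mangoldt e * (of_bool (d \<le> U) * moebius_mu d))
        + of_bool (U < e) * mangoldt e * (\<Sum>d | d dvd n div e. of_bool (U < d) * moebius_mu d))"
    unfolding sum_distrib_left sum.distrib[symmetric]
    by (intro sum.cong refl) (auto simp: of_bool_def)
  also have "\<dots> = (\<Sum>d | d dvd n. \<Sum>e | e dvd n div d. of_bool (U < e) * mangoldt e * (of_bool (d \<le> U) * moebius_mu d))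
     + (\<Sum>e | e dvd n. of_bool (U < e) * mangoldt e * (\<Sum>d | d dvd n div e. of_bool (U < d) * moebius_mu d))"
    unfolding sum.distrib by (subst sum_divisors_swap[OF n0]) simp
  also have "(\<Sum>d | d dvd n. \<Sum>e | e dvd n div d. of_bool (U < e) * mangoldt e * (of_bool (d \<le> U) * moebius_mu d))
     = (\<Sum>d | d dvd n. of_bool (d \<le> U) * moebius_mu d * ln (real (n div d))
          - of_bool (d \<le> U) * moebius_mu d * (\<Sum>e | e dvd n div d. of_bool (e \<le> U) * mangoldt e))"
  proof (intro sum.cong refl)
    fix d assume "d \<in> {d. d dvd n}"
    hence d: "n div d \<noteq> 0" using pos[of d] by simp
    have "(\<Sum>e | e dvd n div d. of_bool (U < e) * mangoldt e * (of_bool (d \<le> U) * moebius_mu d))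
        = of_bool (d \<le> U) * moebius_mu d * (\<Sum>e | e dvd n div d. mangoldt e - of_bool (e \<le> U) * mangoldt e)"
      unfolding sum_distrib_left by (intro sum.cong refl) (auto simp: of_bool_def)
    also have "(\<Sum>e | e dvd n div d. mangoldt e - of_bool (e \<le> U) * mangoldt e)
      = ln (real (n div d)) - (\<Sum>e | e dvd n div d. of_bool (e \<le> U) * mangoldt e)"
      using mangoldt_sum[OF d, where 'a = real] by (simp add: sum_subtractf)
    finally show "(\<Sum>e | e dvd n div d. of_bool (U < e) * mangoldt e * (of_bool (d \<le> U) * moebius_mu d))
        = of_bool (d \<le> U) * moebius_mu d * ln (real (n div d))
          - of_bool (d \<le> U) * moebius_mu d * (\<Sum>e | e dvd n div d. of_bool (e \<le> U) * mangoldt e)"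
      by (simp add: right_diff_distrib)
  qed
  finally show ?thesis by (simp add: sum_subtractf)
qed

section \<open>Divisor sums over intervals and mean values of arithmetic functions\<close>

lemma sum_divisors_interval:
  fixes G :: "nat \<Rightarrow> nat \<Rightarrow> 'a :: comm_monoid_add"
  shows "(\<Sum>n\<in>{x<..y}. \<Sum>d | d dvd n. G d (n div d)) = (\<Sum>d\<in>{1..y}. \<Sum>m\<in>{x div d<..y div d}. G d m)"
proof -
  have "(\<Sum>n\<in>{x<..y}. \<Sum>d | d dvd n. G d (n div d)) = (\<Sum>(n,d)\<in>(SIGMA n:{x<..y}. {d. d dvd n}). G d (n div d))"
    by (intro sum.Sigma) auto
  also have "\<dots> = (\<Sum>(d,m)\<in>(SIGMA d:{1..y}. {x div d<..y div d}). G d m)"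
  proof -
    have 1: "(d, n div d) \<in> (SIGMA d:{1..y}. {x div d<..y div d})" if *: "n \<in> {x<..y}" "d dvd n" for n d
    proof -
      have d: "d > 0" "d \<le> y" using * dvd_imp_le[of d n] by (cases "d = 0"; force)+
      from * obtain m where m: "n = d * m" by auto
      show ?thesis
        using * d by (auto simp: m div_less_iff_less_mult less_eq_div_iff_mult_less_eq mult.commute)
    qed
    have 2: "d * m \<in> {x<..y}" if "d \<in> {1..y}" "m \<in> {x div d<..y div d}" for d m
      using that by (auto simp: div_less_iff_less_mult less_eq_div_iff_mult_less_eq mult.commute)
    show ?thesis
      by (rule sum.reindex_bij_witness[of _ "\<lambda>(d,m). (d*m,d)" "\<lambda>(n,d). (d,n div d)"])
         (use 1 2 in auto)
  qed
  also have "\<dots> = (\<Sum>d\<in>{1..y}. \<Sum>m\<in>{x div d<..y div d}. G d m)"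
    by (intro sum.Sigma[symmetric]) auto
  finally show ?thesis .
qed

lemma harmonic_sum_le: "(\<Sum>i=1..n. 1 / real i) \<le> 1 + ln (real n)" if "n \<ge> 1"
  using that
proof (induction n rule: dec_induct)
  case (step n)
  have "ln (real n / real (Suc n)) \<le> real n / real (Suc n) - 1"
    using step by (intro ln_le_minus_one) auto
  hence "1 / real (Suc n) \<le> ln (real (Suc n)) - ln (real n)"
    using step by (simp add: ln_div field_simps)
  thus ?case using step by simp
qed simp

text \<open>The square counts pairs (d, e) whose lcm divides n, and such a pair occurs at most N
  gcd(d,e) / (d e) times up to N. With d = g a and e = g b this weight is N / (g a b), so three
  harmonic sums bound the total. Needed for the coefficients of the bilinear term of Vaughan's
  identity.\<close>

lemma sum_card_divisors_squared_le:
  assumes N: "N \<ge> 1"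
  shows "(\<Sum>n=1..N. real (card {d. d dvd n}) ^ 2) \<le> real N * (1 + ln (real N)) ^ 3"
proof -
  define H where "H = (\<Sum>i=1..N. 1 / real i)"
  have "(\<Sum>n=1..N. real (card {d. d dvd n}) ^ 2)
      = (\<Sum>n=1..N. \<Sum>(d,e)\<in>{1..N}\<times>{1..N}. of_bool (lcm d e dvd n))"
  proof (intro sum.cong refl)
    fix n assume n: "n \<in> {1..N}"
    have sub: "{d. d dvd n} \<subseteq> {1..N}"
    proof
      fix d assume "d \<in> {d. d dvd n}"
      thus "d \<in> {1..N}" using n dvd_imp_le[of d n] by (cases "d = 0") auto
    qed
    have "real (card {d. d dvd n}) ^ 2 = real (card ({d. d dvd n} \<times> {d. d dvd n}))"
      by (simp add: card_cartesian_product power2_eq_square)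
    also have "\<dots> = (\<Sum>(d,e)\<in>{d. d dvd n} \<times> {d. d dvd n}. 1)" by (simp add: split_def)
    also have "\<dots> = (\<Sum>(d,e)\<in>{1..N}\<times>{1..N}. of_bool (lcm d e dvd n))"
      using sub by (intro sum.mono_neutral_cong_left) (auto simp: lcm_least_iff)
    finally show "real (card {d. d dvd n}) ^ 2 = (\<Sum>(d,e)\<in>{1..N}\<times>{1..N}. of_bool (lcm d e dvd n))" .
  qed
  also have "\<dots> = (\<Sum>(d,e)\<in>{1..N}\<times>{1..N}. \<Sum>n=1..N. of_bool (lcm d e dvd n))"
    by (subst sum.swap) (simp add: split_def)
  also have "\<dots> \<le> (\<Sum>(d,e)\<in>{1..N}\<times>{1..N}. real N * (real (gcd d e) / (real d * real e)))"
  proof (intro sum_mono, clarify)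
    fix d e assume de: "d \<in> {1..N}" "e \<in> {1..N}"
    define l where "l = lcm d e"
    have l: "l > 0" using de by (simp add: l_def lcm_pos_nat)
    have "{n\<in>{1..N}. l dvd n} \<subseteq> (*) l ` {1..N div l}"
    proof
      fix n assume n: "n \<in> {n\<in>{1..N}. l dvd n}"
      then obtain m where m: "n = l * m" by auto
      moreover have "m \<in> {1..N div l}"
        using n l m by (auto simp: less_eq_div_iff_mult_less_eq mult.commute)
      ultimately show "n \<in> (*) l ` {1..N div l}" by blast
    qed
    hence "card {n\<in>{1..N}. l dvd n} \<le> N div l"
      using surj_card_le[of "{1..N div l}" _ "(*) l"] by simp
    hence "(\<Sum>n=1..N. of_bool (l dvd n)) \<le> real (N div l)"
      by (simp add: sum.If_cases of_bool_def Int_def)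
    also have "\<dots> \<le> real N / real l" by (rule of_nat_div_le_of_nat)
    also have "real l * real (gcd d e) = real d * real e"
      using prod_gcd_lcm_nat[of d e] by (simp add: l_def mult.commute flip: of_nat_mult)
    hence "real N / real l = real N * (real (gcd d e) / (real d * real e))"
      using l de by (simp add: field_simps)
    finally show "(\<Sum>n=1..N. of_bool (lcm d e dvd n)) \<le> real N * (real (gcd d e) / (real d * real e))"
      by (simp add: l_def)
  qed
  also have "\<dots> = real N * (\<Sum>(d,e)\<in>{1..N}\<times>{1..N}. real (gcd d e) / (real d * real e))"
    by (simp add: sum_distrib_left split_def)
  also have "(\<Sum>(d,e)\<in>{1..N}\<times>{1..N}. real (gcd d e) / (real d * real e)) \<le> H ^ 3"
  proof -
    define \<psi> where "\<psi> = (\<lambda>(d,e). (gcd d e, d div gcd d e, e div gcd d e :: nat))"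
    define w where "w = (\<lambda>(g::nat,a::nat,b::nat). 1 / real g * (1 / real a * (1 / real b)))"
    have inj: "inj_on \<psi> ({1..N}\<times>{1..N})"
      by (rule inj_on_inverseI[where g = "\<lambda>(g,a,b). (g*a,g*b)"]) (auto simp: \<psi>_def)
    have "(\<Sum>(d,e)\<in>{1..N}\<times>{1..N}. real (gcd d e) / (real d * real e)) = (\<Sum>de\<in>{1..N}\<times>{1..N}. w (\<psi> de))"
      by (intro sum.cong) (auto simp: \<psi>_def w_def real_of_nat_div field_simps)
    also have "\<dots> = sum w (\<psi> ` ({1..N}\<times>{1..N}))"
      by (simp only: sum.reindex[OF inj] o_def)
    also have "\<dots> \<le> sum w ({1..N}\<times>{1..N}\<times>{1..N})"
    proof (intro sum_mono2)
      show "\<psi> ` ({1..N}\<times>{1..N}) \<subseteq> {1..N}\<times>{1..N}\<times>{1..N}"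
      proof clarify
        fix d e g a b assume "d \<in> {1..N}" "e \<in> {1..N}" "(g,a,b) = \<psi> (d,e)"
        hence de: "1 \<le> d" "d \<le> N" "1 \<le> e" "e \<le> N" and g: "g = gcd d e" "a = d div gcd d e" "b = e div gcd d e"
          by (auto simp: \<psi>_def)
        have "gcd d e \<le> N" using gcd_le1_nat[of d e] de by linarith
        moreover have "gcd d e > 0" using de by simp
        ultimately show "g \<in> {1..N} \<and> (a,b) \<in> {1..N}\<times>{1..N}"
          using de div_le_dividend[of d "gcd d e"] div_le_dividend[of e "gcd d e"]
          by (auto simp: g Suc_le_eq div_greater_zero_iff simp del: div_le_dividend)
      qed
    qed (auto simp: w_def)
    also have "\<dots> = H * (H * H)"
      unfolding H_def w_def sum_product sum.cartesian_product
      by (simp add: split_def sum_distrib_left sum.cartesian_product' sum_product)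
    finally show ?thesis by (simp add: power3_eq_cube mult.assoc)
  qed
  also have "H ^ 3 \<le> (1 + ln (real N)) ^ 3"
    using harmonic_sum_le[OF N] by (intro power_mono) (auto simp: H_def intro: sum_nonneg)
  finally show ?thesis by (simp add: mult_left_mono)
qed

text \<open>Only p^j with j \<ge> 2 contributes. Then p is at most the square root of X and j at
  most ln X / ln 2, which is at most 2 ln X; each term weighs at most ln X.\<close>

lemma sum_mangoldt_nonprime_le:
  assumes X: "X \<ge> 1"
  shows "(\<Sum>n\<in>{n\<in>{1..X}. \<not> prime n}. mangoldt n) \<le> 2 * sqrt (real X) * ln (real X) ^ 2"
proof -
  define P where "P = {n\<in>{1..X}. primepow n \<and> \<not> prime n}"
  define s where "s = nat \<lfloor>sqrt (real X)\<rfloor>"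
  define L where "L = nat \<lfloor>ln (real X) / ln 2\<rfloor>"
  have lnX: "ln (real X) \<ge> 0" using X by simp
  have "P \<subseteq> (\<lambda>(p,j). p ^ j) ` ({1..s} \<times> {1..L})"
  proof
    fix n assume "n \<in> P"
    then obtain p j where pj: "prime p" "j > 0" "n = p ^ j" "n \<le> X" "\<not> prime n"
      by (auto simp: P_def primepow_def)
    have j: "j \<ge> 2" using pj by (cases "j = 1") auto
    have p: "p \<ge> 2" using pj prime_ge_2_nat by blast
    have "p ^ 2 \<le> p ^ j" using p j by (intro power_increasing) auto
    hence "p ^ 2 \<le> X" using pj by simp
    hence "real p ^ 2 \<le> real X" by (simp flip: of_nat_power)
    hence "real p \<le> sqrt (real X)" by (rule real_le_rsqrt)
    hence "p \<le> s" by (simp add: s_def le_nat_floor)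
    moreover have "2 ^ j \<le> p ^ j" using p by (intro power_mono) auto
    hence "2 ^ j \<le> X" using pj(3,4) by (metis order_trans)
    hence "(2::real) ^ j \<le> real X" by simp
    hence "ln ((2::real) ^ j) \<le> ln (real X)" using X by (subst ln_le_cancel_iff) auto
    hence "real j \<le> ln (real X) / ln 2" by (simp add: ln_realpow field_simps)
    hence "j \<le> L" by (simp add: L_def le_nat_floor)
    ultimately show "n \<in> (\<lambda>(p,j). p ^ j) ` ({1..s} \<times> {1..L})"
      using pj p by (auto intro!: image_eqI[of _ _ "(p,j)"])
  qed
  hence "card P \<le> card ((\<lambda>(p,j). p ^ j) ` ({1..s} \<times> {1..L}))" by (intro card_mono) auto
  also have "\<dots> \<le> s * L"
    using card_image_le[of "{1..s} \<times> {1..L}" "\<lambda>(p,j). p ^ j"] by (simp add: card_cartesian_product)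
  finally have "real (card P) \<le> real s * real L" by (simp flip: of_nat_mult)
  also have "\<dots> \<le> sqrt (real X) * (2 * ln (real X))"
  proof (intro mult_mono)
    show "real s \<le> sqrt (real X)" by (simp add: s_def)
    have "real L \<le> ln (real X) / ln 2" using lnX by (simp add: L_def)
    also have "(1/2::real) \<le> ln 2" using ln_le_minus_one[of "1/2::real"] by (simp add: ln_div)
    hence "ln (real X) / ln 2 \<le> ln (real X) / (1/2)" using lnX by (intro divide_left_mono) auto
    also have "\<dots> = 2 * ln (real X)" by simp
    finally show "real L \<le> 2 * ln (real X)" .
  qed (use lnX in auto)
  finally have card: "real (card P) \<le> sqrt (real X) * (2 * ln (real X))" .
  have "(\<Sum>n\<in>{n\<in>{1..X}. \<not> prime n}. mangoldt n) = (\<Sum>n\<in>P. mangoldt n :: real)"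
    by (intro sum.mono_neutral_right) (auto simp: P_def mangoldt_def)
  also have "\<dots> \<le> (\<Sum>n\<in>P. ln (real X))"
  proof (intro sum_mono)
    fix n assume "n \<in> P"
    hence n: "1 \<le> n" "n \<le> X" by (auto simp: P_def)
    have "mangoldt n \<le> ln (real n)" using n by (intro mangoldt_le) auto
    also have "\<dots> \<le> ln (real X)" using n by simp
    finally show "mangoldt n \<le> ln (real X)" .
  qed
  also have "\<dots> = real (card P) * ln (real X)" by simp
  also have "\<dots> \<le> sqrt (real X) * (2 * ln (real X)) * ln (real X)"
    using card lnX by (intro mult_right_mono)
  finally show ?thesis by (simp add: power2_eq_square mult_ac)
qed

section \<open>Chebyshev's lower bound from the central binomial coefficient\<close>

lemma ln_fact_eq_sum_mangoldt:
  assumes "N \<le> M"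
  shows "ln (fact N) = (\<Sum>d=1..M. mangoldt d * real (N div d))"
proof -
  have "ln (fact N) = (\<Sum>n\<in>{0<..N}. ln (real n))"
    unfolding fact_prod of_nat_prod by (subst ln_prod) (auto simp: atLeastSucAtMost_greaterThanAtMost)
  also have "\<dots> = (\<Sum>n\<in>{0<..N}. \<Sum>d | d dvd n. mangoldt d)"
    by (intro sum.cong refl mangoldt_sum[where 'a = real, simplified, symmetric]) auto
  also have "\<dots> = (\<Sum>d=1..N. mangoldt d * real (N div d))"
    by (subst sum_divisors_interval) (simp add: mult.commute)
  \<comment> \<open>For d > N the quotient \<open>N div d\<close> is 0. The free upper limit lets
    (2n)! and n! be expanded over the same range and compared term by term.\<close>
  also have "\<dots> = (\<Sum>d=1..M. mangoldt d * real (N div d))"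
    using assms by (intro sum.mono_neutral_left) auto
  finally show ?thesis .
qed

text \<open>In the logarithm of the central binomial coefficient each mangoldt value has the
  coefficient floor(2n/d) - 2 floor(n/d), which is at most 1. Hence that logarithm, at least n ln 4
  - ln(2n), is bounded by the sum of mangoldt up to 2n, where primes weigh at most ln(2n) and the
  other prime powers are bounded separately.\<close>

lemma prime_count_lower_bound:
  assumes n: "n \<ge> 1"
  shows "real n * ln 4 - ln (real (2 * n)) - 2 * sqrt (real (2*n)) * ln (real (2*n)) ^ 2
     \<le> real (card {p. prime p \<and> p \<le> 2 * n}) * ln (real (2 * n))"
proof -
  have "4 ^ n / (2 * real n) \<le> real ((2*n) choose n)" using n by (intro central_binomial_lower_bound) auto
  hence "ln (4 ^ n / (2 * real n)) \<le> ln (real ((2*n) choose n))" using n by (subst ln_le_cancel_iff) auto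
  hence "real n * ln 4 - ln (real (2 * n)) \<le> ln (real ((2*n) choose n))"
    using n by (simp add: ln_div ln_realpow)
  also have "real ((2*n) choose n) = fact (2*n) / (fact n * fact n)"
    using binomial_fact[of n "2*n", where 'a = real] by simp
  also have "ln \<dots> = ln (fact (2*n)) - 2 * ln (fact n)" by (simp add: ln_div ln_mult)
  also have "\<dots> = (\<Sum>d=1..2*n. mangoldt d * (real (2*n div d) - 2 * real (n div d)))"
    by (simp add: ln_fact_eq_sum_mangoldt[of _ "2*n"] right_diff_distrib sum_subtractf sum_distrib_left mult_ac)
  also have "\<dots> \<le> (\<Sum>d=1..2*n. mangoldt d * 1)"
  proof (intro sum_mono mult_left_mono mangoldt_nonneg)
    fix d assume d: "d \<in> {1..2*n}"
    have "2 * (d * (n div d) + n mod d) = d * (2 * (n div d)) + 2 * (n mod d)" by (simp only: algebra_simps)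
    hence "2*n = d * (2 * (n div d)) + 2 * (n mod d)" by simp
    moreover have "n mod d < d" using d by simp
    ultimately have "2 * n < d * (2 * (n div d) + 2)" by (simp add: algebra_simps)
    hence "2*n div d < 2 * (n div d) + 2" using d by (simp add: div_less_iff_less_mult mult.commute)
    thus "real (2*n div d) - 2 * real (n div d) \<le> 1" by simp
  qed
  also have "\<dots> = (\<Sum>d\<in>{1..2*n}. mangoldt d)" by simp
  also have "\<dots> = (\<Sum>d\<in>{d\<in>{1..2*n}. prime d}. mangoldt d) + (\<Sum>d\<in>{d\<in>{1..2*n}. \<not> prime d}. mangoldt d)"
    by (subst sum.union_disjoint[symmetric]) (auto intro!: sum.cong)
  also have "\<dots> \<le> (\<Sum>d\<in>{d\<in>{1..2*n}. prime d}. ln (real (2*n))) + 2 * sqrt (real (2*n)) * ln (real (2*n)) ^ 2"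
  proof (intro add_mono sum_mono sum_mangoldt_nonprime_le)
    fix d assume "d \<in> {d\<in>{1..2*n}. prime d}"
    thus "mangoldt d \<le> ln (real (2*n))" using mangoldt_le[of d] by (smt (verit) atLeastAtMost_iff ln_mono mem_Collect_eq of_nat_0_less_iff of_nat_le_iff less_eq_Suc_le One_nat_def)
  qed (use n in auto)
  also have "{d\<in>{1..2*n}. prime d} = {p. prime p \<and> p \<le> 2 * n}"
    by (auto simp: Suc_le_eq prime_gt_0_nat)
  finally show ?thesis by simp
qed

section \<open>Primes weighted by a power phase\<close>

text \<open>The additive character e(t) = exp(2 pi i t) at t = \<theta> n^c; in the application c =
  1/k, and \<theta> is 1/q or 2/q.\<close>

definition power_phase :: "real \<Rightarrow> real \<Rightarrow> nat \<Rightarrow> complex" where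
  "power_phase \<theta> c n = cis (2 * pi * (\<theta> * real n powr c))"

lemma norm_power_phase [simp]: "norm (power_phase \<theta> c n) = 1"
  by (simp add: power_phase_def)

text \<open>For m > x/d the phase increases per step by at most \<theta> c d x^(c-1), and c \<le>
  1/2 with d^2 \<le> x makes this at most 1/2. The left end \<open>A\<close> is free because partial
  summation against the logarithm calls for all tails of the sum.\<close>

lemma type_I_sum_bound:
  fixes c \<theta> :: real
  assumes c: "0 < c" "c \<le> 1/2" and \<theta>: "0 < \<theta>" "\<theta> \<le> 1"
    and d: "d \<ge> 1" "d\<^sup>2 \<le> x" and y: "y \<le> 2 * x"
    and A: "x div d < A" and B: "B \<le> y div d"
  shows "norm (\<Sum>m=A..B. power_phase \<theta> c (d * m)) \<le> 8 * real x powr (1 - c) / (c * \<theta> * real d)"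
proof (cases "A \<le> B")
  case False
  thus ?thesis using c \<theta> by simp
next
  case True
  define D where "D = \<theta> * real d powr c"
  have x: "x \<ge> 1" using d by (cases x) auto
  have D: "D > 0" using \<theta> d by (simp add: D_def)
  have "x < A * d" using A d by (simp add: div_less_iff_less_mult)
  hence A': "real x / real d \<le> real A" using d by (simp add: field_simps flip: of_nat_mult)
  have "real A powr (c - 1) \<le> (real x / real d) powr (c - 1)"
    using A' c d x by (intro powr_mono2') auto
  hence "D * c * real A powr (c - 1) \<le> D * c * (real x / real d) powr (c - 1)"
    using D c by (intro mult_left_mono) auto
  also have "\<dots> = \<theta> * (c * (real d * real x powr (c - 1)))"
    using d x by (simp add: D_def powr_divide powr_diff field_simps)
  also have "\<dots> \<le> 1 * (1/2 * 1)"
  proof (intro mult_mono)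
    have "real x powr (c - 1) \<le> real x powr (-(1/2))" using c x by (intro powr_mono) auto
    also have "\<dots> = 1 / sqrt (real x)" using x by (simp add: powr_minus_divide powr_half_sqrt)
    finally have "real d * real x powr (c - 1) \<le> real d * (1 / sqrt (real x))" by (intro mult_left_mono) auto
    also have "\<dots> \<le> 1"
    proof -
      have "real d ^ 2 \<le> real x" using d(2) by (simp flip: of_nat_power)
      hence "real d \<le> sqrt (real x)" by (rule real_le_rsqrt)
      thus ?thesis using x by simp
    qed
    finally show "real d * real x powr (c - 1) \<le> 1" .
  qed (use c \<theta> in auto)
  finally have small: "D * c * real A powr (c - 1) \<le> 1 / 2" by simp
  have "norm (\<Sum>m=A..B. power_phase \<theta> c (d * m)) = norm (\<Sum>m=A..B. cis (2 * pi * (D * real m powr c)))"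
    by (simp add: power_phase_def D_def powr_mult mult_ac)
  also have "\<dots> \<le> 4 * real B powr (1 - c) / (c * D)"
    using c D A True small by (intro exp_sum_powr_bound) auto
  also have "\<dots> \<le> 4 * (2 * (real x / real d) powr (1 - c)) / (c * D)"
  proof -
    have "B * d \<le> 2 * x" using B d y by (simp add: less_eq_div_iff_mult_less_eq)
    hence "real B * real d \<le> 2 * real x" by (simp flip: of_nat_mult)
    hence "real B \<le> 2 * (real x / real d)" using d by (simp add: field_simps)
    hence "real B powr (1 - c) \<le> (2 * (real x / real d)) powr (1 - c)" using c by (intro powr_mono2) auto
    also have "\<dots> = 2 powr (1 - c) * (real x / real d) powr (1 - c)" by (rule powr_mult)
    also have "\<dots> \<le> 2 powr 1 * (real x / real d) powr (1 - c)"
      using c by (intro mult_right_mono powr_mono) auto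
    finally show ?thesis using c D by (intro divide_right_mono) auto
  qed
  also have "\<dots> = 8 * real x powr (1 - c) / (c * \<theta> * real d)"
    using d x by (simp add: D_def powr_divide powr_diff field_simps)
  finally show ?thesis .
qed

text \<open>Abel summation: ln m is the sum of the nonnegative increments \<open>w j\<close> over j
  < m, so each increment multiplies a tail of the sum, and the increments add up to ln b.\<close>

lemma norm_sum_ln_le:
  fixes f :: "nat \<Rightarrow> complex"
  assumes "1 \<le> a" "1 \<le> b" and K: "\<And>A. a \<le> A \<Longrightarrow> norm (\<Sum>m=A..b. f m) \<le> K"
  shows "norm (\<Sum>m=a..b. ln (real m) * f m) \<le> ln (real b) * K"
proof -
  define w where "w j = ln (real (Suc j)) - ln (real j)" for j
  have tel: "ln (real m) = (\<Sum>j=1..<m. w j)" if "m \<ge> 1" for m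
    using that unfolding w_def by (subst sum_Suc_diff'[of 1 m "\<lambda>j. ln (real j)"]) auto
  have w: "w j \<ge> 0" if "j \<ge> 1" for j using that by (simp add: w_def)
  have "(\<Sum>m=a..b. ln (real m) * f m) = (\<Sum>m=a..b. \<Sum>j=1..<b. of_bool (j < m) * w j * f m)"
  proof (intro sum.cong refl)
    fix m assume m: "m \<in> {a..b}"
    have "ln (real m) = (\<Sum>j=1..<m. w j)" using m assms by (intro tel) auto
    also have "\<dots> = (\<Sum>j=1..<b. of_bool (j < m) * w j)"
      using m by (intro sum.mono_neutral_cong_left) auto
    finally show "ln (real m) * f m = (\<Sum>j=1..<b. of_bool (j < m) * w j * f m)"
      by (simp only: of_real_sum of_real_mult sum_distrib_right)
  qed
  also have "\<dots> = (\<Sum>j=1..<b. \<Sum>m=a..b. of_bool (j < m) * w j * f m)" by (rule sum.swap)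
  also have "\<dots> = (\<Sum>j=1..<b. w j * (\<Sum>m=max a (Suc j)..b. f m))"
  proof (intro sum.cong refl)
    fix j
    have "(\<Sum>m=a..b. of_bool (j < m) * w j * f m) = (\<Sum>m=max a (Suc j)..b. w j * f m)"
      by (intro sum.mono_neutral_cong_right) auto
    thus "(\<Sum>m=a..b. of_bool (j < m) * w j * f m) = w j * (\<Sum>m=max a (Suc j)..b. f m)"
      by (simp add: sum_distrib_left)
  qed
  also have "norm \<dots> \<le> (\<Sum>j=1..<b. w j * K)"
    using w K by (intro sum_norm_le) (auto simp: norm_mult intro!: mult_mono)
  also have "\<dots> = ln (real b) * K" using tel[of b] assms by (simp add: sum_distrib_right)
  finally show ?thesis .
qed

section \<open>Bilinear sums through correlations of phases\<close>

text \<open>Cauchy-Schwarz in n removes \<beta>; opening the square leaves the correlations of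
  \<open>Y m\<close> and \<open>Y m'\<close>. Bounding the product of two \<alpha> values by the
  mean of their squares and using the symmetry of \<open>G\<close> turns the double sum into row
  sums (Schur's test), so only mean squares of the coefficients enter.\<close>

lemma norm_sum_bilinear_squared_le:
  fixes \<alpha> \<beta> :: "nat \<Rightarrow> real" and Y :: "nat \<Rightarrow> nat \<Rightarrow> complex" and G :: "nat \<Rightarrow> nat \<Rightarrow> real"
  assumes fin: "finite P" "finite Q"
    and G: "\<And>m m'. m \<in> P \<Longrightarrow> m' \<in> P \<Longrightarrow> norm (\<Sum>n\<in>Q. Y m n * cnj (Y m' n)) \<le> G m m'"
    and Gsym: "\<And>m m'. G m m' = G m' m"
    and row: "\<And>m. m \<in> P \<Longrightarrow> (\<Sum>m'\<in>P. G m m') \<le> R"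
  shows "norm (\<Sum>m\<in>P. \<Sum>n\<in>Q. of_real (\<alpha> m * \<beta> n) * Y m n) ^ 2 \<le> (\<Sum>n\<in>Q. \<beta> n ^ 2) * ((\<Sum>m\<in>P. \<alpha> m ^ 2) * R)"
proof -
  define Z where "Z n = (\<Sum>m\<in>P. \<alpha> m * Y m n)" for n
  have "(\<Sum>m\<in>P. \<Sum>n\<in>Q. of_real (\<alpha> m * \<beta> n) * Y m n) = (\<Sum>n\<in>Q. \<beta> n * Z n)"
    by (subst sum.swap) (simp add: Z_def sum_distrib_left mult_ac)
  also have "norm \<dots> \<le> (\<Sum>n\<in>Q. \<bar>\<beta> n\<bar> * norm (Z n))"
    by (intro order_trans[OF norm_sum]) (simp add: norm_mult)
  finally have "norm (\<Sum>m\<in>P. \<Sum>n\<in>Q. of_real (\<alpha> m * \<beta> n) * Y m n) ^ 2 \<le> (\<Sum>n\<in>Q. \<bar>\<beta> n\<bar> * norm (Z n)) ^ 2"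
    by (intro power_mono) auto
  also have "\<dots> \<le> (\<Sum>n\<in>Q. \<bar>\<beta> n\<bar> ^ 2) * (\<Sum>n\<in>Q. norm (Z n) ^ 2)"
    by (rule Cauchy_Schwarz_ineq_sum)
  also have "(\<Sum>n\<in>Q. norm (Z n) ^ 2) \<le> (\<Sum>m\<in>P. \<alpha> m ^ 2) * R"
  proof -
    have "complex_of_real (\<Sum>n\<in>Q. norm (Z n) ^ 2) = (\<Sum>n\<in>Q. Z n * cnj (Z n))"
      by (simp only: of_real_sum complex_norm_square)
    also have "\<dots> = (\<Sum>n\<in>Q. \<Sum>m\<in>P. \<Sum>m'\<in>P. \<alpha> m * \<alpha> m' * (Y m n * cnj (Y m' n)))"
      by (simp add: Z_def sum_product mult_ac)
    also have "\<dots> = (\<Sum>m\<in>P. \<Sum>n\<in>Q. \<Sum>m'\<in>P. \<alpha> m * \<alpha> m' * (Y m n * cnj (Y m' n)))"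
      by (rule sum.swap)
    also have "\<dots> = (\<Sum>m\<in>P. \<Sum>m'\<in>P. \<alpha> m * \<alpha> m' * (\<Sum>n\<in>Q. Y m n * cnj (Y m' n)))"
      unfolding sum_distrib_left by (intro sum.cong refl sum.swap)
    finally have "(\<Sum>n\<in>Q. norm (Z n) ^ 2) = norm (\<Sum>m\<in>P. \<Sum>m'\<in>P. \<alpha> m * \<alpha> m' * (\<Sum>n\<in>Q. Y m n * cnj (Y m' n)))"
      by (metis (no_types, lifting) norm_of_real abs_of_nonneg sum_nonneg zero_le_power2)
    also have "\<dots> \<le> (\<Sum>m\<in>P. \<Sum>m'\<in>P. (\<alpha> m ^ 2 + \<alpha> m' ^ 2) / 2 * G m m')"
    proof (intro sum_norm_le)
      fix m m' assume m: "m \<in> P" "m' \<in> P"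
      have "0 \<le> (\<bar>\<alpha> m\<bar> - \<bar>\<alpha> m'\<bar>) ^ 2" by simp
      hence "\<bar>\<alpha> m\<bar> * \<bar>\<alpha> m'\<bar> \<le> (\<alpha> m ^ 2 + \<alpha> m' ^ 2) / 2"
        by (simp add: power2_diff)
      thus "norm (\<alpha> m * \<alpha> m' * (\<Sum>n\<in>Q. Y m n * cnj (Y m' n))) \<le> (\<alpha> m ^ 2 + \<alpha> m' ^ 2) / 2 * G m m'"
        unfolding norm_mult norm_of_real abs_mult using G[OF m] by (intro mult_mono) auto
    qed
    also have "\<dots> = ((\<Sum>m\<in>P. \<Sum>m'\<in>P. \<alpha> m ^ 2 * G m m') + (\<Sum>m\<in>P. \<Sum>m'\<in>P. \<alpha> m' ^ 2 * G m m')) / 2"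
      by (simp add: sum.distrib distrib_right add_divide_distrib sum_divide_distrib)
    also have "(\<Sum>m\<in>P. \<Sum>m'\<in>P. \<alpha> m' ^ 2 * G m m') = (\<Sum>m\<in>P. \<Sum>m'\<in>P. \<alpha> m ^ 2 * G m m')"
      by (subst sum.swap) (simp add: Gsym)
    also have "((\<Sum>m\<in>P. \<Sum>m'\<in>P. \<alpha> m ^ 2 * G m m') + (\<Sum>m\<in>P. \<Sum>m'\<in>P. \<alpha> m ^ 2 * G m m')) / 2
        = (\<Sum>m\<in>P. \<alpha> m ^ 2 * (\<Sum>m'\<in>P. G m m'))"
    proof -
      have "(t + t) / 2 = t" for t :: real by simp
      thus ?thesis by (simp only: sum_distrib_left)
    qed
    also have "\<dots> \<le> (\<Sum>m\<in>P. \<alpha> m ^ 2 * R)" using row by (intro sum_mono mult_left_mono) auto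
    finally show ?thesis by (simp add: sum_distrib_right)
  qed
  hence "(\<Sum>n\<in>Q. \<bar>\<beta> n\<bar> ^ 2) * (\<Sum>n\<in>Q. norm (Z n) ^ 2) \<le> (\<Sum>n\<in>Q. \<bar>\<beta> n\<bar> ^ 2) * ((\<Sum>m\<in>P. \<alpha> m ^ 2) * R)"
    by (intro mult_left_mono sum_nonneg) auto
  finally show ?thesis by simp
qed

text \<open>The product of the two phases is e(D n^c) with D = \<theta> (m1^c - m2^c), comparable to
  c \<theta> m1^(c-1) (m1 - m2); this is the source of the decay in m1 - m2. Since m1 \<le> 2 m2, D
  is at most c m2^c, and m2^2 \<le> 4 x then keeps the increments at most 1/2.\<close>

lemma correlation_bound:
  fixes c \<theta> :: real
  assumes c: "0 < c" "c \<le> 1/2" and \<theta>: "0 < \<theta>" "\<theta> \<le> 1"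
    and x: "x \<ge> 1" and y: "y \<le> 2 * x"
    and m: "1 \<le> m2" "m2 < m1" "m1 \<le> 2 * m2" "m2\<^sup>2 \<le> 4 * x"
  shows "norm (\<Sum>n=1..N. of_bool (x < m1 * n \<and> m1 * n \<le> y) * power_phase \<theta> c (m1 * n) *
            cnj (of_bool (x < m2 * n \<and> m2 * n \<le> y) * power_phase \<theta> c (m2 * n)))
     \<le> 8 * real x powr (1 - c) / (c\<^sup>2 * \<theta> * (real m1 - real m2))"
proof -
  define D where "D = \<theta> * (real m1 powr c - real m2 powr c)"
  define A where "A = Suc (x div m2)"
  define B where "B = min N (y div m1)"
  have lo: "c * real m1 powr (c - 1) * (real m1 - real m2) \<le> real m1 powr c - real m2 powr c"
    and hi: "real m1 powr c - real m2 powr c \<le> c * real m2 powr (c - 1) * (real m1 - real m2)"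
    using powr_diff_bounds[of c "real m2" "real m1"] c m by auto
  have pos: "0 < c * real m1 powr (c - 1) * (real m1 - real m2)" using c m by simp
  hence D: "D > 0" using lo \<theta> by (simp add: D_def)
  \<comment> \<open>As m2 < m1, only the lower bound from \<open>m2\<close> and the upper bound from
    \<open>m1\<close> bind, so n runs through the single interval from \<open>A\<close> to
    \<open>B\<close>.\<close>
  have iff: "(x < m1 * n \<and> m1 * n \<le> y) \<and> (x < m2 * n \<and> m2 * n \<le> y) \<longleftrightarrow> x < m2 * n \<and> m1 * n \<le> y" for n
    using mult_le_mono1[of m2 m1 n] m(2) by linarith
  have "(\<Sum>n=1..N. of_bool (x < m1 * n \<and> m1 * n \<le> y) * power_phase \<theta> c (m1 * n) *
            cnj (of_bool (x < m2 * n \<and> m2 * n \<le> y) * power_phase \<theta> c (m2 * n)))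
      = (\<Sum>n=1..N. of_bool (x < m2 * n \<and> m1 * n \<le> y) * cis (2 * pi * (D * real n powr c)))"
  proof (intro sum.cong refl)
    fix n
    have "power_phase \<theta> c (m1 * n) * cnj (power_phase \<theta> c (m2 * n)) = cis (2 * pi * (D * real n powr c))"
      by (simp add: power_phase_def D_def cis_cnj cis_mult powr_mult algebra_simps)
    thus "of_bool (x < m1 * n \<and> m1 * n \<le> y) * power_phase \<theta> c (m1 * n) *
            cnj (of_bool (x < m2 * n \<and> m2 * n \<le> y) * power_phase \<theta> c (m2 * n))
      = of_bool (x < m2 * n \<and> m1 * n \<le> y) * cis (2 * pi * (D * real n powr c))"
      using iff[of n] by (auto simp: of_bool_def)
  qed
  also have "\<dots> = (\<Sum>n=A..B. cis (2 * pi * (D * real n powr c)))"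
    using m by (intro sum.mono_neutral_cong_right)
       (auto simp: A_def B_def less_eq_div_iff_mult_less_eq div_less_iff_less_mult Suc_le_eq mult.commute not_less)
  also have "norm \<dots> \<le> 8 * real x powr (1 - c) / (c\<^sup>2 * \<theta> * (real m1 - real m2))"
  proof (cases "A \<le> B")
    case False
    thus ?thesis using c \<theta> m by simp
  next
    case True
    have "x < A * m2" using m dividend_less_div_times[of m2 x] by (simp add: A_def)
    hence A': "real x / real m2 \<le> real A" using m by (simp add: field_simps flip: of_nat_mult)
    have "D \<le> 1 * (c * real m2 powr (c - 1) * (real m1 - real m2))"
      unfolding D_def using hi \<theta> lo pos by (intro mult_mono) auto
    also have "\<dots> \<le> 1 * (c * real m2 powr (c - 1) * real m2)"
      using m c by (intro mult_left_mono mult_nonneg_nonneg) auto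
    also have "\<dots> = c * real m2 powr c" using m by (simp add: powr_diff)
    finally have Dle: "D \<le> c * real m2 powr c" .
    have "real A powr (c - 1) \<le> (real x / real m2) powr (c - 1)"
      using A' c m x by (intro powr_mono2') auto
    hence "D * c * real A powr (c - 1) \<le> (c * real m2 powr c) * c * (real x / real m2) powr (c - 1)"
      using D c Dle by (intro mult_mono) auto
    also have "\<dots> = c * c * (real m2 * real x powr (c - 1))"
      using m x by (simp add: powr_divide powr_diff field_simps)
    also have "\<dots> \<le> 1/2 * (1/2) * 2"
    proof (intro mult_mono)
      have "real x powr (c - 1) \<le> real x powr (-(1/2))" using c x by (intro powr_mono) auto
      also have "\<dots> = 1 / sqrt (real x)" using x by (simp add: powr_minus_divide powr_half_sqrt)
      finally have "real m2 * real x powr (c - 1) \<le> real m2 * (1 / sqrt (real x))" by (intro mult_left_mono) auto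
      also have "\<dots> \<le> 2"
      proof -
        have "real m2 ^ 2 \<le> 4 * real x" using m(4) by (metis of_nat_le_iff of_nat_mult of_nat_numeral of_nat_power)
        hence "real m2 \<le> sqrt (4 * real x)" by (rule real_le_rsqrt)
        also have "\<dots> = 2 * sqrt (real x)" by (simp add: real_sqrt_mult)
        finally show ?thesis using x by (simp add: field_simps)
      qed
      finally show "real m2 * real x powr (c - 1) \<le> 2" .
    qed (use c in auto)
    finally have small: "D * c * real A powr (c - 1) \<le> 1 / 2" by simp
    have "norm (\<Sum>n=A..B. cis (2 * pi * (D * real n powr c))) \<le> 4 * real B powr (1 - c) / (c * D)"
      using c D True small by (intro exp_sum_powr_bound) (auto simp: A_def)
    also have "\<dots> \<le> 4 * (2 * (real x / real m1) powr (1 - c)) / (c * (\<theta> * (c * real m1 powr (c - 1) * (real m1 - real m2))))"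
    proof (intro frac_le mult_left_mono)
      have "B * m1 \<le> 2 * x" using m y by (auto simp: B_def min_le_iff_disj simp flip: less_eq_div_iff_mult_less_eq intro: order_trans[OF _ div_le_mono[OF y]])
      hence "real B * real m1 \<le> 2 * real x" by (simp flip: of_nat_mult)
      hence "real B \<le> 2 * (real x / real m1)" using m by (simp add: field_simps)
      hence "real B powr (1 - c) \<le> (2 * (real x / real m1)) powr (1 - c)" using c by (intro powr_mono2) auto
      also have "\<dots> = 2 powr (1 - c) * (real x / real m1) powr (1 - c)" by (rule powr_mult)
      also have "\<dots> \<le> 2 powr 1 * (real x / real m1) powr (1 - c)"
        using c by (intro mult_right_mono powr_mono) auto
      finally show "real B powr (1 - c) \<le> 2 * (real x / real m1) powr (1 - c)" by simp
      show "\<theta> * (c * real m1 powr (c - 1) * (real m1 - real m2)) \<le> D"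
        unfolding D_def using lo \<theta> by (intro mult_left_mono) auto
    qed (use c \<theta> m pos in auto)
    also have "\<dots> = 8 * real x powr (1 - c) / (c\<^sup>2 * \<theta> * (real m1 - real m2))"
    proof -
      define \<delta> where "\<delta> = real m1 - real m2"
      have "\<delta> > 0" using m by (simp add: \<delta>_def)
      thus ?thesis unfolding \<delta>_def[symmetric]
        using m x by (simp add: powr_divide powr_diff field_simps power2_eq_square)
    qed
    finally show ?thesis .
  qed
  finally show ?thesis .
qed

lemma sum_inverse_distance_le:
  assumes P: "P \<subseteq> {1..T}" and m: "m \<in> {1..T}"
  shows "(\<Sum>m'\<in>P - {m}. 1 / \<bar>real m - real m'\<bar>) \<le> 2 * (1 + ln (real T))"
proof -
  have fin: "finite P" using P finite_subset by blast
  have H: "(\<Sum>i=1..T. 1 / real i) \<le> 1 + ln (real T)" using m by (intro harmonic_sum_le) auto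
  have "(\<Sum>m'\<in>P \<inter> {..<m}. 1 / \<bar>real m - real m'\<bar>) = (\<Sum>i\<in>(\<lambda>m'. m - m') ` (P \<inter> {..<m}). 1 / real i)"
    by (subst sum.reindex) (auto simp: inj_on_def of_nat_diff intro!: sum.cong)
  also have "\<dots> \<le> (\<Sum>i=1..T. 1 / real i)"
    using m by (intro sum_mono2) auto
  finally have 1: "(\<Sum>m'\<in>P \<inter> {..<m}. 1 / \<bar>real m - real m'\<bar>) \<le> 1 + ln (real T)" using H by linarith
  have "(\<Sum>m'\<in>P \<inter> {m<..}. 1 / \<bar>real m - real m'\<bar>) = (\<Sum>i\<in>(\<lambda>m'. m' - m) ` (P \<inter> {m<..}). 1 / real i)"
    by (subst sum.reindex) (auto simp: inj_on_def of_nat_diff intro!: sum.cong)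
  also have "\<dots> \<le> (\<Sum>i=1..T. 1 / real i)"
  proof (intro sum_mono2)
    show "(\<lambda>m'. m' - m) ` (P \<inter> {m<..}) \<subseteq> {1..T}"
    proof clarify
      fix m' assume "m' \<in> P" "m < m'"
      thus "m' - m \<in> {1..T}" using P by force
    qed
  qed auto
  finally have 2: "(\<Sum>m'\<in>P \<inter> {m<..}. 1 / \<bar>real m - real m'\<bar>) \<le> 1 + ln (real T)" using H by linarith
  have eq: "P - {m} = (P \<inter> {..<m}) \<union> (P \<inter> {m<..})" by auto
  have sumeq: "(\<Sum>m'\<in>P - {m}. 1 / \<bar>real m - real m'\<bar>)
      = (\<Sum>m'\<in>P \<inter> {..<m}. 1 / \<bar>real m - real m'\<bar>) + (\<Sum>m'\<in>P \<inter> {m<..}. 1 / \<bar>real m - real m'\<bar>)"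
    unfolding eq using fin by (intro sum.union_disjoint) auto
  show ?thesis using add_mono[OF 1 2] by (simp only: sumeq mult_2)
qed

text \<open>The cutoff is part of the phase, so both variables can range over a rectangle, as
  Cauchy-Schwarz requires, and their roles can be exchanged.\<close>

definition hyperbola_phase :: "real \<Rightarrow> real \<Rightarrow> nat \<Rightarrow> nat \<Rightarrow> nat \<Rightarrow> nat \<Rightarrow> complex" where
  "hyperbola_phase \<theta> c x y m n = of_bool (x < m * n \<and> m * n \<le> y) * power_phase \<theta> c (m * n)"

lemma hyperbola_phase_commute: "hyperbola_phase \<theta> c x y m n = hyperbola_phase \<theta> c x y n m"
  by (simp add: hyperbola_phase_def mult.commute)

text \<open>The diagonal of \<open>G\<close> counts the n with m n \<le> y. Off the diagonal
  \<open>correlation_bound\<close> applies, because two elements of a dyadic block differ by at most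
  a factor 2; its decay in the distance sums to a logarithm along each row.\<close>

lemma type_II_sum_block:
  fixes c \<theta> :: real
  assumes c: "0 < c" "c \<le> 1/2" and \<theta>: "0 < \<theta>" "\<theta> \<le> 1"
    and x: "x \<ge> 1" and y: "y \<le> 2 * x"
    and M: "M \<ge> 1" and P: "P \<subseteq> {M<..2*M}" "\<And>m. m \<in> P \<Longrightarrow> m\<^sup>2 \<le> 4 * x"
  shows "norm (\<Sum>m\<in>P. \<Sum>n=1..N. of_real (\<alpha> m * \<beta> n) * hyperbola_phase \<theta> c x y m n) ^ 2
    \<le> (\<Sum>n=1..N. \<beta> n ^ 2) * ((\<Sum>m\<in>P. \<alpha> m ^ 2) *
         (2 * real x / real M + 16 * real x powr (1 - c) * (1 + ln (real (2 * M))) / (c\<^sup>2 * \<theta>)))"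
proof -
  define K where "K = 8 * real x powr (1 - c) / (c\<^sup>2 * \<theta>)"
  define G where "G m m' = (if m = m' then 2 * real x / real M else K / \<bar>real m - real m'\<bar>)" for m m' :: nat
  have K: "K \<ge> 0" using c \<theta> by (simp add: K_def)
  have finP: "finite P" using P finite_subset by blast
  show ?thesis
  proof (rule norm_sum_bilinear_squared_le[where G = G])
    fix m m' assume m: "m \<in> P" "m' \<in> P"
    have ineq: "norm (\<Sum>n=1..N. hyperbola_phase \<theta> c x y m1 n * cnj (hyperbola_phase \<theta> c x y m2 n)) \<le> K / \<bar>real m1 - real m2\<bar>"
      if "m2 < m1" "m1 \<in> P" "m2 \<in> P" for m1 m2
    proof -
      have "m1 \<le> 2 * M" "M < m2" using that P(1) by auto
      hence "norm (\<Sum>n=1..N. hyperbola_phase \<theta> c x y m1 n * cnj (hyperbola_phase \<theta> c x y m2 n))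
         \<le> 8 * real x powr (1 - c) / (c\<^sup>2 * \<theta> * (real m1 - real m2))"
        unfolding hyperbola_phase_def using that P(2)[OF that(3)] by (intro correlation_bound c \<theta> x y) auto
      thus ?thesis using that by (simp add: K_def)
    qed
    consider "m = m'" | "m' < m" | "m < m'" by linarith
    thus "norm (\<Sum>n=1..N. hyperbola_phase \<theta> c x y m n * cnj (hyperbola_phase \<theta> c x y m' n)) \<le> G m m'"
    proof cases
      case 1
      have "norm (\<Sum>n=1..N. hyperbola_phase \<theta> c x y m n * cnj (hyperbola_phase \<theta> c x y m' n)) \<le> (\<Sum>n=1..N. of_bool (m * n \<le> y))"
        by (intro sum_norm_le) (auto simp: hyperbola_phase_def norm_mult)
      also have "\<dots> = real (card {n\<in>{1..N}. m * n \<le> y})" by (simp add: of_bool_def sum.If_cases Int_def)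
      also have "\<dots> \<le> real (card {1..y div m})"
        using m P(1) by (intro of_nat_mono card_mono) (auto simp: less_eq_div_iff_mult_less_eq mult.commute)
      also have "\<dots> \<le> real y / real m" by (simp add: of_nat_div_le_of_nat)
      also have "\<dots> \<le> 2 * real x / real M"
        using m P(1) M y by (intro frac_le) auto
      finally show ?thesis using 1 by (simp add: G_def)
    next
      case 2
      thus ?thesis using ineq[of m' m] m by (simp add: G_def)
    next
      case 3
      have "(\<Sum>n=1..N. hyperbola_phase \<theta> c x y m n * cnj (hyperbola_phase \<theta> c x y m' n))
         = cnj (\<Sum>n=1..N. hyperbola_phase \<theta> c x y m' n * cnj (hyperbola_phase \<theta> c x y m n))" by (simp add: mult.commute)
      hence "norm (\<Sum>n=1..N. hyperbola_phase \<theta> c x y m n * cnj (hyperbola_phase \<theta> c x y m' n))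
         = norm (\<Sum>n=1..N. hyperbola_phase \<theta> c x y m' n * cnj (hyperbola_phase \<theta> c x y m n))" by (simp only: complex_mod_cnj)
      thus ?thesis using 3 ineq[of m m'] m by (simp add: G_def abs_minus_commute)
    qed
  next
    fix m assume m: "m \<in> P"
    have "(\<Sum>m'\<in>P. G m m') = G m m + (\<Sum>m'\<in>P-{m}. G m m')"
      using m finP by (simp add: sum.remove)
    also have "(\<Sum>m'\<in>P-{m}. G m m') = K * (\<Sum>m'\<in>P-{m}. 1 / \<bar>real m - real m'\<bar>)"
      unfolding sum_distrib_left by (intro sum.cong) (auto simp: G_def)
    also have "\<dots> \<le> K * (2 * (1 + ln (real (2 * M))))"
      using P(1) m K by (intro mult_left_mono sum_inverse_distance_le) auto
    also have "K * (2 * (1 + ln (real (2 * M)))) = 16 * real x powr (1 - c) * (1 + ln (real (2 * M))) / (c\<^sup>2 * \<theta>)"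
      unfolding K_def by (simp only: times_divide_eq_left)
    finally show "(\<Sum>m'\<in>P. G m m') \<le> 2 * real x / real M + 16 * real x powr (1 - c) * (1 + ln (real (2 * M))) / (c\<^sup>2 * \<theta>)"
      by (simp add: G_def)
  qed (use finP in \<open>auto simp: G_def abs_minus_commute\<close>)
qed

lemma sum_dyadic_blocks:
  fixes h :: "nat \<Rightarrow> 'a :: comm_monoid_add"
  shows "(\<Sum>m\<in>{U<..2^K*U}. h m) = (\<Sum>i<K. \<Sum>m\<in>{2^i*U<..2*(2^i*U)}. h m)"
proof (induction K)
  case (Suc K)
  define V where "V = 2^K*U"
  have "U \<le> V" by (simp add: V_def)
  hence "{U<..2*V} = {U<..V} \<union> {V<..2*V}" by auto
  hence "{U<..2^Suc K*U} = {U<..2^K*U} \<union> {2^K*U<..2*(2^K*U)}" by (simp add: V_def mult.assoc)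
  moreover have "(\<Sum>m\<in>{U<..2^K*U} \<union> {2^K*U<..2*(2^K*U)}. h m) = (\<Sum>m\<in>{U<..2^K*U}. h m) + (\<Sum>m\<in>{2^K*U<..2*(2^K*U)}. h m)"
    by (intro sum.union_disjoint) auto
  ultimately show ?case using Suc.IH by simp
qed simp

text \<open>In the block at M the other variable is at most N = y div M, so the two mean squares
  together contribute about N M, at most 2 x, times E^2. The diagonal x / M is at most 2 x^(1-c/4)
  because M \<ge> U. The square root of x times x^(1-c/4) is the x^(1-c/8) of the result.\<close>

lemma type_II_sum_half:
  fixes c \<theta> E :: real and \<alpha> \<beta> :: "nat \<Rightarrow> real" and x y :: nat
  defines "L \<equiv> 1 + ln (real y)"
  assumes c: "0 < c" "c \<le> 1/2" and \<theta>: "0 < \<theta>" "\<theta> \<le> 1"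
    and x: "x \<ge> 1" and xy: "x \<le> y" "y \<le> 2 * x"
    and U: "U \<ge> 1" "real x powr (c/4) \<le> 2 * real U"
    and \<alpha>0: "\<And>m. m \<le> U \<or> 4 * x < m\<^sup>2 \<Longrightarrow> \<alpha> m = 0"
    and E: "\<And>t. 1 \<le> t \<Longrightarrow> t \<le> y \<Longrightarrow> (\<Sum>m=1..t. \<alpha> m ^ 2) \<le> real t * E"
      "\<And>t. 1 \<le> t \<Longrightarrow> t \<le> y \<Longrightarrow> (\<Sum>m=1..t. \<beta> m ^ 2) \<le> real t * E"
  shows "norm (\<Sum>m=1..y. \<Sum>n=1..y. of_real (\<alpha> m * \<beta> n) * hyperbola_phase \<theta> c x y m n) \<le> 24 * E * L^2 * real x powr (1 - c/8) / (c * \<theta>)"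
proof -
  have y1: "y \<ge> 1" using x xy by linarith
  have L: "L \<ge> 1" using y1 by (simp add: L_def)
  have E0: "E \<ge> 0"
  proof -
    have "0 \<le> (\<Sum>m=1..1. \<alpha> m ^ 2)" by simp
    also have "\<dots> \<le> real 1 * E" by (rule E(1)) (use y1 in auto)
    finally show ?thesis by simp
  qed
  define K where "K = Suc (nat \<lfloor>ln (real y) / ln 2\<rfloor>)"
  define T where "T m = (\<Sum>n=1..y. of_real (\<alpha> m * \<beta> n) * hyperbola_phase \<theta> c x y m n)" for m
  \<comment> \<open>The dyadic blocks overshoot y, so the summand is cut off; the cutoff also
    supplies the condition on m^2 that \<open>type_II_sum_block\<close> demands.\<close>
  define h where "h m = (if m \<le> y \<and> m\<^sup>2 \<le> 4 * x then T m else 0)" for m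
  \<comment> \<open>12 is the square root of 144 = 2 * 36 * 2, collected from the block estimate
    below; the at most 2 L blocks turn it into 24.\<close>
  define B where "B = 12 * E * L * real x powr (1 - c/8) / (c * \<theta>)"
  have B0: "B \<ge> 0" using E0 L c \<theta> by (simp add: B_def)
  have lny: "ln (real y) \<ge> 0" using y1 by simp
  have yK: "y \<le> 2 ^ K"
  proof -
    have "ln (real y) / ln 2 \<le> real K" using lny by (simp add: K_def) linarith
    hence "ln (real y) \<le> ln (2 ^ K)" by (simp add: ln_realpow field_simps)
    hence "real y \<le> 2 ^ K" using y1 by (subst (asm) ln_le_cancel_iff) auto
    thus ?thesis by simp
  qed
  have K: "real K \<le> 2 * L"
  proof -
    have "(1/2::real) \<le> ln 2" using ln_le_minus_one[of "1/2::real"] by (simp add: ln_div)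
    hence "ln (real y) / ln 2 \<le> ln (real y) / (1/2)" using lny by (intro divide_left_mono) auto
    moreover have "real (nat \<lfloor>ln (real y) / ln 2\<rfloor>) \<le> ln (real y) / ln 2" using lny by simp
    ultimately show ?thesis by (simp add: K_def L_def)
  qed
  have block: "norm (\<Sum>m\<in>{2^i*U<..2*(2^i*U)}. h m) \<le> B" for i
  proof -
    define M where "M = 2^i * U"
    define P where "P = {M<..2*M} \<inter> {m. m \<le> y \<and> m\<^sup>2 \<le> 4 * x}"
    have M: "M \<ge> 1" "M \<ge> U" using U by (auto simp: M_def)
    have eq: "(\<Sum>m\<in>{M<..2*M}. h m) = (\<Sum>m\<in>P. T m)"
      by (intro sum.mono_neutral_cong_right) (auto simp: P_def h_def)
    show ?thesis
    proof (cases "P = {}")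
      case True
      thus ?thesis using eq B0 by (simp add: M_def)
    next
      case False
      hence My: "M < y" by (auto simp: P_def)
      define N where "N = y div M"
      define t where "t = min (2*M) y"
      have N: "1 \<le> N" "N \<le> y" using My M by (auto simp: N_def less_eq_div_iff_mult_less_eq Suc_le_eq div_greater_zero_iff)
      have "T m = (\<Sum>n=1..N. of_real (\<alpha> m * \<beta> n) * hyperbola_phase \<theta> c x y m n)" if "m \<in> P" for m
        unfolding T_def
      proof (rule sum.mono_neutral_right)
        show "\<forall>n\<in>{1..y} - {1..N}. of_real (\<alpha> m * \<beta> n) * hyperbola_phase \<theta> c x y m n = 0"
        proof
          fix n assume "n \<in> {1..y} - {1..N}"
          hence "N < n" by auto
          hence "y < n * M" using M by (simp add: N_def div_less_iff_less_mult)
          also have "\<dots> \<le> m * n" using that by (auto simp: P_def)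
          finally show "of_real (\<alpha> m * \<beta> n) * hyperbola_phase \<theta> c x y m n = 0" by (simp add: hyperbola_phase_def)
        qed
      qed (use N in auto)
      hence "norm (\<Sum>m\<in>P. T m) ^ 2 = norm (\<Sum>m\<in>P. \<Sum>n=1..N. of_real (\<alpha> m * \<beta> n) * hyperbola_phase \<theta> c x y m n) ^ 2" by simp
      also have "\<dots> \<le> (\<Sum>n=1..N. \<beta> n ^ 2) * ((\<Sum>m\<in>P. \<alpha> m ^ 2) *
         (2 * real x / real M + 16 * real x powr (1 - c) * (1 + ln (real (2 * M))) / (c\<^sup>2 * \<theta>)))"
        using M xy by (intro type_II_sum_block c \<theta> x) (auto simp: P_def)
      also have "\<dots> \<le> (real N * E) * ((real (2 * M) * E) * (36 * real x powr (1 - c/4) * L / (c\<^sup>2 * \<theta>)))"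
      proof (intro mult_mono)
        show "(\<Sum>n=1..N. \<beta> n ^ 2) \<le> real N * E" using N by (intro E) auto
        have "(\<Sum>m\<in>P. \<alpha> m ^ 2) \<le> (\<Sum>m=1..t. \<alpha> m ^ 2)"
          by (intro sum_mono2) (auto simp: P_def t_def)
        also have "\<dots> \<le> real t * E" using M y1 by (intro E) (auto simp: t_def)
        also have "\<dots> \<le> real (2 * M) * E" using E0 by (intro mult_right_mono of_nat_mono) (auto simp: t_def)
        finally show "(\<Sum>m\<in>P. \<alpha> m ^ 2) \<le> real (2 * M) * E" .
        have c2: "0 < c\<^sup>2 * \<theta>" "c\<^sup>2 * \<theta> \<le> 1"
          using c \<theta> mult_le_one[of "c\<^sup>2" \<theta>] power_le_one[of c 2] by auto
        have xp: "real x powr (1 - c) \<le> real x powr (1 - c/4)" using x c by (intro powr_mono) auto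
        have "real x / real M \<le> real x / (real x powr (c/4) / 2)"
          using M U x by (intro divide_left_mono) auto
        also have "\<dots> = 2 * real x powr (1 - c/4)" using x by (simp add: powr_diff)
        finally have 1: "2 * real x / real M \<le> 4 * real x powr (1 - c/4)" by simp
        also have "\<dots> \<le> 4 * real x powr (1 - c/4) * (L / (c\<^sup>2 * \<theta>))"
        proof -
          have "1 * (c\<^sup>2 * \<theta>) \<le> L" using c2 L by linarith
          hence "1 \<le> L / (c\<^sup>2 * \<theta>)" using c2 by (simp add: pos_le_divide_eq)
          thus ?thesis using mult_left_mono[of 1 "L / (c\<^sup>2 * \<theta>)" "4 * real x powr (1 - c/4)"] by simp
        qed
        finally have 1: "2 * real x / real M \<le> 4 * real x powr (1 - c/4) * L / (c\<^sup>2 * \<theta>)" by simp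
        have "ln (real (2 * M)) \<le> ln (2 * real y)" using M My by (subst ln_le_cancel_iff) auto
        also have "\<dots> = ln 2 + ln (real y)" using y1 by (simp add: ln_mult)
        also have "ln (2::real) \<le> 1" using ln_le_minus_one[of "2::real"] by simp
        finally have "1 + ln (real (2 * M)) \<le> 2 * L" using L by (simp add: L_def)
        hence "16 * real x powr (1 - c) * (1 + ln (real (2 * M))) / (c\<^sup>2 * \<theta>) \<le> 16 * real x powr (1 - c/4) * (2 * L) / (c\<^sup>2 * \<theta>)"
          using xp c2 M L by (intro divide_right_mono mult_mono) (auto intro!: add_nonneg_nonneg)
        with 1 have "2 * real x / real M + 16 * real x powr (1 - c) * (1 + ln (real (2 * M))) / (c\<^sup>2 * \<theta>)
          \<le> 4 * real x powr (1 - c/4) * L / (c\<^sup>2 * \<theta>) + 16 * real x powr (1 - c/4) * (2 * L) / (c\<^sup>2 * \<theta>)" by linarith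
        also have "\<dots> = 36 * real x powr (1 - c/4) * L / (c\<^sup>2 * \<theta>)" by (simp add: add_divide_distrib[symmetric])
        finally show "2 * real x / real M + 16 * real x powr (1 - c) * (1 + ln (real (2 * M))) / (c\<^sup>2 * \<theta>)
          \<le> 36 * real x powr (1 - c/4) * L / (c\<^sup>2 * \<theta>)" .
      qed (use E0 M c \<theta> in \<open>auto intro!: mult_nonneg_nonneg sum_nonneg add_nonneg_nonneg divide_nonneg_nonneg\<close>)
      also have "\<dots> = (2 * E\<^sup>2 * (36 * real x powr (1 - c/4) * L / (c\<^sup>2 * \<theta>))) * (real N * real M)"
        by (simp add: power2_eq_square mult_ac)
      also have "\<dots> \<le> (2 * E\<^sup>2 * (36 * real x powr (1 - c/4) * L / (c\<^sup>2 * \<theta>))) * (2 * real x)"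
      proof (intro mult_left_mono)
        have "N * M \<le> 2 * x" unfolding N_def by (rule order_trans[OF div_times_less_eq_dividend xy(2)])
        thus "real N * real M \<le> 2 * real x" by (simp flip: of_nat_mult)
      qed (use L c \<theta> in auto)
      also have "\<dots> = 144 * E\<^sup>2 * (real x * real x powr (1 - c/4)) * (L / (c\<^sup>2 * \<theta>))" by simp
      also have "real x * real x powr (1 - c/4) = (real x powr (1 - c/8))\<^sup>2"
        using x by (simp add: power2_eq_square powr_mult_base flip: powr_add)
      also have "144 * E\<^sup>2 * (real x powr (1 - c/8))\<^sup>2 * (L / (c\<^sup>2 * \<theta>)) \<le> 144 * E\<^sup>2 * (real x powr (1 - c/8))\<^sup>2 * (L\<^sup>2 / (c\<^sup>2 * \<theta>\<^sup>2))"
      proof (intro mult_left_mono frac_le)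
        show "L \<le> L\<^sup>2" using L by (simp add: self_le_power)
        show "\<theta>\<^sup>2 \<le> \<theta>" using \<theta> by (auto simp: power2_eq_square mult_left_le)
      qed (use c \<theta> in auto)
      also have "\<dots> = B\<^sup>2" by (simp add: B_def power_divide power_mult_distrib)
      finally have "norm (\<Sum>m\<in>P. T m) \<le> B" using B0 by (rule power2_le_imp_le)
      thus ?thesis using eq by (simp add: M_def)
    qed
  qed
  have "(\<Sum>m=1..y. T m) = (\<Sum>m\<in>{U<..2^K*U}. h m)"
  proof (rule sum.mono_neutral_cong)
    fix m assume "m \<in> {U<..2^K*U} - {1..y}"
    thus "h m = 0" by (auto simp: h_def)
  next
    fix m assume m: "m \<in> {1..y} - {U<..2^K*U}"
    have "m \<le> 2^K * U" using m yK mult_le_mono[of m "2^K" 1 U] U by auto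
    hence "\<alpha> m = 0" using m \<alpha>0[of m] by auto
    thus "T m = 0" by (simp add: T_def)
  next
    fix m assume "m \<in> {1..y} \<inter> {U<..2^K*U}"
    thus "T m = h m" using \<alpha>0[of m] by (auto simp: h_def T_def)
  qed auto
  also have "\<dots> = (\<Sum>i<K. \<Sum>m\<in>{2^i*U<..2*(2^i*U)}. h m)" by (rule sum_dyadic_blocks)
  also have "norm \<dots> \<le> (\<Sum>i<K. B)" by (intro sum_norm_le block)
  also have "\<dots> = real K * B" by simp
  also have "\<dots> \<le> 2 * L * B" using K B0 by (rule mult_right_mono)
  finally show ?thesis by (simp add: T_def B_def power2_eq_square mult_ac)
qed

text \<open>From m n \<le> y \<le> 2 x it follows that m^2 or n^2 is at most 4 x. The terms with
  small m form one instance of \<open>type_II_sum_half\<close>; in the terms with large m the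
  variable n is small, and exchanging the roles gives a second instance.\<close>

lemma type_II_sum_bound:
  fixes c \<theta> E :: real and \<alpha> \<beta> :: "nat \<Rightarrow> real" and x y :: nat
  defines "L \<equiv> 1 + ln (real y)"
  assumes c: "0 < c" "c \<le> 1/2" and \<theta>: "0 < \<theta>" "\<theta> \<le> 1"
    and x: "x \<ge> 1" and xy: "x \<le> y" "y \<le> 2 * x"
    and U: "U \<ge> 1" "real x powr (c/4) \<le> 2 * real U"
    and zero: "\<And>m. m \<le> U \<Longrightarrow> \<alpha> m = 0" "\<And>m. m \<le> U \<Longrightarrow> \<beta> m = 0"
    and E: "\<And>t. 1 \<le> t \<Longrightarrow> t \<le> y \<Longrightarrow> (\<Sum>m=1..t. \<alpha> m ^ 2) \<le> real t * E"
      "\<And>t. 1 \<le> t \<Longrightarrow> t \<le> y \<Longrightarrow> (\<Sum>m=1..t. \<beta> m ^ 2) \<le> real t * E"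
  shows "norm (\<Sum>m=1..y. \<Sum>n=1..y. of_real (\<alpha> m * \<beta> n) * hyperbola_phase \<theta> c x y m n) \<le> 48 * E * L^2 * real x powr (1 - c/8) / (c * \<theta>)"
proof -
  define lo where "lo f m = (if m\<^sup>2 \<le> 4 * x then f m else 0)" for f :: "nat \<Rightarrow> real" and m
  define hi where "hi m = (if m\<^sup>2 \<le> 4 * x then 0 else \<alpha> m)" for m
  have trunc: "(\<Sum>m=1..t. g m ^ 2) \<le> real t * E"
    if "(\<Sum>m=1..t. f m ^ 2) \<le> real t * E" "\<And>m. g m = 0 \<or> g m = f m" for f g :: "nat \<Rightarrow> real" and t
  proof -
    have "g m ^ 2 \<le> f m ^ 2" for m using that(2)[of m] by auto
    thus ?thesis using that(1) by (intro order_trans[OF sum_mono that(1)])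
  qed
  have "of_real (\<alpha> m * \<beta> n) * hyperbola_phase \<theta> c x y m n = of_real (lo \<alpha> m * \<beta> n) * hyperbola_phase \<theta> c x y m n + of_real (lo \<beta> n * hi m) * hyperbola_phase \<theta> c x y n m" for m n
  proof (cases "m\<^sup>2 \<le> 4 * x")
    case False
    have "hyperbola_phase \<theta> c x y m n = 0" if "\<not> n\<^sup>2 \<le> 4 * x"
    proof -
      have "\<not> m * n \<le> y"
      proof
        assume "m * n \<le> y"
        have "m\<^sup>2 \<le> m * n \<or> n\<^sup>2 \<le> m * n" by (cases "m \<le> n") (auto simp: power2_eq_square)
        thus False using \<open>m * n \<le> y\<close> xy that False by linarith
      qed
      thus ?thesis by (simp add: hyperbola_phase_def)
    qed
    thus ?thesis using False by (auto simp: lo_def hi_def hyperbola_phase_commute[of \<theta> c x y n m])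
  qed (auto simp: lo_def hi_def)
  hence "(\<Sum>m=1..y. \<Sum>n=1..y. of_real (\<alpha> m * \<beta> n) * hyperbola_phase \<theta> c x y m n)
     = (\<Sum>m=1..y. \<Sum>n=1..y. of_real (lo \<alpha> m * \<beta> n) * hyperbola_phase \<theta> c x y m n) + (\<Sum>m=1..y. \<Sum>n=1..y. of_real (lo \<beta> n * hi m) * hyperbola_phase \<theta> c x y n m)"
    by (simp add: sum.distrib)
  also have "(\<Sum>m=1..y. \<Sum>n=1..y. of_real (lo \<beta> n * hi m) * hyperbola_phase \<theta> c x y n m) = (\<Sum>n=1..y. \<Sum>m=1..y. of_real (lo \<beta> n * hi m) * hyperbola_phase \<theta> c x y n m)"
    by (rule sum.swap)
  also have "norm ((\<Sum>m=1..y. \<Sum>n=1..y. of_real (lo \<alpha> m * \<beta> n) * hyperbola_phase \<theta> c x y m n) + (\<Sum>n=1..y. \<Sum>m=1..y. of_real (lo \<beta> n * hi m) * hyperbola_phase \<theta> c x y n m))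
      \<le> 24 * E * L^2 * real x powr (1 - c/8) / (c * \<theta>) + 24 * E * L^2 * real x powr (1 - c/8) / (c * \<theta>)"
    unfolding L_def
  proof (intro norm_triangle_mono type_II_sum_half[where U = U] c \<theta> x xy U)
    fix t assume t: "1 \<le> t" "t \<le> y"
    show "(\<Sum>m=1..t. lo \<alpha> m ^ 2) \<le> real t * E" by (rule trunc[OF E(1)[OF t]]) (auto simp: lo_def)
    show "(\<Sum>m=1..t. \<beta> m ^ 2) \<le> real t * E" by (rule E(2)[OF t])
    show "(\<Sum>m=1..t. lo \<beta> m ^ 2) \<le> real t * E" by (rule trunc[OF E(2)[OF t]]) (auto simp: lo_def)
    show "(\<Sum>m=1..t. hi m ^ 2) \<le> real t * E" by (rule trunc[OF E(1)[OF t]]) (auto simp: hi_def)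
  qed (auto simp: lo_def zero)
  finally show ?thesis by (simp add: mult_ac)
qed

section \<open>The mangoldt sum against a power phase\<close>

text \<open>The exponent 3 matches the divisor bound for the other coefficient sequence, so that one
  value of E serves both in \<open>type_II_sum_bound\<close>.\<close>

lemma mangoldt_squares_le:
  assumes "1 \<le> t" "t \<le> y"
  shows "(\<Sum>m=1..t. (if U < m then mangoldt m else 0) ^ 2) \<le> real t * (1 + ln (real y)) ^ 3"
proof -
  have "(\<Sum>m=1..t. (if U < m then mangoldt m else 0) ^ 2) \<le> (\<Sum>m=1..t. (1 + ln (real y)) ^ 3)"
  proof (intro sum_mono)
    fix m assume m: "m \<in> {1..t}"
    have l: "ln (real y) \<ge> 0" using assms by simp
    have "mangoldt m \<le> ln (real m)" using m by (intro mangoldt_le) auto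
    also have "\<dots> \<le> ln (real y)" using m assms by simp
    finally have le: "mangoldt m \<le> 1 + ln (real y)" by simp
    have "(if U < m then mangoldt m else 0) ^ 2 \<le> (mangoldt m ^ 2 :: real)" by simp
    also have "\<dots> \<le> (1 + ln (real y)) ^ 2" using le by (intro power_mono mangoldt_nonneg)
    also have "\<dots> \<le> (1 + ln (real y)) ^ 3" using l by (intro power_increasing) auto
    finally show "(if U < m then mangoldt m else 0) ^ 2 \<le> (1 + ln (real y)) ^ 3" .
  qed
  thus ?thesis by simp
qed

lemma truncated_moebius_mu_squares_le:
  assumes "1 \<le> t" "t \<le> y"
  shows "(\<Sum>n=1..t. (\<Sum>d | d dvd n. of_bool (U < d) * moebius_mu d) ^ 2) \<le> real t * (1 + ln (real y)) ^ 3"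
proof -
  have "(\<Sum>n=1..t. (\<Sum>d | d dvd n. of_bool (U < d) * moebius_mu d) ^ 2) \<le> (\<Sum>n=1..t. real (card {d. d dvd n}) ^ 2)"
  proof (intro sum_mono)
    fix n
    have "\<bar>\<Sum>d | d dvd n. of_bool (U < d) * moebius_mu d\<bar> \<le> (\<Sum>d | d dvd n. 1)"
      by (intro order_trans[OF sum_abs] sum_mono) (auto simp: abs_moebius_mu_le)
    hence "\<bar>\<Sum>d | d dvd n. of_bool (U < d) * moebius_mu d\<bar> \<le> real (card {d. d dvd n})" by simp
    from power_mono[OF this, of 2] show "(\<Sum>d | d dvd n. of_bool (U < d) * moebius_mu d) ^ 2 \<le> real (card {d. d dvd n}) ^ 2"
      by simp
  qed
  also have "\<dots> \<le> real t * (1 + ln (real t)) ^ 3" using assms by (intro sum_card_divisors_squared_le)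
  also have "\<dots> \<le> real t * (1 + ln (real y)) ^ 3"
    using assms by (intro mult_left_mono power_mono add_mono) auto
  finally show ?thesis .
qed

text \<open>Of the three parts of Vaughan's identity, \<open>S1\<close> carries a logarithm that
  partial summation removes, \<open>S2\<close> has moduli d e \<le> U^2, and \<open>S3\<close> is
  bilinear with both variables above \<open>U\<close>. The first two save a full x^c;
  \<open>S3\<close> determines the exponent 1 - c/8. The constant is 64 = 8 + 8 + 48.\<close>

lemma mangoldt_exp_sum_dyadic:
  fixes c \<theta> :: real and x y :: nat
  defines "L \<equiv> 1 + ln (real y)"
  assumes c: "0 < c" "c \<le> 1/2" and \<theta>: "0 < \<theta>" "\<theta> \<le> 1"
    and x: "x \<ge> 1" and xy: "x \<le> y" "y \<le> 2 * x"
  shows "norm (\<Sum>n\<in>{x<..y}. mangoldt n * power_phase \<theta> c n) \<le> 64 * L ^ 5 * real x powr (1 - c/8) / (c * \<theta>)"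
proof -
  define f where "f = power_phase \<theta> c"
  \<comment> \<open>Small enough for U^4 \<le> x, so that a modulus up to U^2 has its square below
    x, and large enough that the diagonal of the bilinear sum saves x^(c/4).\<close>
  define U where "U = nat \<lfloor>real x powr (c/4)\<rfloor>"
  define b where "b n = (\<Sum>d | d dvd n. of_bool (U < d) * moebius_mu d)" for n
  define \<Lambda> where "\<Lambda> m = (if U < m then mangoldt m else 0 :: real)" for m
  define X where "X = real x powr (1 - c) / (c * \<theta>)"
  have X0: "X \<ge> 0" using c \<theta> by (simp add: X_def)
  have y1: "y \<ge> 1" using x xy by linarith
  have L: "L \<ge> 1" using y1 by (simp add: L_def)
  have lnL: "ln (real m) \<le> L" "1 + ln (real m) \<le> L" if "1 \<le> m" "m \<le> y" for m
  proof -
    have "ln (real m) \<le> ln (real y)" using that by simp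
    thus "ln (real m) \<le> L" "1 + ln (real m) \<le> L" by (auto simp: L_def)
  qed
  have xp: "1 \<le> real x powr (c/4)" using x c by (simp add: ge_one_powr_ge_zero)
  have U: "1 \<le> U" "real U \<le> real x powr (c/4)" "real x powr (c/4) \<le> 2 * real U"
  proof -
    show 1: "1 \<le> U" using xp by (simp add: U_def le_nat_iff le_floor_iff)
    show "real U \<le> real x powr (c/4)" by (simp add: U_def)
    have "real x powr (c/4) \<le> real U + 1" unfolding U_def by linarith
    thus "real x powr (c/4) \<le> 2 * real U" using 1 by linarith
  qed
  have U4: "U ^ 4 \<le> x"
  proof -
    have "real U ^ 4 \<le> (real x powr (c/4)) ^ 4" using U by (intro power_mono) auto
    also have "\<dots> = real x powr c" using x by (simp add: powr_power)
    also have "\<dots> \<le> real x powr 1" using x c by (intro powr_mono) auto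
    finally show ?thesis using x by (simp flip: of_nat_power)
  qed
  have Ux: "U \<le> x" using U4 self_le_power[of U 4] U by linarith
  define S1 where "S1 = (\<Sum>n\<in>{x<..y}. of_real (\<Sum>d | d dvd n. of_bool (d \<le> U) * moebius_mu d * ln (real (n div d))) * f n)"
  define S2 where "S2 = (\<Sum>n\<in>{x<..y}. of_real (\<Sum>d | d dvd n. of_bool (d \<le> U) * moebius_mu d * (\<Sum>e | e dvd n div d. of_bool (e \<le> U) * mangoldt e)) * f n)"
  define S3 where "S3 = (\<Sum>n\<in>{x<..y}. of_real (\<Sum>e | e dvd n. \<Lambda> e * b (n div e)) * f n)"
  have "(\<Sum>n\<in>{x<..y}. mangoldt n * f n) = (\<Sum>n\<in>{x<..y}. of_real (mangoldt n) * f n)"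
    by simp
  also have "\<dots> = S1 - S2 + S3"
    unfolding S1_def S2_def S3_def sum_subtractf[symmetric] sum.distrib[symmetric]
  proof (intro sum.cong refl)
    fix n assume "n \<in> {x<..y}"
    hence n: "U < n" using Ux by simp
    have 1: "(\<Sum>e | e dvd n. \<Lambda> e * b (n div e))
       = (\<Sum>e | e dvd n. of_bool (U < e) * mangoldt e * (\<Sum>d | d dvd n div e. of_bool (U < d) * moebius_mu d))"
      by (intro sum.cong) (auto simp: \<Lambda>_def b_def)
    show "of_real (mangoldt n) * f n = of_real (\<Sum>d | d dvd n. of_bool (d \<le> U) * moebius_mu d * ln (real (n div d))) * f n
       - of_real (\<Sum>d | d dvd n. of_bool (d \<le> U) * moebius_mu d * (\<Sum>e | e dvd n div d. of_bool (e \<le> U) * mangoldt e)) * f n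
       + of_real (\<Sum>e | e dvd n. \<Lambda> e * b (n div e)) * f n"
      unfolding 1 by (subst vaughan_identity[OF n]) (simp only: of_real_add of_real_diff distrib_right left_diff_distrib)
  qed
  finally have split: "(\<Sum>n\<in>{x<..y}. mangoldt n * f n) = S1 - S2 + S3" .
  have hyper: "(\<Sum>n\<in>{x<..y}. of_real (\<Sum>d | d dvd n. g d (n div d)) * f n)
      = (\<Sum>d=1..y. \<Sum>m\<in>{x div d<..y div d}. of_real (g d m) * f (d * m))" for g :: "nat \<Rightarrow> nat \<Rightarrow> real"
  proof -
    have "(\<Sum>n\<in>{x<..y}. of_real (\<Sum>d | d dvd n. g d (n div d)) * f n)
       = (\<Sum>n\<in>{x<..y}. \<Sum>d | d dvd n. of_real (g d (n div d)) * f (d * (n div d)))"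
      unfolding of_real_sum sum_distrib_right by (intro sum.cong refl) auto
    also have "\<dots> = (\<Sum>d=1..y. \<Sum>m\<in>{x div d<..y div d}. of_real (g d m) * f (d * m))"
      by (rule sum_divisors_interval)
    finally show ?thesis .
  qed
  \<comment> \<open>The range up to U^2 covers the moduli d of \<open>S1\<close> as well as the
    products d e of \<open>S2\<close>.\<close>
  have t1: "norm (\<Sum>m=A..y div d. f (d * m)) \<le> 8 * X / real d"
    if "1 \<le> d" "d \<le> U ^ 2" "x div d < A" for A d
  proof -
    have "d ^ 2 \<le> (U ^ 2) ^ 2" using that by (intro power_mono) auto
    hence "d ^ 2 \<le> x" using U4 by simp
    thus ?thesis using that xy type_I_sum_bound[OF c \<theta> that(1), of x y A "y div d"]
      by (simp add: f_def X_def)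
  qed
  have UU: "U \<le> U ^ 2" using U by (intro self_le_power) auto
  have harm: "(\<Sum>d=1..t. K / real d) \<le> K * L" if "K \<ge> 0" "t \<le> y" for K t
  proof (cases "t = 0")
    case False
    have "(\<Sum>d=1..t. K / real d) = K * (\<Sum>d=1..t. 1 / real d)" by (simp add: sum_distrib_left)
    also have "\<dots> \<le> K * (1 + ln (real t))" using that False by (intro mult_left_mono harmonic_sum_le) auto
    also have "\<dots> \<le> K * L" using that lnL[of t] False by (intro mult_left_mono) auto
    finally show ?thesis .
  qed (use that L in auto)
  have \<mu>1: "norm (complex_of_real (of_bool (d \<le> U) * moebius_mu d)) \<le> 1" for d using abs_moebius_mu_le by simp
  have n1: "norm S1 \<le> 8 * X * L * L"
  proof -
    have "S1 = (\<Sum>d=1..y. \<Sum>m\<in>{x div d<..y div d}. of_real (of_bool (d \<le> U) * moebius_mu d * ln (real m)) * f (d * m))"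
      unfolding S1_def by (rule hyper)
    also have "norm \<dots> \<le> (\<Sum>d=1..y. 8 * X * L / real d)"
    proof (intro sum_norm_le)
      fix d assume d: "d \<in> {1..y}"
      have eq: "(\<Sum>m\<in>{x div d<..y div d}. of_real (of_bool (d \<le> U) * moebius_mu d * ln (real m)) * f (d * m))
         = of_real (of_bool (d \<le> U) * moebius_mu d) * (\<Sum>m=Suc (x div d)..y div d. ln (real m) * f (d * m))"
        by (simp add: sum_distrib_left atLeastSucAtMost_greaterThanAtMost mult_ac)
      have yd: "1 \<le> y div d" "y div d \<le> y" using d by (auto simp: Suc_le_eq div_greater_zero_iff)
      show "norm (\<Sum>m\<in>{x div d<..y div d}. of_real (of_bool (d \<le> U) * moebius_mu d * ln (real m)) * f (d * m)) \<le> 8 * X * L / real d"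
      proof (cases "d \<le> U")
        case True
        have "norm (\<Sum>m=Suc (x div d)..y div d. ln (real m) * f (d * m)) \<le> ln (real (y div d)) * (8 * X / real d)"
          using d True UU yd by (intro norm_sum_ln_le t1) auto
        also have "\<dots> \<le> L * (8 * X / real d)" using lnL yd X0 by (intro mult_right_mono) auto
        finally have "norm (\<Sum>m=Suc (x div d)..y div d. ln (real m) * f (d * m)) \<le> 8 * X * L / real d"
          by (simp add: mult_ac)
        from mult_mono[OF \<mu>1 this] show ?thesis unfolding eq norm_mult by simp
      next
        case False
        thus ?thesis unfolding eq using X0 L by simp
      qed
    qed
    also have "\<dots> \<le> 8 * X * L * L" using X0 L by (intro harm) auto
    finally show ?thesis .
  qed
  have n2: "norm S2 \<le> 8 * X * L * L * L"
  proof -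
    have "S2 = (\<Sum>d=1..y. \<Sum>m\<in>{x div d<..y div d}.
        of_real (of_bool (d \<le> U) * moebius_mu d * (\<Sum>e | e dvd m. of_bool (e \<le> U) * mangoldt e)) * f (d * m))"
      unfolding S2_def by (rule hyper)
    also have "norm \<dots> \<le> (\<Sum>d=1..y. 8 * X * L * L / real d)"
    proof (intro sum_norm_le)
      fix d assume d: "d \<in> {1..y}"
      have yd: "1 \<le> y div d" "y div d \<le> y" using d by (auto simp: Suc_le_eq div_greater_zero_iff)
      have eq: "(\<Sum>m\<in>{x div d<..y div d}. of_real (of_bool (d \<le> U) * moebius_mu d * (\<Sum>e | e dvd m. of_bool (e \<le> U) * mangoldt e)) * f (d * m))
         = of_real (of_bool (d \<le> U) * moebius_mu d) *
            (\<Sum>e=1..y div d. \<Sum>m\<in>{x div d div e<..y div d div e}. of_real (of_bool (e \<le> U) * mangoldt e) * f (d * (e * m)))"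
        (is "?l = _ * ?r")
      proof -
        have "?l = of_real (of_bool (d \<le> U) * moebius_mu d) *
            (\<Sum>m\<in>{x div d<..y div d}. \<Sum>e | e dvd m. of_real (of_bool (e \<le> U) * mangoldt e) * f (d * (e * (m div e))))"
          unfolding sum_distrib_left sum_distrib_right of_real_sum of_real_mult[of _ "sum _ _"]
          by (intro sum.cong refl) (auto simp: mult_ac)
        thus ?thesis by (subst (asm) sum_divisors_interval)
      qed
      show "norm ?l \<le> 8 * X * L * L / real d"
      proof (cases "d \<le> U")
        case True
        have "norm ?r \<le> (\<Sum>e=1..y div d. (8 * X * L / real d) / real e)"
        proof (intro sum_norm_le)
          fix e assume e: "e \<in> {1..y div d}"
          have eq: "(\<Sum>m\<in>{x div d div e<..y div d div e}. of_real (of_bool (e \<le> U) * mangoldt e) * f (d * (e * m)))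
            = of_real (of_bool (e \<le> U) * mangoldt e) * (\<Sum>m=Suc (x div (d * e))..y div (d * e). f (d * e * m))"
            by (simp add: sum_distrib_left atLeastSucAtMost_greaterThanAtMost mult_ac div_mult2_eq)
          show "norm (\<Sum>m\<in>{x div d div e<..y div d div e}. of_real (of_bool (e \<le> U) * mangoldt e) * f (d * (e * m)))
              \<le> (8 * X * L / real d) / real e"
          proof (cases "e \<le> U")
            case eU: True
            have "norm (\<Sum>m=Suc (x div (d * e))..y div (d * e). f (d * e * m)) \<le> 8 * X / real (d * e)"
              using d e True eU by (intro t1) (auto simp: power2_eq_square intro!: mult_le_mono)
            moreover have "mangoldt e \<le> L"
              using mangoldt_le[of e] lnL[of e] e yd by fastforce
            ultimately have "L * (8 * X / real (d * e)) \<ge> mangoldt e * norm (\<Sum>m=Suc (x div (d * e))..y div (d * e). f (d * e * m))"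
              using L by (intro mult_mono) auto
            thus ?thesis unfolding eq norm_mult using eU by (simp add: mult_ac)
          next
            case False
            thus ?thesis unfolding eq using X0 L by simp
          qed
        qed
        also have "\<dots> \<le> (8 * X * L / real d) * L" using X0 L yd by (intro harm) auto
        finally have "norm ?r \<le> 8 * X * L * L / real d" by simp
        from mult_mono[OF \<mu>1 this] show ?thesis unfolding eq norm_mult by simp
      next
        case False
        thus ?thesis unfolding eq using X0 L by simp
      qed
    qed
    also have "\<dots> \<le> 8 * X * L * L * L" using X0 L by (intro harm) auto
    finally show ?thesis .
  qed
  have n3: "norm S3 \<le> 48 * L ^ 3 * L ^ 2 * real x powr (1 - c/8) / (c * \<theta>)"
  proof -
    have "S3 = (\<Sum>e=1..y. \<Sum>m\<in>{x div e<..y div e}. of_real (\<Lambda> e * b m) * f (e * m))"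
      unfolding S3_def by (rule hyper)
    also have "\<dots> = (\<Sum>e=1..y. \<Sum>m=1..y. of_real (\<Lambda> e * b m) * hyperbola_phase \<theta> c x y e m)"
    proof (rule sum.cong[OF refl], rule sum.mono_neutral_cong_left)
      fix e assume e: "e \<in> {1..y}"
      have *: "m \<in> {x div e<..y div e} \<longleftrightarrow> x < e * m \<and> e * m \<le> y" for m
        using e by (simp add: div_less_iff_less_mult less_eq_div_iff_mult_less_eq mult.commute)
      show "{x div e<..y div e} \<subseteq> {1..y}"
      proof
        fix m assume m: "m \<in> {x div e<..y div e}"
        hence "m \<le> y div e" by simp
        also have "\<dots> \<le> y" by simp
        finally show "m \<in> {1..y}" using m by simp
      qed
      show "\<forall>m\<in>{1..y} - {x div e<..y div e}. of_real (\<Lambda> e * b m) * hyperbola_phase \<theta> c x y e m = 0"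
        using * by (auto simp: hyperbola_phase_def)
      show "of_real (\<Lambda> e * b m) * f (e * m) = of_real (\<Lambda> e * b m) * hyperbola_phase \<theta> c x y e m" if "m \<in> {x div e<..y div e}" for m
        using *[of m] that by (simp add: hyperbola_phase_def f_def)
    qed auto
    also have "norm \<dots> \<le> 48 * L ^ 3 * L ^ 2 * real x powr (1 - c/8) / (c * \<theta>)"
      unfolding L_def
    proof (rule type_II_sum_bound[OF c \<theta> x xy U(1,3)])
      show "\<Lambda> m = 0" if "m \<le> U" for m using that by (simp add: \<Lambda>_def)
      show "(\<Sum>m=1..t. \<Lambda> m ^ 2) \<le> real t * (1 + ln (real y)) ^ 3" if "1 \<le> t" "t \<le> y" for t
        unfolding \<Lambda>_def using mangoldt_squares_le[OF that] .
      show "(\<Sum>m=1..t. b m ^ 2) \<le> real t * (1 + ln (real y)) ^ 3" if "1 \<le> t" "t \<le> y" for t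
        unfolding b_def using truncated_moebius_mu_squares_le[OF that] .
      show "b m = 0" if "m \<le> U" for m
      proof (cases "m = 0")
        case False
        thus ?thesis unfolding b_def using that dvd_imp_le[of _ m] by (intro sum.neutral) force
      qed (simp add: b_def)
    qed
    finally show ?thesis .
  qed
  have "norm (S1 - S2 + S3) \<le> norm S1 + norm S2 + norm S3"
    using norm_triangle_ineq[of "S1 - S2" S3] norm_triangle_ineq4[of S1 S2] by linarith
  also have "\<dots> \<le> 8 * X * L ^ 5 + 8 * X * L ^ 5 + 48 * L ^ 5 * real x powr (1 - c/8) / (c * \<theta>)"
  proof (intro add_mono)
    have "8 * X * L ^ 2 \<le> 8 * X * L ^ 5" using X0 L by (intro mult_left_mono power_increasing) auto
    thus "norm S1 \<le> 8 * X * L ^ 5" using n1 by (simp add: power2_eq_square)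
    have "8 * X * L ^ 3 \<le> 8 * X * L ^ 5" using X0 L by (intro mult_left_mono power_increasing) auto
    thus "norm S2 \<le> 8 * X * L ^ 5" using n2 by (simp add: power3_eq_cube mult_ac)
    show "norm S3 \<le> 48 * L ^ 5 * real x powr (1 - c/8) / (c * \<theta>)" using n3 by (simp add: mult.assoc flip: power_add)
  qed
  also have "X \<le> real x powr (1 - c/8) / (c * \<theta>)"
    unfolding X_def using x c \<theta> by (intro divide_right_mono powr_mono) auto
  hence "8 * X * L ^ 5 + 8 * X * L ^ 5 + 48 * L ^ 5 * real x powr (1 - c/8) / (c * \<theta>)
    \<le> 8 * (real x powr (1 - c/8) / (c * \<theta>)) * L ^ 5 + 8 * (real x powr (1 - c/8) / (c * \<theta>)) * L ^ 5 + 48 * L ^ 5 * real x powr (1 - c/8) / (c * \<theta>)"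
    using L by (intro add_mono mult_right_mono mult_left_mono) auto
  also have "\<dots> = 64 * L ^ 5 * real x powr (1 - c/8) / (c * \<theta>)" by (simp add: mult_ac)
  finally show ?thesis using split by (simp add: f_def)
qed

text \<open>With h = Y div 2, the range up to Y splits into the range up to h, the dyadic range from
  h to 2 h, and at most one leftover term when Y is odd. One halving costs at most \<open>B\<close>,
  where 65 = 64 + 1 pays for that leftover; at most 2 (1 + ln X) halvings give the sixth power and
  130.\<close>

lemma mangoldt_exp_sum:
  fixes c \<theta> :: real and X :: nat
  assumes c: "0 < c" "c \<le> 1/2" and \<theta>: "0 < \<theta>" "\<theta> \<le> 1" and X: "X \<ge> 1"
  shows "norm (\<Sum>n\<in>{0<..X}. mangoldt n * power_phase \<theta> c n)
    \<le> 130 * (1 + ln (real X)) ^ 6 * real X powr (1 - c/8) / (c * \<theta>)"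
proof -
  define B where "B = 65 * (1 + ln (real X)) ^ 5 * real X powr (1 - c/8) / (c * \<theta>)"
  have lnX: "ln (real X) \<ge> 0" using X by simp
  have B0: "B \<ge> 0" using lnX c \<theta> by (simp add: B_def)
  have triv: "(\<Sum>n\<in>{0<..Y}. mangoldt n * power_phase \<theta> c n) = 0" if "Y \<le> 1" for Y
  proof (intro sum.neutral ballI)
    fix n assume "n \<in> {0<..Y}"
    hence "n = Suc 0" using that by auto
    thus "mangoldt n * power_phase \<theta> c n = 0" by simp
  qed
  have claim: "norm (\<Sum>n\<in>{0<..Y}. mangoldt n * power_phase \<theta> c n) \<le> real k * B"
    if "Y < 2 ^ Suc k" "Y \<le> X" for k Y
    using that
  proof (induction k arbitrary: Y)
    case 0
    hence "Y \<le> 1" by simp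
    thus ?case by (simp only: triv) simp
  next
    case (Suc k)
    show ?case
    proof (cases "Y \<le> 1")
      case True
      thus ?thesis using B0 by (simp only: triv) simp
    next
      case False
      define h where "h = Y div 2"
      have h: "1 \<le> h" "h \<le> 2 * h" "2 * h \<le> Y" "Y \<le> 2 * h + 1" "h < 2 ^ Suc k" "h \<le> X"
        using False Suc.prems by (auto simp: h_def)
      define g where "g n = mangoldt n * power_phase \<theta> c n" for n
      have "{0<..Y} = {0<..h} \<union> ({h<..2*h} \<union> {2*h<..Y})" using h by auto
      hence "sum g {0<..Y} = sum g ({0<..h} \<union> ({h<..2*h} \<union> {2*h<..Y}))" by simp
      also have "\<dots> = sum g {0<..h} + sum g ({h<..2*h} \<union> {2*h<..Y})" by (intro sum.union_disjoint) auto
      also have "sum g ({h<..2*h} \<union> {2*h<..Y}) = sum g {h<..2*h} + sum g {2*h<..Y}" by (intro sum.union_disjoint) auto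
      finally have eq: "sum g {0<..Y} = sum g {0<..h} + (sum g {h<..2*h} + sum g {2*h<..Y})" .
      have 1: "norm (sum g {0<..h}) \<le> real k * B" unfolding g_def using h by (intro Suc.IH) auto
      have hX: "real h powr (1 - c/8) \<le> real X powr (1 - c/8)" using h c by (intro powr_mono2) auto
      have l2: "1 + ln (real (2 * h)) \<le> 1 + ln (real X)" using h Suc.prems X by (simp del: of_nat_mult)
      have "norm (sum g {h<..2*h}) \<le> 64 * (1 + ln (real (2*h))) ^ 5 * real h powr (1 - c/8) / (c * \<theta>)"
        unfolding g_def using h by (intro mangoldt_exp_sum_dyadic c \<theta>) auto
      also have "\<dots> \<le> 64 * (1 + ln (real X)) ^ 5 * real X powr (1 - c/8) / (c * \<theta>)"
      proof (intro divide_right_mono mult_mono hX power_mono l2)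
        show "0 \<le> 1 + ln (real (2 * h))" using h by (auto simp del: of_nat_mult intro!: add_nonneg_nonneg ln_ge_zero)
      qed (use c \<theta> lnX h in \<open>auto intro!: mult_nonneg_nonneg zero_le_power add_nonneg_nonneg\<close>)
      finally have 2: "norm (sum g {h<..2*h}) \<le> 64 * (1 + ln (real X)) ^ 5 * real X powr (1 - c/8) / (c * \<theta>)" .
      have "norm (sum g {2*h<..Y}) \<le> 1 + ln (real X)"
      proof (cases "Y = 2 * h")
        case False
        hence "{2*h<..Y} = {Y}" using h by auto
        hence "norm (sum g {2*h<..Y}) = mangoldt Y" by (simp add: g_def norm_mult)
        also have "\<dots> \<le> ln (real Y)" using h by (intro mangoldt_le) auto
        also have "\<dots> \<le> ln (real X)" using h Suc.prems by simp
        finally show ?thesis by simp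
      qed (use lnX in auto)
      also have "\<dots> \<le> (1 + ln (real X)) ^ 5" using lnX by (intro self_le_power) auto
      also have "\<dots> \<le> (1 + ln (real X)) ^ 5 * (real X powr (1 - c/8) / (c * \<theta>))"
      proof -
        have "1 \<le> real X powr (1 - c/8)" using X c by (intro ge_one_powr_ge_zero) auto
        moreover have "c * \<theta> \<le> 1" "c * \<theta> > 0" using c \<theta> by (auto intro!: mult_le_one)
        ultimately have "1 \<le> real X powr (1 - c/8) / (c * \<theta>)" by (simp add: pos_le_divide_eq)
        thus ?thesis using lnX mult_left_mono[of 1 _ "(1 + ln (real X)) ^ 5"] by fastforce
      qed
      finally have 3: "norm (sum g {2*h<..Y}) \<le> (1 + ln (real X)) ^ 5 * real X powr (1 - c/8) / (c * \<theta>)" by simp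
      have "norm (sum g {h<..2*h} + sum g {2*h<..Y}) \<le> B"
      proof -
        have "B = 64 * (1 + ln (real X)) ^ 5 * real X powr (1 - c/8) / (c * \<theta>) + (1 + ln (real X)) ^ 5 * real X powr (1 - c/8) / (c * \<theta>)"
          by (simp add: B_def add_divide_distrib[symmetric])
        thus ?thesis using norm_triangle_ineq[of "sum g {h<..2*h}" "sum g {2*h<..Y}"] 2 3 by linarith
      qed
      hence "norm (sum g {0<..Y}) \<le> real k * B + B"
        unfolding eq using 1 norm_triangle_ineq[of "sum g {0<..h}" "sum g {h<..2*h} + sum g {2*h<..Y}"] by linarith
      thus ?thesis by (simp add: g_def algebra_simps)
    qed
  qed
  define k where "k = nat \<lfloor>ln (real X) / ln 2\<rfloor>"
  have "ln (real X) / ln 2 < real (Suc k)" using lnX by (simp add: k_def) linarith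
  hence "ln (real X) < real (Suc k) * ln 2" by (subst (asm) pos_divide_less_eq) auto
  also have "\<dots> = ln (2 ^ Suc k)" by (subst ln_realpow) auto
  finally have "ln (real X) < ln (2 ^ Suc k)" .
  hence "real X < 2 ^ Suc k" using X by (subst (asm) ln_less_cancel_iff) auto
  hence "X < 2 ^ Suc k" by (metis of_nat_less_iff of_nat_numeral of_nat_power)
  from claim[OF this] have "norm (\<Sum>n\<in>{0<..X}. mangoldt n * power_phase \<theta> c n) \<le> real k * B" by simp
  also have "\<dots> \<le> (2 * (1 + ln (real X))) * B"
  proof (intro mult_right_mono B0)
    have "(1/2::real) \<le> ln 2" using ln_le_minus_one[of "1/2::real"] by (simp add: ln_div)
    hence "ln (real X) / ln 2 \<le> ln (real X) / (1/2)" using lnX by (intro divide_left_mono) auto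
    moreover have "real k \<le> ln (real X) / ln 2" using lnX by (simp add: k_def)
    ultimately show "real k \<le> 2 * (1 + ln (real X))" by simp
  qed
  also have "\<dots> = 130 * (1 + ln (real X)) ^ 6 * real X powr (1 - c/8) / (c * \<theta>)"
    by (simp add: B_def eval_nat_numeral)
  finally show ?thesis .
qed

section \<open>Intervals of subset sums\<close>

text \<open>Indexed by a family, because different primes may have equal root parts and then count
  as separate summands; sums over a plain set of numbers are the case of the identity
  family.\<close>

definition subset_sums :: "('a \<Rightarrow> nat) \<Rightarrow> 'a set \<Rightarrow> nat set" where
  "subset_sums a W = sum a ` Pow W"

lemma subset_sumsI: "T \<subseteq> W \<Longrightarrow> sum a T \<in> subset_sums a W"
  by (auto simp: subset_sums_def)

lemma subset_sums_mono: "V \<subseteq> W \<Longrightarrow> subset_sums a V \<subseteq> subset_sums a W"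
  by (auto simp: subset_sums_def)

lemma subset_sums_Un:
  assumes "finite V" "finite W" "V \<inter> W = {}" "s \<in> subset_sums a V" "t \<in> subset_sums a W"
  shows "s + t \<in> subset_sums a (V \<union> W)"
proof -
  from assms obtain S T where ST: "S \<subseteq> V" "s = sum a S" "T \<subseteq> W" "t = sum a T"
    by (auto simp: subset_sums_def)
  have "sum a (S \<union> T) = sum a S + sum a T"
    using ST assms by (intro sum.union_disjoint) (auto intro: finite_subset)
  thus ?thesis using ST subset_sumsI[of "S \<union> T" "V \<union> W" a] by auto
qed

lemma subset_sums_le:
  assumes "finite W" "t \<in> subset_sums a W"
  shows "t \<le> sum a W"
  using assms by (auto simp: subset_sums_def intro!: sum_mono2)

text \<open>An interval of L + 1 consecutive sums and its translate by a term of size at most L + 1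
  leave no gap, so each further term lengthens the interval by its full size.\<close>

lemma subset_sums_greedy:
  assumes "finite R" "finite W" "R \<inter> W = {}"
    and "\<And>j. j \<in> R \<Longrightarrow> a j \<le> Suc L"
    and "{B..B+L} \<subseteq> subset_sums a W"
  shows "{B..B + L + sum a R} \<subseteq> subset_sums a (W \<union> R)"
  using assms
proof (induction R rule: finite_induct)
  case (insert r R)
  have IH: "{B..B + L + sum a R} \<subseteq> subset_sums a (W \<union> R)"
    using insert by (intro insert.IH) auto
  show ?case
  proof
    fix t assume t: "t \<in> {B..B + L + sum a (insert r R)}"
    show "t \<in> subset_sums a (W \<union> insert r R)"
    proof (cases "t \<le> B + L + sum a R")
      case True
      hence "t \<in> subset_sums a (W \<union> R)" using t IH by auto
      thus ?thesis using subset_sums_mono[of "W \<union> R" "W \<union> insert r R" a] by auto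
    next
      case False
      moreover have "a r \<le> Suc L" using insert.prems by auto
      ultimately have "t - a r \<in> {B..B + L + sum a R}" using t insert.hyps by auto
      hence "t - a r \<in> subset_sums a (W \<union> R)" using IH by auto
      moreover have "a r \<in> subset_sums a {r}" using subset_sumsI[of "{r}" "{r}" a] by simp
      ultimately have "(t - a r) + a r \<in> subset_sums a ((W \<union> R) \<union> {r})"
        using insert by (intro subset_sums_Un) auto
      moreover have "a r \<le> t" using False \<open>a r \<le> Suc L\<close> by linarith
      ultimately show ?thesis by simp
    qed
  qed
qed auto

text \<open>Otherwise every \<open>a j\<close> lies in the stabilizer \<open>P\<close> of
  \<open>S\<close> modulo g. Its least positive element d divides g and all \<open>a j\<close>, so a
  prime factor of d would contradict \<open>gcd\<close>. Thus d = 1, all translations preserve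
  \<open>S\<close>, and \<open>S\<close> is everything.\<close>

lemma exists_translate_leaving_residue_set:
  fixes S :: "nat set" and g :: nat
  assumes g: "g > 0" and S: "S \<subseteq> {..<g}" "S \<noteq> {}" "S \<noteq> {..<g}"
    and gcd: "\<And>q. prime q \<Longrightarrow> q dvd g \<Longrightarrow> \<exists>j\<in>R. \<not> q dvd a j"
  shows "\<exists>j\<in>R. \<exists>s\<in>S. (s + a j) mod g \<notin> S"
proof (rule ccontr)
  assume "\<not> ?thesis"
  hence closed: "(s + a j) mod g \<in> S" if "s \<in> S" "j \<in> R" for s j using that by auto
  define P where "P = {x. \<forall>s\<in>S. (s + x) mod g \<in> S}"
  have P0: "0 \<in> P" using S by (auto simp: P_def subset_iff)
  have Padd: "x + y \<in> P" if "x \<in> P" "y \<in> P" for x y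
  proof -
    have "(s + (x + y)) mod g \<in> S" if "s \<in> S" for s
    proof -
      have "((s + x) mod g + y) mod g \<in> S" using that \<open>x \<in> P\<close> \<open>y \<in> P\<close> by (auto simp: P_def)
      thus ?thesis by (simp add: mod_add_left_eq add.assoc)
    qed
    thus ?thesis by (auto simp: P_def)
  qed
  have Pmult: "m * x \<in> P" if "x \<in> P" for m x
    by (induction m) (use P0 Padd that in auto)
  have Pmod: "x \<in> P" if "x mod g = y mod g" "y \<in> P" for x y
  proof -
    have "(s + x) mod g = (s + y) mod g" for s using that(1) by (metis mod_add_right_eq)
    thus ?thesis using that by (auto simp: P_def)
  qed
  have aP: "a j \<in> P" if "j \<in> R" for j using closed that by (auto simp: P_def)
  have gP: "g \<in> P" using Pmod[OF _ P0, of g] by simp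
  have "\<exists>d. d > 0 \<and> d \<in> P" using gP g by blast
  define d where "d = (LEAST d. d > 0 \<and> d \<in> P)"
  have d: "d > 0" "d \<in> P" using LeastI_ex[OF \<open>\<exists>d. d > 0 \<and> d \<in> P\<close>] by (auto simp: d_def)
  have dvd: "d dvd x" if "x \<in> P" for x
  proof (rule ccontr)
    assume nd: "\<not> d dvd x"
    \<comment> \<open>Subtracting (x div d) d is replaced by adding g - 1 times it, which is the
      same modulo g and stays inside the natural numbers.\<close>
    define e where "e = (g - 1) * (x div d) * d"
    have "x mod d + g * (x div d * d) = x + e"
    proof -
      have "x + e = x mod d + (x div d * d + (g - 1) * (x div d * d))" by (simp add: e_def mult.assoc)
      also have "x div d * d + (g - 1) * (x div d * d) = Suc (g - 1) * (x div d * d)" by simp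
      also have "Suc (g - 1) = g" using g by simp
      finally show ?thesis by simp
    qed
    moreover have "x + e \<in> P" unfolding e_def by (intro Padd Pmult that d)
    ultimately have "x mod d \<in> P" using Pmod[of "x mod d" "x + e"] by (metis mod_mult_self2)
    moreover have "x mod d > 0" using nd by (simp add: dvd_eq_mod_eq_0)
    ultimately have "d \<le> x mod d" unfolding d_def by (intro Least_le) auto
    thus False using d(1) mod_less_divisor[of d x] by linarith
  qed
  have "d = 1"
  proof (rule ccontr)
    assume "d \<noteq> 1"
    then obtain q where q: "prime q" "q dvd d" using prime_factor_nat by blast
    from gcd[of q] q dvd[OF gP] obtain j where "j \<in> R" "\<not> q dvd a j" using dvd_trans by blast
    moreover have "q dvd a j" using q dvd[OF aP[OF \<open>j \<in> R\<close>]] dvd_trans by blast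
    ultimately show False by blast
  qed
  hence all: "x \<in> P" for x using Pmult[OF d(2), of x] by simp
  from S obtain s where s: "s \<in> S" by auto
  have "{..<g} \<subseteq> S"
  proof
    fix t assume t: "t \<in> {..<g}"
    have "s < g" using s S by auto
    have "(s + (t + g - s)) mod g \<in> S" using all[of "t + g - s"] s by (auto simp: P_def)
    thus "t \<in> S" using t \<open>s < g\<close> by simp
  qed
  thus False using S by auto
qed

lemma subset_sums_cover_residues:
  fixes g :: nat
  assumes g: "g > 0" and fin: "finite R"
    and many: "\<And>q. prime q \<Longrightarrow> q dvd g \<Longrightarrow> g \<le> card {j\<in>R. \<not> q dvd a j}"
  shows "\<exists>R'\<subseteq>R. card R' < g \<and> (\<forall>r<g. \<exists>t\<in>subset_sums a R'. t mod g = r)"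
proof -
  have "\<exists>R'\<subseteq>R. card R' \<le> i \<and> min g (Suc i) \<le> card ((\<lambda>t. t mod g) ` subset_sums a R')" if "i < g" for i
    using that
  proof (induction i)
    case 0
    show ?case by (rule exI[of _ "{}"]) (auto simp: subset_sums_def)
  next
    case (Suc i)
    then obtain R' where R': "R' \<subseteq> R" "card R' \<le> i"
      "min g (Suc i) \<le> card ((\<lambda>t. t mod g) ` subset_sums a R')" by auto
    have fR': "finite R'" using R' fin finite_subset by blast
    define S where "S = (\<lambda>t. t mod g) ` subset_sums a R'"
    have S: "S \<subseteq> {..<g}" using g by (auto simp: S_def)
    have fS: "finite S" using S finite_subset by blast
    show ?case
    proof (cases "S = {..<g}")
      case True
      thus ?thesis using R' Suc.prems by (intro exI[of _ R']) (auto simp: S_def)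
    next
      case False
      have "\<exists>j\<in>R - R'. \<exists>s\<in>S. (s + a j) mod g \<notin> S"
      proof (rule exists_translate_leaving_residue_set[OF g S _ False])
        show "S \<noteq> {}" by (auto simp: S_def subset_sums_def)
        fix q assume q: "prime q" "q dvd g"
        have "card R' < card {j\<in>R. \<not> q dvd a j}" using many[OF q] R' Suc.prems by linarith
        hence "\<not> {j\<in>R. \<not> q dvd a j} \<subseteq> R'" using card_mono[OF fR'] by (metis leD)
        thus "\<exists>j\<in>R - R'. \<not> q dvd a j" by auto
      qed
      then obtain j s where js: "j \<in> R" "j \<notin> R'" "s \<in> S" "(s + a j) mod g \<notin> S" by auto
      define R'' where "R'' = insert j R'"
      have sub: "insert ((s + a j) mod g) S \<subseteq> (\<lambda>t. t mod g) ` subset_sums a R''"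
      proof -
        from js(3) obtain t where t: "t \<in> subset_sums a R'" "s = t mod g" by (auto simp: S_def)
        have "t + a j \<in> subset_sums a (R' \<union> {j})"
          using js fR' t subset_sumsI[of "{j}" "{j}" a] by (intro subset_sums_Un) auto
        moreover have "(s + a j) mod g = (t + a j) mod g" using t by (simp add: mod_add_left_eq)
        moreover have "subset_sums a R' \<subseteq> subset_sums a R''"
          by (rule subset_sums_mono) (auto simp: R''_def)
        ultimately show ?thesis by (auto simp: S_def R''_def)
      qed
      have fin'': "finite ((\<lambda>t. t mod g) ` subset_sums a R'')"
        using fR' by (auto simp: subset_sums_def R''_def)
      have "Suc (card S) = card (insert ((s + a j) mod g) S)" using js fS by simp
      also have "\<dots> \<le> card ((\<lambda>t. t mod g) ` subset_sums a R'')" by (rule card_mono[OF fin'' sub])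
      finally have "min g (Suc (Suc i)) \<le> card ((\<lambda>t. t mod g) ` subset_sums a R'')"
        using R'(3) by (auto simp: S_def)
      thus ?thesis using js R' fR' by (intro exI[of _ R'']) (auto simp: R''_def card_insert_if)
    qed
  qed
  from this[of "g - 1"] g obtain R' where R': "R' \<subseteq> R" "card R' \<le> g - 1"
    "g \<le> card ((\<lambda>t. t mod g) ` subset_sums a R')" by auto
  have sub: "(\<lambda>t. t mod g) ` subset_sums a R' \<subseteq> {..<g}" using g by auto
  have "(\<lambda>t. t mod g) ` subset_sums a R' = {..<g}"
    using R'(3) card_mono[OF _ sub] by (intro card_subset_eq sub) auto
  hence "\<forall>r<g. \<exists>t\<in>subset_sums a R'. t mod g = r" by (auto simp: set_eq_iff image_iff) metis
  thus ?thesis using R' g by (intro exI[of _ R']) auto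
qed


section \<open>Arithmetic progressions among subset sums\<close>

text \<open>\<open>J\<close> counts steps, not terms. The summands are the elements of
  \<open>V\<close> themselves, so disjoint pairs are pairs of distinct values.\<close>

definition contains_ap :: "nat \<Rightarrow> nat \<Rightarrow> nat set \<Rightarrow> bool" where
  "contains_ap g J V \<longleftrightarrow> (\<exists>b. \<forall>j\<le>J. b + g * j \<in> subset_sums (\<lambda>x. x) V)"

lemma contains_ap_mono: "contains_ap g J V \<Longrightarrow> J' \<le> J \<Longrightarrow> V \<subseteq> V' \<Longrightarrow> contains_ap g J' V'"
  unfolding contains_ap_def using subset_sums_mono by (meson le_trans subsetD)

text \<open>Taking u or u + g t shifts the progression by 0 or t steps; the two copies join without
  a gap because t \<le> J + 1.\<close>

lemma contains_ap_pair:
  assumes ap: "contains_ap g J V" and V: "finite V" "u \<notin> V" "u + g * t \<notin> V" and t: "t \<le> Suc J"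
  shows "contains_ap g (J + t) (V \<union> {u, u + g * t})"
proof -
  from ap obtain b where b: "\<And>j. j \<le> J \<Longrightarrow> b + g * j \<in> subset_sums (\<lambda>x. x) V"
    by (auto simp: contains_ap_def)
  have add: "x + y \<in> subset_sums (\<lambda>x. x) (V \<union> {u, u + g * t})"
    if "x \<in> subset_sums (\<lambda>x. x) V" "y \<in> {u, u + g * t}" for x y
  proof -
    have "y \<in> subset_sums (\<lambda>x. x) {y}" using subset_sumsI[of "{y}" "{y}" "\<lambda>x. x"] by simp
    hence "x + y \<in> subset_sums (\<lambda>x. x) (V \<union> {y})"
      using that V by (intro subset_sums_Un) auto
    thus ?thesis using that(2) subset_sums_mono[of "V \<union> {y}" "V \<union> {u, u + g * t}"] by blast
  qed
  have "b + u + g * j \<in> subset_sums (\<lambda>x. x) (V \<union> {u, u + g * t})" if "j \<le> J + t" for j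
  proof (cases "j \<le> J")
    case True
    have "(b + g * j) + u \<in> subset_sums (\<lambda>x. x) (V \<union> {u, u + g * t})"
      using True by (intro add b) auto
    thus ?thesis by (simp add: add_ac)
  next
    case False
    hence "t \<le> j" using t by simp
    have "(b + g * (j - t)) + (u + g * t) \<in> subset_sums (\<lambda>x. x) (V \<union> {u, u + g * t})"
      using that by (intro add b) auto
    moreover have "g * (j - t) + g * t = g * j" using \<open>t \<le> j\<close> by (simp flip: distrib_left)
    ultimately show ?thesis by (simp add: add_ac)
  qed
  thus ?thesis by (auto simp: contains_ap_def)
qed

text \<open>Pair the minimum of \<open>T\<close> with its maximum, then recurse on the rest. As the
  elements are congruent modulo g, a set of r elements has extremes at least r - 1 steps apart, and
  (r - 1) + (r - 3) + ... is the floor of r^2 / 4. This quadratic gain makes the progression longer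
  than the largest term.\<close>

lemma contains_ap_residue_class:
  assumes "contains_ap g J V" "finite V" "finite T" "V \<inter> T = {}" "g > 0"
    and "\<And>x y. x \<in> T \<Longrightarrow> y \<in> T \<Longrightarrow> x mod g = y mod g"
    and "\<And>x y. x \<in> T \<Longrightarrow> y \<in> T \<Longrightarrow> x \<le> y + g * J"
  shows "contains_ap g (J + card T ^ 2 div 4) (V \<union> T)"
  using assms
proof (induction "card T" arbitrary: T V J rule: less_induct)
  case (less T V J)
  show ?case
  proof (cases "card T \<le> 1")
    case True
    hence "card T = 0 \<or> card T = 1" by linarith
    thus ?thesis using contains_ap_mono[OF less.prems(1), of J "V \<union> T"] by auto
  next
    case False
    define u where "u = Min T"
    define v where "v = Max T"
    have "T \<noteq> {}" using False by auto
    hence uv: "u \<in> T" "v \<in> T" using less.prems by (auto simp: u_def v_def)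
    have rng: "u \<le> x" "x \<le> v" if "x \<in> T" for x
      using that less.prems by (auto simp: u_def v_def)
    have mod: "\<exists>i. x = u + g * i" if "x \<in> T" for x
      using less.prems(6)[OF that uv(1)] rng[OF that] mod_eq_nat1E by metis
    from mod[OF uv(2)] obtain t where t: "v = u + g * t" by blast
    have tJ: "t \<le> J" using less.prems(7)[OF uv(2,1)] \<open>g > 0\<close> by (simp add: t)
    have "T \<subseteq> (\<lambda>i. u + g * i) ` {..t}"
    proof
      fix x assume x: "x \<in> T"
      from mod[OF x] obtain i where "x = u + g * i" by blast
      moreover from this rng(2)[OF x] \<open>g > 0\<close> have "i \<le> t" by (simp add: t)
      ultimately show "x \<in> (\<lambda>i. u + g * i) ` {..t}" by auto
    qed
    hence cT: "card T \<le> Suc t" using surj_card_le[of "{..t}" T] by simp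
    have "u \<noteq> v" using cT False \<open>g > 0\<close> by (auto simp: t)
    define T' where "T' = T - {u, v}"
    have cT': "card T' = card T - 2" using uv \<open>u \<noteq> v\<close> less.prems by (simp add: T'_def card_Diff_subset)
    have "contains_ap g (J + t) (V \<union> {u, u + g * t})"
      using less.prems uv tJ by (intro contains_ap_pair) (auto simp: t)
    hence ap: "contains_ap g (J + (card T - 1)) (V \<union> {u, v})"
      by (rule contains_ap_mono) (use cT in \<open>auto simp: t\<close>)
    have "contains_ap g (J + (card T - 1) + card T' ^ 2 div 4) (V \<union> {u, v} \<union> T')"
    proof (rule less.hyps[OF _ ap])
      fix x y assume "x \<in> T'" "y \<in> T'"
      thus "x \<le> y + g * (J + (card T - 1))"
        using less.prems(7)[of x y] by (auto simp: T'_def distrib_left)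
    qed (use less.prems cT' False in \<open>auto simp: T'_def\<close>)
    moreover have "V \<union> {u, v} \<union> T' = V \<union> T" using uv by (auto simp: T'_def)
    moreover have "J + card T ^ 2 div 4 \<le> J + (card T - 1) + card T' ^ 2 div 4"
    proof -
      obtain s where s: "card T = s + 2" using False by (metis add.commute le_Suc_ex not_less_eq_eq numeral_2_eq_2 One_nat_def)
      have "(s + 2)^2 = s^2 + 4 * (s + 1)" by (simp add: power2_eq_square algebra_simps)
      hence "(s + 2)^2 div 4 = s^2 div 4 + (s + 1)" by (metis add.commute div_mult_self2 zero_neq_numeral)
      thus ?thesis by (simp add: cT' s)
    qed
    ultimately show ?thesis using contains_ap_mono by (metis order_refl)
  qed
qed

lemma contains_ap_equal_differences:
  fixes u :: "'i \<Rightarrow> nat"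
  assumes "finite I"
    and "\<And>i j. i \<in> I \<Longrightarrow> j \<in> I \<Longrightarrow> i \<noteq> j \<Longrightarrow> {u i, u i + g} \<inter> {u j, u j + g} = {}"
  shows "contains_ap g (card I) (\<Union>i\<in>I. {u i, u i + g})"
  using assms
proof (induction I rule: finite_induct)
  case empty
  show ?case by (auto simp: contains_ap_def subset_sums_def intro!: exI[of _ 0])
next
  case (insert i I)
  have "contains_ap g (card I) (\<Union>i\<in>I. {u i, u i + g})" using insert by auto
  moreover have "{u i, u i + g} \<inter> (\<Union>j\<in>I. {u j, u j + g}) = {}"
    using insert.prems[of i] insert.hyps by blast
  ultimately have "contains_ap g (card I + 1) ((\<Union>i\<in>I. {u i, u i + g}) \<union> {u i, u i + g * 1})"
    using insert.hyps by (intro contains_ap_pair) auto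
  thus ?case using insert.hyps by (simp add: Un_commute)
qed

lemma card_eq_sum_fibres:
  assumes "finite A" "finite B" "f ` A \<subseteq> B"
  shows "card A = (\<Sum>b\<in>B. card {x\<in>A. f x = b})"
  using sum.group[OF assms, of "\<lambda>_. 1 :: nat"] by simp

lemma pigeonhole_sum:
  assumes "finite A" "finite B" "f ` A \<subseteq> B" "B \<noteq> {}"
  shows "\<exists>b\<in>B. card A \<le> card B * card {x\<in>A. f x = b}"
proof (rule ccontr)
  assume "\<not> ?thesis"
  hence *: "card B * card {x\<in>A. f x = b} < card A" if "b \<in> B" for b using that by force
  have "card A = (\<Sum>b\<in>B. card {x\<in>A. f x = b})"
    using assms by (intro card_eq_sum_fibres) auto
  hence "card B * card A = (\<Sum>b\<in>B. card B * card {x\<in>A. f x = b})" by (simp add: sum_distrib_left)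
  also have "\<dots> < (\<Sum>b\<in>B. card A)" using * assms by (intro sum_strict_mono) auto
  finally show False by simp
qed

text \<open>Cut \<open>[0, Z]\<close> into blocks of length \<open>l\<close>, pick two elements of \<open>V\<close> from every block that contains
  at least two, and keep the most frequent difference.\<close>
lemma exists_short_ap:
  assumes V: "finite V" "V \<subseteq> {..Z}" and l: "l > 0"
  shows "\<exists>g m. 0 < g \<and> g \<le> l \<and> contains_ap g m V \<and> card V \<le> Z div l + 1 + l * (l * m)"
proof -
  define blk where "blk i = {x\<in>V. x div l = i}" for i
  define B where "B = {i\<in>{..Z div l}. 2 \<le> card (blk i)}"
  have fin: "finite (blk i)" for i using V by (simp add: blk_def)
  have cblk: "card (blk i) \<le> l" for i
  proof -
    have "blk i \<subseteq> {i * l..<i * l + l}"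
      using l by (auto simp: blk_def) (metis dividend_less_div_times add.commute)
    from card_mono[OF _ this] show ?thesis by simp
  qed
  have "card V = (\<Sum>i\<le>Z div l. card (blk i))"
    unfolding blk_def using V by (intro card_eq_sum_fibres) (auto intro!: div_le_mono)
  also have "\<dots> \<le> (\<Sum>i\<le>Z div l. 1 + (if i \<in> B then l else 0))"
    using cblk by (intro sum_mono) (auto simp: B_def not_le intro: le_SucI)
  also have "\<dots> = Z div l + 1 + l * card B"
    by (subst sum.distrib) (simp add: sum.If_cases B_def Int_def)
  finally have cV: "card V \<le> Z div l + 1 + l * card B" .
  have "\<exists>x d. x \<in> blk i \<and> x + d \<in> blk i \<and> 0 < d \<and> d \<le> l" if "i \<in> B" for i
  proof -
    have "\<exists>T. T \<subseteq> blk i \<and> card T = 2"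
      using that obtain_subset_with_card_n[of 2 "blk i"] by (auto simp: B_def)
    then obtain x y where "x \<in> blk i" "y \<in> blk i" "x \<noteq> y" by (auto simp: card_2_iff)
    then obtain x y where xy: "x \<in> blk i" "y \<in> blk i" "x < y" by (metis linorder_neqE_nat)
    have "y < x + l"
    proof -
      have "y < l * (y div l) + l" using mult_div_mod_eq[of l y] mod_less_divisor[OF l, of y] by linarith
      moreover have "l * (x div l) \<le> x" by simp
      moreover have "x div l = y div l" using xy by (simp add: blk_def)
      ultimately show ?thesis by simp
    qed
    thus ?thesis using xy by (intro exI[of _ x] exI[of _ "y - x"]) auto
  qed
  then obtain u d where ud: "\<And>i. i \<in> B \<Longrightarrow> u i \<in> blk i \<and> u i + d i \<in> blk i \<and> 0 < d i \<and> d i \<le> l" by metis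
  have "\<exists>g\<in>{1..l}. card B \<le> card {1..l} * card {i\<in>B. d i = g}"
    by (intro pigeonhole_sum) (use ud l in \<open>force simp: B_def\<close>)+
  then obtain g where g: "1 \<le> g" "g \<le> l" "card B \<le> l * card {i\<in>B. d i = g}" by auto
  define I where "I = {i\<in>B. d i = g}"
  have inb: "u i \<in> blk i" "u i + g \<in> blk i" if "i \<in> I" for i using ud[of i] that by (auto simp: I_def)
  have "contains_ap g (card I) (\<Union>i\<in>I. {u i, u i + g})"
  proof (rule contains_ap_equal_differences)
    show "finite I" by (simp add: I_def B_def)
    fix i j assume "i \<in> I" "j \<in> I" "i \<noteq> j"
    thus "{u i, u i + g} \<inter> {u j, u j + g} = {}" using inb[of i] inb[of j] by (auto simp: blk_def)
  qed
  moreover have "(\<Union>i\<in>I. {u i, u i + g}) \<subseteq> V" using inb by (auto simp: blk_def)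
  ultimately have "contains_ap g (card I) V" by (rule contains_ap_mono[OF _ order_refl])
  moreover have "card V \<le> Z div l + 1 + l * (l * card I)"
    using cV mult_le_mono2[OF g(3), of l] unfolding I_def by linarith
  ultimately show ?thesis using g by (intro exI[of _ g] exI[of _ "card I"]) auto
qed

text \<open>Half of \<open>V\<close> supplies m disjoint pairs with a common difference g \<le> 2
  \<Lambda>, where Z \<le> 16 \<Lambda>^3 m. In the other half one class \<open>T\<close> of
  congruent and close elements has size s with Z \<le> 18 \<Lambda>^4 s, and its s^2 / 4 further
  steps exceed 2 Z because Z is at least 4000 \<Lambda>^8.\<close>

lemma exists_long_ap:
  assumes V: "finite V" "V \<subseteq> {..Z}" "card V = 2 * v" and Z: "Z \<le> \<Lambda> * v" and L: "\<Lambda> \<ge> 1"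
    and big: "4000 * \<Lambda> ^ 8 \<le> Z"
  shows "\<exists>g. 0 < g \<and> g \<le> 2 * \<Lambda> \<and> contains_ap g (2 * Z) V"
proof -
  obtain V1 where V1: "V1 \<subseteq> V" "card V1 = v"
    using obtain_subset_with_card_n[of v V] V by auto
  define V2 where "V2 = V - V1"
  have fV1: "finite V1" using V1 V finite_subset by blast
  have V2: "finite V2" "card V2 = v" "V1 \<inter> V2 = {}" "V2 \<subseteq> V"
    using V V1 fV1 by (auto simp: V2_def card_Diff_subset)
  have L8: "\<Lambda> \<le> \<Lambda> ^ 8" "1 \<le> \<Lambda> ^ 8" using L by (auto intro: self_le_power)
  have v: "v \<ge> 4"
  proof (rule ccontr)
    assume "\<not> v \<ge> 4"
    hence "\<Lambda> * v \<le> \<Lambda> * 3" by (intro mult_le_mono2) auto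
    thus False using Z big L8 by linarith
  qed
  obtain g m where gm: "0 < g" "g \<le> 2 * \<Lambda>" "contains_ap g m V1"
      "card V1 \<le> Z div (2 * \<Lambda>) + 1 + 2 * \<Lambda> * (2 * \<Lambda> * m)"
    using exists_short_ap[of V1 Z "2 * \<Lambda>"] V V1 fV1 L by auto
  have "Z div (2 * \<Lambda>) * (2 * \<Lambda>) \<le> \<Lambda> * v" using Z div_times_less_eq_dividend[of Z "2 * \<Lambda>"] by linarith
  hence "\<Lambda> * (2 * (Z div (2 * \<Lambda>))) \<le> \<Lambda> * v" by (simp add: mult_ac)
  hence "2 * (Z div (2 * \<Lambda>)) \<le> v" using L by simp
  hence "v \<le> 16 * (\<Lambda> * \<Lambda> * m)" using gm(4) V1 v by (simp add: mult_ac)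
  hence "\<Lambda> * v \<le> \<Lambda> * (16 * (\<Lambda> * \<Lambda> * m))" by (rule mult_le_mono2)
  hence "Z \<le> \<Lambda> * (16 * (\<Lambda> * \<Lambda> * m))" using Z by (rule order_trans[rotated])
  hence Zm: "Z \<le> 16 * \<Lambda> ^ 3 * m" by (simp add: power3_eq_cube mult_ac)
  have m: "m > 0" using Zm big L8 by (intro Nat.gr0I) auto
  \<comment> \<open>A class fixes the residue modulo g and a block of length g m, so two of its
    elements are fewer than m steps of g apart, within reach of the progression of m steps already
    built.\<close>
  define C where "C = {..<g} \<times> {..Z div (g * m)}"
  have "\<exists>c\<in>C. card V2 \<le> card C * card {x\<in>V2. (x mod g, x div (g * m)) = c}"
    using V V2 gm by (intro pigeonhole_sum) (auto simp: C_def intro!: div_le_mono)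
  then obtain c where c: "v \<le> card C * card {x\<in>V2. (x mod g, x div (g * m)) = c}" using V2 by auto
  define T where "T = {x\<in>V2. (x mod g, x div (g * m)) = c}"
  define s where "s = card T"
  have "card C = g * (Z div (g * m)) + g" by (simp add: C_def card_cartesian_product)
  also have "g * (Z div (g * m)) \<le> 16 * \<Lambda> ^ 3"
  proof -
    have "m * (g * (Z div (g * m))) \<le> Z" using div_times_less_eq_dividend[of Z "g * m"] by (simp add: mult_ac)
    also have "\<dots> \<le> m * (16 * \<Lambda> ^ 3)" using Zm by (simp add: mult_ac)
    finally show ?thesis using m mult_le_cancel1 by blast
  qed
  also have "16 * \<Lambda> ^ 3 + g \<le> 18 * \<Lambda> ^ 3" using gm(2) self_le_power[of \<Lambda> 3] L by linarith
  finally have "v \<le> 18 * \<Lambda> ^ 3 * s" using c mult_le_mono1[of "card C" "18 * \<Lambda> ^ 3" s]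
    unfolding s_def T_def by linarith
  hence "\<Lambda> * v \<le> \<Lambda> * (18 * \<Lambda> ^ 3 * s)" by (rule mult_le_mono2)
  hence "Z \<le> \<Lambda> * (18 * \<Lambda> ^ 3 * s)" using Z by (rule order_trans[rotated])
  hence Zs: "Z \<le> 18 * \<Lambda> ^ 4 * s" by (simp add: power3_eq_cube power4_eq_xxxx mult_ac)
  have "Z * Z \<le> (18 * \<Lambda> ^ 4 * s) * (18 * \<Lambda> ^ 4 * s)" by (intro mult_le_mono Zs)
  also have "\<dots> = 324 * \<Lambda> ^ 8 * s ^ 2" by (simp add: power2_eq_square flip: power_add)
  finally have "Z * (4000 * \<Lambda> ^ 8) \<le> 324 * \<Lambda> ^ 8 * s ^ 2"
    using big mult_le_mono2[OF big, of Z] by linarith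
  hence "\<Lambda> ^ 8 * (4000 * Z) \<le> \<Lambda> ^ 8 * (324 * s ^ 2)" by (simp add: mult_ac)
  hence "4000 * Z \<le> 324 * s ^ 2" using L8 mult_le_cancel1[of "\<Lambda> ^ 8" "4000 * Z" "324 * s ^ 2"] by linarith
  \<comment> \<open>Here 324 = 18^2, and s^2 \<ge> 8 Z is needed; 4000 / 324 is above 12, which
    leaves room for rounding.\<close>
  hence sq: "2 * Z \<le> m + card T ^ 2 div 4" using big L8 unfolding s_def by linarith
  have "contains_ap g (m + card T ^ 2 div 4) (V1 \<union> T)"
  proof (rule contains_ap_residue_class[OF gm(3) fV1])
    fix x y assume xy: "x \<in> T" "y \<in> T"
    thus "x mod g = y mod g" by (auto simp: T_def)
    define q where "q = y div (g * m)"
    have "x = (g * m) * q + x mod (g * m)"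
    proof -
      have "x div (g * m) = q" using xy by (auto simp: T_def q_def)
      thus ?thesis using mult_div_mod_eq[of "g * m" x] by simp
    qed
    moreover have "x mod (g * m) < g * m" using gm(1) m by simp
    moreover have "(g * m) * q \<le> y" by (simp add: q_def)
    ultimately show "x \<le> y + g * m" by linarith
  qed (use V2 gm in \<open>auto simp: T_def\<close>)
  moreover have "V1 \<union> T \<subseteq> V" using V1 V2 by (auto simp: T_def)
  ultimately have "contains_ap g (2 * Z) V" by (rule contains_ap_mono[OF _ sq])
  thus ?thesis using gm by blast
qed

lemma subset_sums_image:
  assumes "inj_on a V"
  shows "subset_sums (\<lambda>x. x) (a ` V) = subset_sums a V"
proof -
  have "sum (\<lambda>x. x) (a ` T) = sum a T" if "T \<subseteq> V" for T
    using sum.reindex[OF inj_on_subset[OF assms that], of "\<lambda>x. x"] by simp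
  thus ?thesis unfolding subset_sums_def image_Pow_surj[OF refl, symmetric] image_image
    by (intro image_cong) auto
qed

text \<open>\<open>W\<close> consists of the progression's terms \<open>V\<close> and the residue
  terms \<open>R\<close>; everything else extends the interval greedily. The count in
  \<open>many\<close> is chosen so that at least g terms not divisible by q remain after
  \<open>V\<close> is removed. Since the base interval consists of sums from \<open>W\<close>, its
  lower end is at most the total of \<open>W\<close>.\<close>

lemma subset_sums_cover_interval:
  fixes a :: "'i \<Rightarrow> nat"
  assumes I: "finite I" and aZ: "\<And>i. i \<in> I \<Longrightarrow> a i \<le> Z"
    and V: "V \<subseteq> I" "inj_on a V" "card V = 2 * v"
    and Z: "Z \<le> \<Lambda> * v" and L: "\<Lambda> \<ge> 1" and big: "4000 * \<Lambda> ^ 8 \<le> Z"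
    and many: "\<And>q. prime q \<Longrightarrow> q \<le> 2 * \<Lambda> \<Longrightarrow> 2 * v + 2 * \<Lambda> \<le> card {j\<in>I. \<not> q dvd a j}"
  shows "\<exists>W\<subseteq>I. card W \<le> 2 * v + 2 * \<Lambda> \<and> {sum a W..sum a I - sum a W} \<subseteq> subset_sums a I"
proof -
  have fV: "finite V" using V I finite_subset by blast
  have "\<exists>g. 0 < g \<and> g \<le> 2 * \<Lambda> \<and> contains_ap g (2 * Z) (a ` V)"
    using V aZ Z L big fV by (intro exists_long_ap[of _ _ v]) (auto simp: card_image)
  then obtain g b where g: "0 < g" "g \<le> 2 * \<Lambda>"
    and ap: "\<And>j. j \<le> 2 * Z \<Longrightarrow> b + g * j \<in> subset_sums a V"
    by (auto simp: contains_ap_def subset_sums_image[OF V(2)])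
  have "\<exists>R\<subseteq>I - V. card R < g \<and> (\<forall>r<g. \<exists>t\<in>subset_sums a R. t mod g = r)"
  proof (rule subset_sums_cover_residues[OF g(1)])
    fix q assume q: "prime q" "q dvd g"
    hence "q \<le> 2 * \<Lambda>" using g dvd_imp_le[of q g] by linarith
    from many[OF q(1) this] have "2 * v + 2 * \<Lambda> \<le> card {j\<in>I. \<not> q dvd a j}" .
    also have "\<dots> \<le> card ({j\<in>I - V. \<not> q dvd a j} \<union> V)"
      using I fV by (intro card_mono) auto
    also have "\<dots> \<le> card {j\<in>I - V. \<not> q dvd a j} + 2 * v"
      using card_Un_le[of _ V] V(3) by metis
    finally show "g \<le> card {j\<in>I - V. \<not> q dvd a j}" using g by linarith
  qed (use I in auto)
  then obtain R where R: "R \<subseteq> I - V" "card R < g" "\<And>r. r < g \<Longrightarrow> \<exists>t\<in>subset_sums a R. t mod g = r"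
    by auto
  have fR: "finite R" using R I finite_subset by blast
  define W where "W = V \<union> R"
  have W: "W \<subseteq> I" "finite W" using R V fR fV by (auto simp: W_def)
  have "card W \<le> 2 * v + 2 * \<Lambda>" using card_Un_le[of V R] R g V by (simp add: W_def)
  have sR: "t \<le> g * Z" if "t \<in> subset_sums a R" for t
  proof -
    have "t \<le> sum a R" using that fR by (rule subset_sums_le[rotated])
    also have "\<dots> \<le> card R * Z" using R aZ by (intro sum_bounded_above[where K = Z, simplified]) auto
    also have "\<dots> \<le> g * Z" using R by (intro mult_le_mono1) auto
    finally show ?thesis .
  qed
  \<comment> \<open>Use of the length 2 Z: sums from \<open>R\<close> reach up to g Z, so half of
    the progression is spent on reaching a prescribed residue, and the other half leaves an interval
    of length g Z, no shorter than any term.\<close>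
  have base: "{b + g * Z..b + g * Z + g * Z} \<subseteq> subset_sums a W"
  proof
    fix t assume t: "t \<in> {b + g * Z..b + g * Z + g * Z}"
    obtain s where s: "s \<in> subset_sums a R" "s mod g = (t - b) mod g" using R(3)[of "(t - b) mod g"] g by auto
    have sle: "s \<le> t - b" using sR[OF s(1)] t by auto
    then obtain i where i: "t - b = s + g * i" using s(2) mod_eq_nat1E[of "t - b" g s] by metis
    have "t \<le> b + (g * Z + g * Z)" using t by simp
    hence "g * i \<le> g * Z + g * Z" using i by linarith
    hence "g * i \<le> g * (2 * Z)" by (simp only: mult_2 distrib_left)
    hence "i \<le> 2 * Z" using g(1) mult_le_cancel1 by blast
    from ap[OF this] have "(b + g * i) + s \<in> subset_sums a (V \<union> R)"
      using s fV fR R by (intro subset_sums_Un) auto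
    moreover have "t = b + g * i + s" using i t by auto
    ultimately show "t \<in> subset_sums a W" by (simp add: W_def)
  qed
  have "{b + g * Z..b + g * Z + g * Z + sum a (I - W)} \<subseteq> subset_sums a (W \<union> (I - W))"
  proof (rule subset_sums_greedy[OF _ W(2) _ _ base])
    fix j assume "j \<in> I - W"
    hence "a j \<le> 1 * Z" using aZ by simp
    also have "\<dots> \<le> g * Z" using g by (intro mult_le_mono1) auto
    finally show "a j \<le> Suc (g * Z)" by simp
  qed (use I in auto)
  moreover have "W \<union> (I - W) = I" using W by auto
  moreover have "sum a (I - W) = sum a I - sum a W" using W by (simp add: sum_diff_nat)
  moreover have "b + g * Z \<le> sum a W"
    using base W by (intro subset_sums_le) auto
  ultimately have "{sum a W..sum a I - sum a W} \<subseteq> subset_sums a I" by (auto simp: subset_iff)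
  thus ?thesis using W \<open>card W \<le> 2 * v + 2 * \<Lambda>\<close> by blast
qed

section \<open>The sequence of primes\<close>

lemma prime_nth_prime: "prime (nth_prime i)"
  using enumerate_in_set[OF primes_infinite, of "i - 1"] by (simp add: nth_prime_def)

lemma nth_prime_less_iff: "1 \<le> i \<Longrightarrow> 1 \<le> j \<Longrightarrow> nth_prime i < nth_prime j \<longleftrightarrow> i < j"
  using primes_infinite by (auto simp: nth_prime_def)

lemma nth_prime_le_iff: "1 \<le> i \<Longrightarrow> 1 \<le> j \<Longrightarrow> nth_prime i \<le> nth_prime j \<longleftrightarrow> i \<le> j"
  using nth_prime_less_iff[of j i] by (simp add: not_less[symmetric])

text \<open>Restricted to positive indices, since truncated subtraction makes
  \<open>nth_prime 0\<close> and \<open>nth_prime 1\<close> both equal to 2.\<close>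

lemma inj_on_nth_prime: "inj_on nth_prime {1..}"
proof (rule inj_onI)
  fix i j assume "i \<in> {1..}" "j \<in> {1..}" "nth_prime i = nth_prime j"
  thus "i = j" using nth_prime_less_iff[of i j] nth_prime_less_iff[of j i] by force
qed

lemma nth_prime_surj: "prime q \<Longrightarrow> \<exists>i\<ge>1. nth_prime i = q"
  using enumerate_Ex[of "{p. prime p}" q] primes_infinite
  by (metis Suc_diff_1 diff_Suc_1 le_add1 mem_Collect_eq nth_prime_def plus_1_eq_Suc)

lemma le_nth_prime: "i \<le> nth_prime i"
proof (induction i)
  case (Suc i)
  show ?case
  proof (cases "i = 0")
    case False
    thus ?thesis using Suc.IH nth_prime_less_iff[of i "Suc i"] by simp
  qed (use prime_ge_1_nat[OF prime_nth_prime] in auto)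
qed simp

lemma nth_prime_image:
  assumes "1 \<le> n"
  shows "nth_prime ` {n<..m} = {q\<in>{nth_prime n<..nth_prime m}. prime q}"
proof (intro equalityI subsetI)
  fix q assume "q \<in> {q\<in>{nth_prime n<..nth_prime m}. prime q}"
  hence q: "nth_prime n < q" "q \<le> nth_prime m" "prime q" by auto
  obtain i where i: "1 \<le> i" "nth_prime i = q" using nth_prime_surj[OF q(3)] by blast
  have "m \<ge> 1"
  proof (rule ccontr)
    assume "\<not> m \<ge> 1"
    \<comment> \<open>The default at index 0: \<open>m - 1\<close> is 0 for m = 0 as for m =
      1.\<close>
    hence "nth_prime m = nth_prime 1" by (simp add: nth_prime_def)
    hence "nth_prime n < nth_prime 1" using q by simp
    thus False using nth_prime_less_iff[of n 1] assms by simp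
  qed
  thus "q \<in> nth_prime ` {n<..m}" using i q nth_prime_less_iff[of n i] nth_prime_le_iff[of i m] assms by auto
qed (use assms in \<open>auto simp: nth_prime_less_iff nth_prime_le_iff prime_nth_prime\<close>)

lemma nth_prime_le:
  assumes "1 \<le> i" "i \<le> card {p. prime p \<and> p \<le> X}"
  shows "nth_prime i \<le> X"
proof (rule ccontr)
  assume "\<not> nth_prime i \<le> X"
  hence X: "X < nth_prime i" by simp
  have "{p. prime p \<and> p \<le> X} \<subseteq> nth_prime ` {1..<i}"
  proof
    fix p assume p: "p \<in> {p. prime p \<and> p \<le> X}"
    then obtain j where j: "1 \<le> j" "nth_prime j = p" using nth_prime_surj by blast
    thus "p \<in> nth_prime ` {1..<i}" using p X assms nth_prime_less_iff[of j i] by auto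
  qed
  hence "card {p. prime p \<and> p \<le> X} \<le> card {1..<i}" by (intro surj_card_le) auto
  thus False using assms by simp
qed

text \<open>The second logarithm absorbs all constants of the Chebyshev bound. The index 2n + 2
  covers a window inside (n, 2n] and the two terms by which its right end may move when n increases
  by one.\<close>

lemma nth_prime_upper_bound:
  "eventually (\<lambda>n. real (nth_prime (2 * n + 2)) \<le> real n * ln (real n) ^ 2) sequentially"
proof -
  have "eventually (\<lambda>x::real. (x * ln x ^ 2 / 2 - 1) * ln 4 - ln (x * ln x ^ 2) - 2 * sqrt (x * ln x^2) * ln (x * ln x ^ 2)^2 \<ge> (2 * x + 2) * ln (x * ln x^2)) at_top"
    by real_asymp
  moreover have "eventually (\<lambda>x::real. x * ln x ^ 2 \<ge> 4) at_top" by real_asymp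
  ultimately have "eventually (\<lambda>x::real. x * ln x ^ 2 \<ge> 4 \<and>
      (x * ln x ^ 2 / 2 - 1) * ln 4 - ln (x * ln x ^ 2) - 2 * sqrt (x * ln x^2) * ln (x * ln x ^ 2)^2 \<ge> (2 * x + 2) * ln (x * ln x^2)) at_top"
    by eventually_elim blast
  from eventually_compose_filterlim[OF this filterlim_real_sequentially] show ?thesis
  proof eventually_elim
    case (elim n)
    define Y where "Y = real n * ln (real n) ^ 2"
    \<comment> \<open>\<open>prime_count_lower_bound\<close> is stated at even arguments, so the
      bound is halved before it is rounded down.\<close>
    define w where "w = nat \<lfloor>Y / 2\<rfloor>"
    have Y: "Y \<ge> 4" using elim by (simp add: Y_def)
    have w: "real w \<le> Y / 2" "Y / 2 - 1 \<le> real w" "w \<ge> 1"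
    proof -
      show "real w \<le> Y / 2" using Y unfolding w_def by (intro of_nat_floor) auto
      show "Y / 2 - 1 \<le> real w" unfolding w_def by linarith
      thus "w \<ge> 1" using Y by linarith
    qed
    have wY: "real (2 * w) \<le> Y" "1 \<le> real (2 * w)" using w by auto
    have l: "0 \<le> ln (real (2 * w))" "ln (real (2 * w)) \<le> ln Y" using wY by auto
    have "(2 * real n + 2) * ln (real (2 * w)) \<le> (2 * real n + 2) * ln Y"
      using l by (intro mult_left_mono) auto
    also have "\<dots> \<le> (Y / 2 - 1) * ln 4 - ln Y - 2 * sqrt Y * ln Y ^ 2"
      using elim unfolding Y_def by blast
    also have "\<dots> \<le> real w * ln 4 - ln (real (2 * w)) - 2 * sqrt (real (2*w)) * ln (real (2*w)) ^ 2"
      using w wY l Y by (intro diff_mono mult_mono mult_right_mono power_mono) auto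
    also have "\<dots> \<le> real (card {p. prime p \<and> p \<le> 2 * w}) * ln (real (2 * w))"
      using w by (intro prime_count_lower_bound) auto
    finally have "2 * real n + 2 \<le> real (card {p. prime p \<and> p \<le> 2 * w})"
      using w by (subst (asm) mult_le_cancel_right_pos) (auto intro!: ln_gt_zero)
    hence "2 * n + 2 \<le> card {p. prime p \<and> p \<le> 2 * w}" by linarith
    hence "nth_prime (2 * n + 2) \<le> 2 * w" by (intro nth_prime_le) auto
    thus ?case using wY(1) unfolding Y_def by linarith
  qed
qed

section \<open>Root parts divisible by a fixed prime\<close>

text \<open>The trigonometric polynomial \<open>sin t + cos(2t)/2\<close> has mean zero but is at least \<open>1/2\<close>
  on \<open>[0, \<pi>]\<close>; it detects that the fractional part of \<open>p\<^sup>1\<^sup>/\<^sup>k / q\<close> is not always below \<open>1/q\<close>.\<close>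
lemma trig_poly_bounds:
  fixes c \<theta> :: real
  defines "T \<equiv> \<lambda>n. Im (power_phase \<theta> c n) + Re (power_phase (2 * \<theta>) c n) / 2"
  shows "\<bar>T n\<bar> \<le> 3 / 2"
    and "real n powr c * \<theta> = of_int s + r \<Longrightarrow> 0 \<le> r \<Longrightarrow> r \<le> 1/2 \<Longrightarrow> 1/2 \<le> T n"
proof -
  have "\<bar>Im (power_phase \<theta> c n)\<bar> \<le> 1" "\<bar>Re (power_phase (2 * \<theta>) c n)\<bar> \<le> 1"
    using abs_Im_le_cmod[of "power_phase \<theta> c n"] abs_Re_le_cmod[of "power_phase (2*\<theta>) c n"] by auto
  thus "\<bar>T n\<bar> \<le> 3 / 2" unfolding T_def by linarith
next
  assume eq: "real n powr c * \<theta> = of_int s + r" and r: "0 \<le> r" "r \<le> 1/2"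
  define u where "u = 2 * pi * r"
  have "sin u \<ge> 0" using r unfolding u_def by (intro sin_ge_zero) auto
  have eq': "\<theta> * real n powr c = of_int s + r" using eq by (simp add: mult.commute)
  have 1: "2 * pi * (\<theta> * real n powr c) = u + 2 * pi * of_int s"
    unfolding eq' by (simp add: u_def algebra_simps)
  have 2: "2 * pi * (2 * \<theta> * real n powr c) = 2 * u + 2 * pi * of_int (2 * s)"
    unfolding mult.assoc eq' by (simp add: u_def algebra_simps)
  have per: "cis (x + 2 * pi * of_int i) = cis x" for x i
    by (simp add: cis_mult[symmetric] cis_multiple_2pi)
  have "T n = sin u + cos (2 * u) / 2"
    unfolding T_def power_phase_def 1 2 per by simp
  also have "\<dots> = 1/2 + sin u * (1 - sin u)" unfolding cos_double_sin by (simp add: power2_eq_square field_simps)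
  also have "\<dots> \<ge> 1/2" using \<open>sin u \<ge> 0\<close> by (auto intro!: mult_nonneg_nonneg)
  finally show "1/2 \<le> T n" .
qed

text \<open>If the integer part of z is q s, then z / q exceeds s by less than 1/q, hence by at most
  1/2.\<close>

lemma floor_root_multiple:
  assumes k: "k > 0" and q: "q \<ge> 2" and dvd: "q dvd nat \<lfloor>root k (real p)\<rfloor>"
  shows "\<exists>s r. real p powr (1 / real k) * (1 / real q) = of_int s + r \<and> 0 \<le> r \<and> r \<le> 1/2"
proof -
  define z where "z = root k (real p)"
  have z0: "z \<ge> 0" by (simp add: z_def real_root_ge_zero)
  have z: "z = real p powr (1 / real k)"
  proof (cases "p = 0")
    case False
    thus ?thesis using k by (simp add: z_def root_powr_inverse divide_inverse)
  qed (use k in \<open>simp add: z_def\<close>)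
  obtain s where s: "nat \<lfloor>z\<rfloor> = q * s" using dvd by (auto simp: z_def)
  hence "\<lfloor>z\<rfloor> = int q * int s" using z0 by (metis nat_0_le of_nat_mult zero_le_floor)
  hence "real_of_int \<lfloor>z\<rfloor> = real q * real s" by simp
  hence b: "real q * real s \<le> z" "z < real q * real s + 1" by linarith+
  have "z / real q = real_of_int (int s) + (z - real q * real s) / real q" using q by (simp add: field_simps)
  moreover have "0 \<le> (z - real q * real s) / real q" using b by simp
  moreover have "(z - real q * real s) / real q \<le> 1 / 2" using b q by (simp add: field_simps)
  ultimately show ?thesis unfolding z[symmetric] by (metis mult.right_neutral times_divide_eq_right)
qed

text \<open>The mangoldt sum of the detecting polynomial over the window is small. From below, a
  prime whose root part is divisible by q contributes at least 1/2, any other prime at least -(3/2)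
  L, and higher prime powers little. Thus every prime contributes at least 1/2, up to a loss of 2 L
  for each exception.\<close>

lemma count_nondivisible:
  fixes k q n m :: nat
  defines "c \<equiv> 1 / real k" and "X \<equiv> nth_prime m" 
  defines "L \<equiv> 1 + ln (real X)"
  assumes k: "k \<ge> 2" and q: "q \<ge> 2" and n: "2 \<le> n" "n \<le> m"
  shows "real (m - n) / 2 \<le> real (card {j\<in>{n<..m}. \<not> q dvd nat \<lfloor>root k (real (nth_prime j))\<rfloor>}) * (2 * L)
     + 390 * real q * L ^ 6 * real X powr (1 - c/8) / c + 3 * sqrt (real X) * ln (real X) ^ 2"
proof -
  define T where "T l = Im (power_phase (1 / real q) c l) + Re (power_phase (2 * (1 / real q)) c l) / 2" for l
  have c: "0 < c" "c \<le> 1/2" using k by (auto simp: c_def field_simps)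
  have Tle: "\<bar>T l\<bar> \<le> 3 / 2" for l unfolding T_def by (rule trig_poly_bounds(1))
  \<comment> \<open>390 = 3 * 130: a partial sum costs D + D/2, where D is the bound for one
    exponential sum with \<theta> \<ge> 1/q, and the window is a difference of two partial
    sums.\<close>
  define B where "B = 390 * real q * L ^ 6 * real X powr (1 - c/8) / c"
  define x where "x = nth_prime n"
  define E where "E = card {j\<in>{n<..m}. \<not> q dvd nat \<lfloor>root k (real (nth_prime j))\<rfloor>}"
  have xX: "2 \<le> x" "x \<le> X" using n le_nth_prime[of n] nth_prime_le_iff[of n m] by (auto simp: x_def X_def)
  have L1: "L \<ge> 1" using xX by (simp add: L_def)
  have bound: "\<bar>\<Sum>l\<in>{0<..Y}. mangoldt l * T l\<bar> \<le> B / 2" if "1 \<le> Y" "Y \<le> X" for Y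
  proof -
    have e: "norm (\<Sum>l\<in>{0<..Y}. mangoldt l * power_phase \<theta> c l) \<le> 130 * L ^ 6 * real X powr (1 - c/8) / (c * (1 / real q))"
      if \<theta>: "1 / real q \<le> \<theta>" "\<theta> \<le> 1" for \<theta>
    proof -
      have "0 < \<theta>" using \<theta>(1) q by (meson divide_pos_pos less_le_trans of_nat_0_less_iff pos2 zero_less_one)
      have "norm (\<Sum>l\<in>{0<..Y}. mangoldt l * power_phase \<theta> c l) \<le> 130 * (1 + ln (real Y)) ^ 6 * real Y powr (1 - c/8) / (c * \<theta>)"
        using that c \<open>0 < \<theta>\<close> \<open>1 \<le> Y\<close> by (intro mangoldt_exp_sum)
      also have "\<dots> \<le> 130 * L ^ 6 * real X powr (1 - c/8) / (c * (1 / real q))"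
        using \<theta> \<open>1 \<le> Y\<close> \<open>Y \<le> X\<close> c q L1
        by (intro frac_le mult_mono power_mono powr_mono2 mult_left_mono) (auto simp: L_def)
      finally show ?thesis .
    qed
    define S1 where "S1 = (\<Sum>l\<in>{0<..Y}. mangoldt l * power_phase (1 / real q) c l)"
    define S2 where "S2 = (\<Sum>l\<in>{0<..Y}. mangoldt l * power_phase (2 * (1 / real q)) c l)"
    have "(\<Sum>l\<in>{0<..Y}. mangoldt l * T l) = Im S1 + Re S2 / 2"
      unfolding S1_def S2_def T_def Im_sum Re_sum sum_divide_distrib sum.distrib[symmetric]
      by (intro sum.cong refl) (simp add: algebra_simps)
    also have "\<bar>\<dots>\<bar> \<le> norm S1 + norm S2 / 2"
      using abs_Im_le_cmod[of S1] abs_Re_le_cmod[of S2] by linarith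
    also have "\<dots> \<le> B / 2"
    proof -
      define D where "D = 130 * L ^ 6 * real X powr (1 - c/8) / (c * (1 / real q))"
      have "norm S1 \<le> D" unfolding S1_def D_def using q by (intro e) (auto simp: field_simps)
      moreover have "norm S2 \<le> D" unfolding S2_def D_def using q by (intro e) (auto simp: field_simps)
      moreover have "B = 3 * D" by (simp add: B_def D_def)
      ultimately show ?thesis by linarith
    qed
    finally show ?thesis .
  qed
  have dis: "{0<..X} = {0<..x} \<union> {x<..X}" using xX by auto
  have "(\<Sum>l\<in>{0<..X}. mangoldt l * T l) = (\<Sum>l\<in>{0<..x}. mangoldt l * T l) + (\<Sum>l\<in>{x<..X}. mangoldt l * T l)"
    unfolding dis by (intro sum.union_disjoint) auto
  hence up: "(\<Sum>l\<in>{x<..X}. mangoldt l * T l) \<le> B"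
    using bound[of x] bound[of X] xX by linarith
  define P where "P = {l\<in>{x<..X}. prime l}"
  define NP where "NP = {l\<in>{x<..X}. \<not> prime l}"
  have "(\<Sum>l\<in>{x<..X}. mangoldt l * T l) = (\<Sum>l\<in>P \<union> NP. mangoldt l * T l)"
    by (intro sum.cong) (auto simp: P_def NP_def)
  also have "\<dots> = (\<Sum>l\<in>P. mangoldt l * T l) + (\<Sum>l\<in>NP. mangoldt l * T l)"
    by (intro sum.union_disjoint) (auto simp: P_def NP_def)
  finally have split: "(\<Sum>l\<in>{x<..X}. mangoldt l * T l) = (\<Sum>l\<in>P. mangoldt l * T l) + (\<Sum>l\<in>NP. mangoldt l * T l)" .
  have np: "- (3 * sqrt (real X) * ln (real X) ^ 2) \<le> (\<Sum>l\<in>NP. mangoldt l * T l)"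
  proof -
    have "\<bar>\<Sum>l\<in>NP. mangoldt l * T l\<bar> \<le> (\<Sum>l\<in>NP. mangoldt l * (3 / 2))"
    proof (intro order_trans[OF sum_abs] sum_mono)
      fix l
      show "\<bar>mangoldt l * T l\<bar> \<le> mangoldt l * (3 / 2)"
        unfolding abs_mult abs_mangoldt by (intro mult_left_mono Tle mangoldt_nonneg)
    qed
    also have "\<dots> = (\<Sum>l\<in>NP. mangoldt l) * (3 / 2)" by (rule sum_distrib_right[symmetric])
    also have "(\<Sum>l\<in>NP. mangoldt l :: real) \<le> (\<Sum>n\<in>{n\<in>{1..X}. \<not> prime n}. mangoldt n)"
      by (intro sum_mono2) (auto simp: NP_def mangoldt_nonneg)
    also have "\<dots> \<le> 2 * sqrt (real X) * ln (real X) ^ 2" using xX by (intro sum_mangoldt_nonprime_le) auto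
    finally show ?thesis by (simp add: abs_le_iff)
  qed
  have "P = nth_prime ` {n<..m}" unfolding P_def x_def X_def using n by (subst nth_prime_image) auto
  hence "(\<Sum>l\<in>P. mangoldt l * T l) = (\<Sum>j\<in>{n<..m}. mangoldt (nth_prime j) * T (nth_prime j))"
    using inj_on_subset[OF inj_on_nth_prime, of "{n<..m}"] by (simp add: sum.reindex subset_iff)
  also have "\<dots> \<ge> (\<Sum>j\<in>{n<..m}. 1/2 - (if \<not> q dvd nat \<lfloor>root k (real (nth_prime j))\<rfloor> then 2 * L else 0))"
  proof (intro sum_mono)
    fix j assume j: "j \<in> {n<..m}"
    \<comment> \<open>Since n \<ge> 2, the prime 2 lies before the window, so every logarithm in it
      is at least 1.\<close>
    have p3: "nth_prime j \<ge> 3" using le_nth_prime[of j] j n by auto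
    have "1 \<le> ln (real (nth_prime j))"
    proof -
      have "exp 1 \<le> real (nth_prime j)" using p3 exp_le by linarith
      thus ?thesis using p3 by (subst ln_ge_iff) auto
    qed
    moreover have "nth_prime j \<le> X" using j n by (simp add: X_def nth_prime_le_iff)
    hence "ln (real (nth_prime j)) \<le> ln (real X)" using p3 by (subst ln_le_cancel_iff) auto
    hence "ln (real (nth_prime j)) \<le> L" by (simp add: L_def)
    ultimately have lb: "1 \<le> ln (real (nth_prime j))" "ln (real (nth_prime j)) \<le> L" by blast+
    have mg: "mangoldt (nth_prime j) = ln (real (nth_prime j))" using prime_nth_prime by simp
    show "1/2 - (if \<not> q dvd nat \<lfloor>root k (real (nth_prime j))\<rfloor> then 2 * L else 0) \<le> mangoldt (nth_prime j) * T (nth_prime j)"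
    proof (cases "q dvd nat \<lfloor>root k (real (nth_prime j))\<rfloor>")
      case True
      have "k > 0" using k by simp
      from floor_root_multiple[OF this q True] have "1/2 \<le> T (nth_prime j)"
        unfolding T_def c_def[symmetric] using trig_poly_bounds(2) by blast
      hence "1 * (1/2) \<le> ln (real (nth_prime j)) * T (nth_prime j)" using lb by (intro mult_mono) auto
      thus ?thesis using True mg by simp
    next
      case False
      have "\<bar>ln (real (nth_prime j)) * T (nth_prime j)\<bar> \<le> L * (3/2)"
        unfolding abs_mult using lb Tle by (intro mult_mono) auto
      thus ?thesis using False mg L1 by (simp add: abs_le_iff)
    qed
  qed
  also have "(\<Sum>j\<in>{n<..m}. 1/2 - (if \<not> q dvd nat \<lfloor>root k (real (nth_prime j))\<rfloor> then 2 * L else 0))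
     = real (m - n) / 2 - real E * (2 * L)"
    by (simp add: sum_subtractf sum.If_cases E_def Int_def)
  finally have "real (m - n) / 2 - real E * (2 * L) \<le> (\<Sum>l\<in>P. mangoldt l * T l)" .
  thus ?thesis using up split np unfolding E_def B_def by linarith
qed

section \<open>Windows of roots of primes\<close>

definition root_prime :: "nat \<Rightarrow> nat \<Rightarrow> nat" where
  "root_prime k j = nat \<lfloor>root k (real (nth_prime j))\<rfloor>"

lemma power_Suc_le: "(w + 1) ^ k \<le> w ^ k + k * (w + 1) ^ (k - 1)" for w k :: nat
proof (induction k)
  case (Suc k)
  have "(w + 1) ^ Suc k \<le> (w + 1) * (w ^ k + k * (w + 1) ^ (k - 1))"
    using Suc.IH by (simp only: power_Suc mult_le_mono2)
  also have "\<dots> = w ^ Suc k + w ^ k + k * ((w + 1) * (w + 1) ^ (k - 1))" by (simp add: algebra_simps)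
  also have "k * ((w + 1) * (w + 1) ^ (k - 1)) = k * (w + 1) ^ k" by (cases k) simp_all
  also have "w ^ Suc k + w ^ k + k * (w + 1) ^ k \<le> w ^ Suc k + (w + 1) ^ k + k * (w + 1) ^ k"
    using power_mono[of w "w + 1" k] by simp
  finally show ?case by simp
qed simp

text \<open>The primes in a fibre lie between w^k and (w+1)^k, and counting all integers there
  suffices.\<close>

lemma card_root_prime_fibre_le:
  assumes k: "k > 0" and I: "I \<subseteq> {1..}"
  shows "card {j\<in>I. root_prime k j = w} \<le> k * (w + 1) ^ (k - 1)"
proof -
  have "card {j\<in>I. root_prime k j = w} \<le> card {w ^ k..<(w + 1) ^ k}"
  proof (rule card_inj_on_le)
    show "inj_on nth_prime {j\<in>I. root_prime k j = w}"
      using I by (intro inj_on_subset[OF inj_on_nth_prime]) auto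
    show "nth_prime ` {j\<in>I. root_prime k j = w} \<subseteq> {w ^ k..<(w + 1) ^ k}"
    proof clarify
      fix j assume w: "w = root_prime k j"
      define z where "z = root k (real (nth_prime j))"
      have z: "z \<ge> 0" "z ^ k = real (nth_prime j)" using k by (auto simp: z_def real_root_ge_zero)
      have "real (root_prime k j) = of_int \<lfloor>z\<rfloor>" using z by (simp add: root_prime_def z_def)
      hence "real (root_prime k j) \<le> z" "z < real (root_prime k j) + 1" by linarith+
      hence "real (root_prime k j) ^ k \<le> z ^ k" "z ^ k < (real (root_prime k j) + 1) ^ k"
        using k z(1) by (intro power_mono power_strict_mono; simp)+
      hence "real (root_prime k j ^ k) \<le> real (nth_prime j)" "real (nth_prime j) < real ((root_prime k j + 1) ^ k)"
        unfolding z by (simp_all add: add.commute)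
      thus "nth_prime j \<in> {root_prime k j ^ k..<(root_prime k j + 1) ^ k}"
        by (simp only: of_nat_le_iff of_nat_less_iff atLeastLessThan_iff)
    qed
  qed simp
  also have "\<dots> \<le> k * (w + 1) ^ (k - 1)" using power_Suc_le[of w k] by simp
  finally show ?thesis .
qed

text \<open>1560 = 4 * 390, as q \<le> 2 \<Lambda> \<le> 4 l^D in \<open>count_nondivisible\<close>.
  The two error terms bounded by \<delta> x / 8 use up half of the main term \<delta> x / 2. The
  exponent 8 D + 1 comes from the eighth power of \<Lambda> in \<open>exists_long_ap\<close>, with
  one logarithm for the constants.\<close>

lemma window_asymptotics:
  fixes \<delta> c C :: real and D :: nat
  assumes "\<delta> > 0" "0 < c" "c \<le> 1"
  shows "eventually (\<lambda>x::real. C < ln x \<and> ln x ^ (8 * D + 1) \<le> x powr c \<and>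
    1560 * ln x ^ D * (1 + ln (x * ln x ^ 2)) ^ 6 * (x * ln x ^ 2) powr (1 - c/8) / c \<le> \<delta> * x / 8 \<and>
    3 * sqrt (x * ln x ^ 2) * ln (x * ln x ^ 2) ^ 2 \<le> \<delta> * x / 8 \<and>
    8 * (1 + ln (x * ln x ^ 2)) \<le> \<delta> * ln x ^ 2) at_top"
proof -
  have "eventually (\<lambda>x::real. C < ln x) at_top" by real_asymp
  moreover have "eventually (\<lambda>x::real. ln x ^ (8 * D + 1) \<le> x powr c) at_top"
    using assms by real_asymp
  moreover have "eventually (\<lambda>x::real. 1560 * ln x ^ D * (1 + ln (x * ln x ^ 2)) ^ 6 * (x * ln x ^ 2) powr (1 - c/8) / c \<le> \<delta> * x / 8) at_top"
    using assms by real_asymp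
  moreover have "eventually (\<lambda>x::real. 3 * sqrt (x * ln x ^ 2) * ln (x * ln x ^ 2) ^ 2 \<le> \<delta> * x / 8) at_top"
    using assms by real_asymp
  moreover have "eventually (\<lambda>x::real. 8 * (1 + ln (x * ln x ^ 2)) \<le> \<delta> * ln x ^ 2) at_top"
    using assms by real_asymp
  ultimately show ?thesis by eventually_elim blast
qed

text \<open>With l = ln n, the parameters are Z about n^c l^2 for the largest term, 2 v with v about
  n^c / l^A for the distinct values used, and \<Lambda> about l^D. \<open>Z\<close> is independent
  of \<open>m\<close> and also bounds the terms just beyond the window, so that it can later measure
  the change from n to n + 1. Doubling \<open>t\<close> avoids halves.\<close>

lemma root_prime_window:
  fixes \<delta> :: real and k :: nat
  assumes k: "k \<ge> 1" and \<delta>: "\<delta> > 0"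
  shows "\<exists>n0. \<forall>n\<ge>n0. \<exists>Z. (\<forall>j\<in>{1..2*n+2}. root_prime k j \<le> Z) \<and>
    (\<forall>m t. m \<le> 2 * n \<longrightarrow> \<delta> * real n \<le> real (m - n) \<longrightarrow>
       sum (root_prime k) {n<..m} \<le> 2 * t \<longrightarrow> 2 * t \<le> sum (root_prime k) {n<..m} + 3 * Z \<longrightarrow>
       t \<in> subset_sums (root_prime k) {n<..m})"
proof -
  define c where "c = 1 / real k"
  \<comment> \<open>A = 2 (k - 1) + 5: a fibre has at most about n^(1-c) l^(2(k-1)) elements, so
    fewer than 2 v distinct values would account for only O(n / l^5) indices.\<close>
  define A where "A = 2 * k + 3"
  \<comment> \<open>For Z \<le> \<Lambda> v: two logarithms beyond l^A come from \<open>Z\<close>,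
    and the third pays for rounding \<open>v\<close> down.\<close>
  define D where "D = A + 3"
  \<comment> \<open>1024000 = 4000 * 2^8, where the 2 comes from \<Lambda> \<le> 2 l^D. The fraction
    makes \<delta> l exceed both k 2^k, for counting distinct values, and 12, for the size
    estimates.\<close>
  define C where "C = 1024000 + (real k * 2 ^ k + 12) / \<delta>"
  have c: "0 < c" "c \<le> 1" using k by (auto simp: c_def)
  have "eventually (\<lambda>n. real (nth_prime (2 * n + 2)) \<le> real n * ln (real n) ^ 2 \<and>
    (C < ln (real n) \<and> ln (real n) ^ (8 * D + 1) \<le> real n powr c \<and>
    1560 * ln (real n) ^ D * (1 + ln (real n * ln (real n) ^ 2)) ^ 6 * (real n * ln (real n) ^ 2) powr (1 - c/8) / c \<le> \<delta> * real n / 8 \<and>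
    3 * sqrt (real n * ln (real n) ^ 2) * ln (real n * ln (real n) ^ 2) ^ 2 \<le> \<delta> * real n / 8 \<and>
    8 * (1 + ln (real n * ln (real n) ^ 2)) \<le> \<delta> * ln (real n) ^ 2)) sequentially"
    using nth_prime_upper_bound eventually_compose_filterlim[OF window_asymptotics[OF \<delta> c, of C D] filterlim_real_sequentially]
    by eventually_elim blast
  then obtain n0 where n0: "\<And>n. n \<ge> n0 \<Longrightarrow> real (nth_prime (2 * n + 2)) \<le> real n * ln (real n) ^ 2 \<and>
    (C < ln (real n) \<and> ln (real n) ^ (8 * D + 1) \<le> real n powr c \<and>
    1560 * ln (real n) ^ D * (1 + ln (real n * ln (real n) ^ 2)) ^ 6 * (real n * ln (real n) ^ 2) powr (1 - c/8) / c \<le> \<delta> * real n / 8 \<and>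
    3 * sqrt (real n * ln (real n) ^ 2) * ln (real n * ln (real n) ^ 2) ^ 2 \<le> \<delta> * real n / 8 \<and>
    8 * (1 + ln (real n * ln (real n) ^ 2)) \<le> \<delta> * ln (real n) ^ 2)"
    unfolding eventually_sequentially by blast
  have main: "\<exists>Z. (\<forall>j\<in>{1..2*n+2}. root_prime k j \<le> Z) \<and>
    (\<forall>m t. m \<le> 2 * n \<longrightarrow> \<delta> * real n \<le> real (m - n) \<longrightarrow>
       sum (root_prime k) {n<..m} \<le> 2 * t \<longrightarrow> 2 * t \<le> sum (root_prime k) {n<..m} + 3 * Z \<longrightarrow>
       t \<in> subset_sums (root_prime k) {n<..m})" if "n \<ge> n0" for n
  proof -
    define x where "x = real n"
    define l where "l = ln x"
    define xc where "xc = x powr c"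
    define v where "v = nat \<lfloor>xc / l ^ A\<rfloor>"
    define \<Lambda> where "\<Lambda> = nat \<lceil>l ^ D\<rceil>"
    define Z where "Z = nat \<lfloor>xc * l ^ 2\<rfloor>"
    have pup: "real (nth_prime (2 * n + 2)) \<le> x * l ^ 2"
      and lC: "C < l" and lxc: "l ^ (8 * D + 1) \<le> xc"
      and as1: "1560 * l ^ D * (1 + ln (x * l ^ 2)) ^ 6 * (x * l ^ 2) powr (1 - c/8) / c \<le> \<delta> * x / 8"
      and as2: "3 * sqrt (x * l ^ 2) * ln (x * l ^ 2) ^ 2 \<le> \<delta> * x / 8"
      and as3: "8 * (1 + ln (x * l ^ 2)) \<le> \<delta> * l ^ 2"
      using n0[OF that] unfolding x_def l_def xc_def by blast+
    have "0 \<le> (real k * 2 ^ k + 12) / \<delta>" using \<delta> by simp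
    hence l: "1024000 \<le> l" "(real k * 2 ^ k + 12) / \<delta> < l" using lC by (simp_all add: C_def)
    have \<delta>l: "real k * 2 ^ k + 12 < \<delta> * l" using l(2) \<delta> by (simp add: field_simps)
    have \<delta>l12: "12 \<le> \<delta> * l" and \<delta>lk: "real k * 2 ^ k < \<delta> * l"
      using \<delta>l by (auto intro: order_trans[OF _ less_imp_le[OF \<delta>l]])
    have lpow: "l ^ i \<le> xc" if "i \<le> 8 * D + 1" for i
      using power_increasing[OF that, of l] l lxc by linarith
    have lp1: "1 \<le> l ^ i" for i using l by (intro one_le_power) auto
    have x1: "x \<ge> 1"
    proof (rule ccontr)
      assume "\<not> 1 \<le> x"
      hence "n = 0" by (simp add: x_def)
      thus False using l by (simp add: l_def x_def)
    qed
    have n1: "n \<ge> 1" using x1 by (simp add: x_def)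
    have xc: "1 \<le> xc" "xc \<le> x"
      using lpow[of 0] powr_mono[of c 1 x] c x1 by (auto simp: xc_def)
    have xck: "xc ^ k = x" using x1 k by (simp add: xc_def c_def powr_power)
    have \<Lambda>: "l ^ D \<le> real \<Lambda>" "real \<Lambda> \<le> 2 * l ^ D" "1 \<le> \<Lambda>"
    proof -
      show "l ^ D \<le> real \<Lambda>" unfolding \<Lambda>_def by linarith
      show "real \<Lambda> \<le> 2 * l ^ D" using lp1[of D] unfolding \<Lambda>_def by linarith
      show "1 \<le> \<Lambda>" using \<open>l ^ D \<le> real \<Lambda>\<close> lp1[of D] by linarith
    qed
    have v: "xc / l ^ A - 1 \<le> real v" "real v \<le> xc / l ^ A"
    proof -
      show "xc / l ^ A - 1 \<le> real v" unfolding v_def by linarith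
      show "real v \<le> xc / l ^ A" unfolding v_def using xc lp1[of A] by (intro of_nat_floor divide_nonneg_nonneg) auto
    qed
    have Z: "xc * l ^ 2 - 1 \<le> real Z" "real Z \<le> xc * l ^ 2"
    proof -
      show "xc * l ^ 2 - 1 \<le> real Z" unfolding Z_def by linarith
      show "real Z \<le> xc * l ^ 2" unfolding Z_def using xc by (intro of_nat_floor) auto
    qed
    have aZ: "root_prime k j \<le> Z" if "j \<in> {1..2*n+2}" for j
    proof -
      have "nth_prime j \<le> nth_prime (2 * n + 2)" using that by (simp add: nth_prime_le_iff)
      hence "real (nth_prime j) \<le> x * l ^ 2" using pup by linarith
      hence "root k (real (nth_prime j)) \<le> root k (x * l ^ 2)" using k by simp
      also have "\<dots> = (x * l ^ 2) powr c" using x1 k l by (simp add: root_powr_inverse c_def divide_inverse)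
      also have "\<dots> = xc * (l ^ 2) powr c" by (simp only: powr_mult xc_def)
      also have "\<dots> \<le> xc * (l ^ 2) powr 1" using c lp1[of 2] xc by (intro mult_left_mono powr_mono) auto
      also have "\<dots> = xc * l ^ 2" using l by simp
      finally show ?thesis by (simp add: root_prime_def Z_def nat_mono floor_mono)
    qed
    have a_lower: "xc / 2 \<le> real (root_prime k j)" if "n < j" for j
    proof -
      have "x \<le> real (nth_prime j)" using le_nth_prime[of j] that by (simp add: x_def)
      hence "root k x \<le> root k (real (nth_prime j))" using k by simp
      moreover have "root k x = xc" using x1 k by (simp add: root_powr_inverse c_def xc_def divide_inverse)
      ultimately have "xc - 1 \<le> real (root_prime k j)" unfolding root_prime_def by linarith
      moreover have "2 \<le> xc" using lpow[of 1] l by simp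
      ultimately show ?thesis by linarith
    qed
    have ZL: "Z \<le> \<Lambda> * v"
    proof -
      have "l ^ D \<le> xc * 1" using lpow[of D] by simp
      also have "\<dots> \<le> xc * (l ^ 2 * (l - 1))"
      proof (intro mult_left_mono)
        have "1 * 1 \<le> l ^ 2 * (l - 1)" using lp1[of 2] l by (intro mult_mono) auto
        thus "1 \<le> l ^ 2 * (l - 1)" by simp
      qed (use xc in auto)
      finally have "xc * l ^ 2 \<le> xc * l ^ 3 - l ^ D" by (simp add: algebra_simps power2_eq_square power3_eq_cube)
      also have "\<dots> = l ^ D * (xc / l ^ A - 1)" using l by (simp add: D_def power_add field_simps)
      also have "\<dots> \<le> l ^ D * real v" using v lp1[of D] by (intro mult_left_mono) auto
      also have "\<dots> \<le> real \<Lambda> * real v" using \<Lambda> by (intro mult_right_mono) auto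
      finally have "real Z \<le> real (\<Lambda> * v)" using Z by simp
      thus ?thesis by (simp only: of_nat_le_iff)
    qed
    have big: "4000 * \<Lambda> ^ 8 \<le> Z"
    proof -
      have "real \<Lambda> ^ 8 \<le> (2 * l ^ D) ^ 8" using \<Lambda> by (intro power_mono) auto
      hence "real (4000 * \<Lambda> ^ 8) \<le> 4000 * (2 * l ^ D) ^ 8" by simp
      also have "\<dots> = 1024000 * l ^ (8 * D)" by (simp add: power_mult_distrib mult.commute flip: power_mult)
      also have "\<dots> \<le> l * l ^ (8 * D)" using l lp1[of "8*D"] by (intro mult_right_mono) auto
      also have "\<dots> \<le> xc" using lxc by simp
      also have "\<dots> \<le> xc * l ^ 2 - 1"
      proof -
        have "1 * 1 \<le> xc * (l ^ 2 - 1)" using xc l power_increasing[of 1 2 l] by (intro mult_mono) auto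
        thus ?thesis by (simp add: algebra_simps)
      qed
      finally have "real (4000 * \<Lambda> ^ 8) \<le> real Z" using Z by linarith
      thus ?thesis by (simp only: of_nat_le_iff)
    qed
    have size: "2 * real v + 2 * real \<Lambda> \<le> x / l ^ 3"
    proof -
      have "real v \<le> x / l ^ 5"
        using v xc l k power_increasing[of 5 A l] by (intro order_trans[OF v(2)] frac_le) (auto simp: A_def)
      also have "\<dots> = (x / l ^ 3) / l ^ 2" by (simp add: flip: power_add)
      also have "\<dots> \<le> (x / l ^ 3) / 4"
        using x1 lp1[of 3] l power_increasing[of 1 2 l] by (intro divide_left_mono) auto
      finally have 1: "2 * real v \<le> (x / l ^ 3) / 2" by simp
      have "8 * l ^ D * l ^ 3 \<le> l * l ^ D * l ^ 3" using l lp1[of D] lp1[of 3] by (intro mult_right_mono) auto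
      also have "\<dots> = l ^ (D + 4)" by (simp add: power_add eval_nat_numeral)
      also have "\<dots> \<le> x" using lpow[of "D+4"] xc by (simp add: D_def)
      finally have "8 * l ^ D \<le> x / l ^ 3" using l by (simp add: field_simps)
      hence "2 * real \<Lambda> \<le> (x / l ^ 3) / 2" using \<Lambda> by simp
      with 1 show ?thesis by simp
    qed
    have rep: "t \<in> subset_sums (root_prime k) {n<..m}"
      if m: "m \<le> 2 * n" "\<delta> * real n \<le> real (m - n)"
      and t: "sum (root_prime k) {n<..m} \<le> 2 * t" "2 * t \<le> sum (root_prime k) {n<..m} + 3 * Z" for m t
    proof -
      define I where "I = {n<..m}"
      have I: "I \<subseteq> {1..2*n+2}" "I \<subseteq> {1..}" "finite I" "card I = m - n" using m by (auto simp: I_def)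
      have mn: "\<delta> * x \<le> real (m - n)" using m by (simp add: x_def)
      have "n \<le> m" using mn \<delta> x1 by (cases "n \<le> m") (auto simp: mult_le_0_iff)
      \<comment> \<open>If there were fewer values, the fibre bound would leave room for at most k
        2^k x / l^5 indices, less than the \<delta> x in the window.\<close>
      have "2 * v \<le> card (root_prime k ` I)"
      proof (rule ccontr)
        assume "\<not> 2 * v \<le> card (root_prime k ` I)"
        hence lt: "card (root_prime k ` I) \<le> 2 * v" by simp
        have "card I = (\<Sum>w\<in>root_prime k ` I. card {j\<in>I. root_prime k j = w})"
          using I by (intro card_eq_sum_fibres) auto
        also have "\<dots> \<le> (\<Sum>w\<in>root_prime k ` I. k * (Z + 1) ^ (k - 1))"
        proof (intro sum_mono)
          fix w assume "w \<in> root_prime k ` I"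
          hence w: "w \<le> Z" using aZ I by auto
          have "card {j\<in>I. root_prime k j = w} \<le> k * (w + 1) ^ (k - 1)"
            using k I by (intro card_root_prime_fibre_le) auto
          also have "\<dots> \<le> k * (Z + 1) ^ (k - 1)" using w by (intro mult_le_mono2 power_mono) auto
          finally show "card {j\<in>I. root_prime k j = w} \<le> k * (Z + 1) ^ (k - 1)" .
        qed
        also have "\<dots> = card (root_prime k ` I) * (k * (Z + 1) ^ (k - 1))" by simp
        also have "\<dots> \<le> 2 * v * (k * (Z + 1) ^ (k - 1))" using lt by (rule mult_le_mono1)
        finally have "real (m - n) \<le> real (2 * v * (k * (Z + 1) ^ (k - 1)))"
          unfolding I(4) by (simp only: of_nat_le_iff)
        hence "\<delta> * x \<le> 2 * real v * (real k * (real Z + 1) ^ (k - 1))" using mn by (simp add: add.commute)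
        also have "\<dots> \<le> 2 * (xc / l ^ A) * (real k * (2 * (xc * l ^ 2)) ^ (k - 1))"
        proof (intro mult_mono mult_left_mono power_mono)
          have "1 * 1 \<le> xc * l ^ 2" using xc lp1[of 2] by (intro mult_mono) auto
          thus "real Z + 1 \<le> 2 * (xc * l ^ 2)" using Z by simp
        qed (use v xc lp1[of A] in auto)
        also have "\<dots> = real k * (2 * 2 ^ (k - 1)) * (xc * xc ^ (k - 1)) * (l ^ (2 * (k - 1)) / l ^ A)"
          by (simp add: power_mult_distrib flip: power_mult)
        also have "2 * 2 ^ (k - 1) = (2::real) ^ k" using k by (metis Suc_diff_1 less_eq_Suc_le power_Suc One_nat_def)
        also have "xc * xc ^ (k - 1) = x" using k xck by (metis Suc_diff_1 less_eq_Suc_le power_Suc One_nat_def)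
        also have "l ^ (2 * (k - 1)) / l ^ A = 1 / l ^ 5"
        proof -
          have "A = 2 * (k - 1) + 5" using k by (simp add: A_def)
          thus ?thesis using l by (simp add: power_add)
        qed
        also have "real k * 2 ^ k * x * (1 / l ^ 5) \<le> real k * 2 ^ k * x * (1 / l)"
          using x1 l self_le_power[of l 5] by (intro mult_left_mono divide_left_mono) auto
        also have "\<dots> < \<delta> * x" using \<delta>lk l x1 by (simp add: field_simps)
        finally show False by simp
      qed
      then obtain S where S: "S \<subseteq> root_prime k ` I" "card S = 2 * v" using obtain_subset_with_card_n by metis
      then obtain V where V: "V \<subseteq> I" "inj_on (root_prime k) V" "S = root_prime k ` V"
        by (auto simp: subset_image_inj)
      have cV: "card V = 2 * v" using S V by (simp add: card_image)
      have xl: "x / l ^ 3 \<le> x / l ^ 2"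
        using x1 l by (intro divide_left_mono power_increasing) auto
      have many: "2 * v + 2 * \<Lambda> \<le> card {j\<in>I. \<not> q dvd root_prime k j}" if q: "prime q" "q \<le> 2 * \<Lambda>" for q
      proof -
        define E where "E = card {j\<in>I. \<not> q dvd root_prime k j}"
        have "x / l ^ 2 \<le> real E"
        proof (cases "k = 1")
          case True
          \<comment> \<open>For k = 1 the terms are the primes themselves, so divisibility means
            equality, impossible as q \<le> 2 \<Lambda> is below n.\<close>
          have "\<not> q dvd root_prime k j" if "j \<in> I" for j
          proof
            assume "q dvd root_prime k j"
            hence "q dvd nth_prime j" using True by (simp add: root_prime_def)
            hence "q = nth_prime j" using q prime_nth_prime[of j] by (simp add: primes_dvd_imp_eq)
            hence "n < 2 * \<Lambda>" using q le_nth_prime[of j] that by (auto simp: I_def)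
            hence "x < x / l ^ 3" using size by (simp add: x_def)
            moreover have "x / l ^ 3 \<le> x / 1" using x1 l lp1[of 3] by (intro divide_left_mono) auto
            ultimately show False by simp
          qed
          hence "{j\<in>I. \<not> q dvd root_prime k j} = I" by auto
          hence "E = m - n" using I by (simp add: E_def)
          have "x / l ^ 2 \<le> x / l" using x1 l self_le_power[of l 2] by (intro divide_left_mono) auto
          also have "x / l \<le> \<delta> * x" using \<delta>l12 l x1 mult_right_mono[of 1 "\<delta> * l" x] by (simp add: field_simps)
          finally show ?thesis using mn \<open>E = m - n\<close> by linarith
        next
          case False
          hence k2: "k \<ge> 2" using k by linarith
          define X where "X = nth_prime m"
          have "1 \<le> m" "m \<le> 2 * n + 2" using m n1 \<open>n \<le> m\<close> by auto
          hence "X \<le> nth_prime (2 * n + 2)" by (simp add: X_def nth_prime_le_iff)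
          hence Xle: "real X \<le> x * l ^ 2" using pup by linarith
          have X1: "1 \<le> real X" using prime_ge_1_nat[OF prime_nth_prime, of m] by (simp add: X_def)
          have lX: "0 \<le> ln (real X)" "ln (real X) \<le> ln (x * l ^ 2)" using X1 Xle by auto
          have q2: "q \<ge> 2" using q prime_ge_2_nat by blast
          have n2: "2 \<le> n"
          proof (rule ccontr)
            assume "\<not> 2 \<le> n"
            hence "x = 1" using n1 by (simp add: x_def)
            thus False using l by (simp add: l_def)
          qed
          have "real (m - n) / 2 \<le> real E * (2 * (1 + ln (real X)))
             + 390 * real q * (1 + ln (real X)) ^ 6 * real X powr (1 - c/8) / c + 3 * sqrt (real X) * ln (real X) ^ 2"
            using count_nondivisible[OF k2 q2 n2 \<open>n \<le> m\<close>]
            by (simp add: E_def I_def root_prime_def X_def c_def)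
          also have "390 * real q * (1 + ln (real X)) ^ 6 * real X powr (1 - c/8) / c
              \<le> 390 * (4 * l ^ D) * (1 + ln (x * l ^ 2)) ^ 6 * (x * l ^ 2) powr (1 - c/8) / c"
          proof (intro divide_right_mono mult_mono power_mono powr_mono2)
            have "real q \<le> 2 * real \<Lambda>" using q(2) by linarith
            thus "real q \<le> 4 * l ^ D" using \<Lambda> by linarith
          qed (use lX Xle X1 c lp1[of D] in auto)
          also have "\<dots> \<le> \<delta> * x / 8" using as1 by simp
          also have "3 * sqrt (real X) * ln (real X) ^ 2 \<le> 3 * sqrt (x * l ^ 2) * ln (x * l ^ 2) ^ 2"
            using lX Xle X1 by (intro mult_mono power_mono) auto
          also have "\<dots> \<le> \<delta> * x / 8" by (rule as2)
          also have "real E * (2 * (1 + ln (real X))) \<le> real E * (\<delta> * l ^ 2 / 4)"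
            using lX as3 by (intro mult_left_mono) auto
          finally have "real (m - n) / 2 \<le> real E * (\<delta> * l ^ 2 / 4) + \<delta> * x / 8 + \<delta> * x / 8" by simp
          hence "\<delta> * x \<le> \<delta> * (real E * l ^ 2)" using mn by simp
          hence "x \<le> real E * l ^ 2" using \<delta> by simp
          thus ?thesis using l by (simp add: field_simps)
        qed
        hence "real (2 * v + 2 * \<Lambda>) \<le> real E" using size xl by simp
        thus ?thesis unfolding E_def by (simp only: of_nat_le_iff)
      qed
      have "\<exists>W\<subseteq>I. card W \<le> 2 * v + 2 * \<Lambda> \<and>
          {sum (root_prime k) W..sum (root_prime k) I - sum (root_prime k) W} \<subseteq> subset_sums (root_prime k) I"
        using aZ I by (intro subset_sums_cover_interval[OF I(3) _ V(1,2) cV ZL \<Lambda>(3) big many]) auto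
      then obtain W where W: "W \<subseteq> I" "card W \<le> 2 * v + 2 * \<Lambda>"
          "{sum (root_prime k) W..sum (root_prime k) I - sum (root_prime k) W} \<subseteq> subset_sums (root_prime k) I" by blast
      \<comment> \<open>The terms in \<open>W\<close> are negligible: at most x / l^3 of them, each
        at most xc l^2, against a window total of at least \<delta> x xc / 2. So the interval around
        half the total is covered with 3 Z to spare.\<close>
      have "sum (root_prime k) W \<le> card W * Z"
        using W aZ I by (intro sum_bounded_above[where K = Z, simplified]) auto
      also have "\<dots> \<le> (2 * v + 2 * \<Lambda>) * Z" using W by (intro mult_le_mono1)
      finally have "real (2 * sum (root_prime k) W + 3 * Z) \<le> real (2 * ((2 * v + 2 * \<Lambda>) * Z) + 3 * Z)"
        by (simp only: of_nat_le_iff)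
      also have "\<dots> = (2 * (2 * real v + 2 * real \<Lambda>) + 3) * real Z" by (simp add: algebra_simps)
      also have "\<dots> \<le> (2 * (x / l ^ 3) + 3) * (xc * l ^ 2)"
        using size Z x1 l by (intro mult_mono) auto
      also have "\<dots> = (2 * (x / l) + 3 * l ^ 2) * xc"
        using l by (simp add: field_simps power2_eq_square power3_eq_cube)
      also have "\<dots> \<le> (\<delta> * x / 4 + \<delta> * x / 4) * xc"
      proof (intro mult_right_mono add_mono)
        have "8 * x \<le> (\<delta> * l) * x" using \<delta>l12 x1 by (intro mult_right_mono) auto
        thus "2 * (x / l) \<le> \<delta> * x / 4" using l by (simp add: field_simps)
        have "12 * l ^ 2 \<le> (\<delta> * l) * l ^ 2" using \<delta>l12 by (intro mult_right_mono) auto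
        also have "\<dots> = \<delta> * l ^ 3" by (simp add: power2_eq_square power3_eq_cube)
        also have "\<dots> \<le> \<delta> * x" using \<delta> lpow[of 3] xc by (intro mult_left_mono) (auto simp: D_def A_def)
        finally show "3 * l ^ 2 \<le> \<delta> * x / 4" by simp
      qed (use xc in auto)
      also have "\<dots> = (\<delta> * x) * (xc / 2)" by simp
      also have "\<dots> \<le> real (card I) * (xc / 2)" unfolding I(4) using mn xc by (intro mult_right_mono) auto
      also have "\<dots> \<le> (\<Sum>j\<in>I. real (root_prime k j))"
        using a_lower by (intro sum_bounded_below) (auto simp: I_def)
      also have "\<dots> = real (sum (root_prime k) I)" by simp
      finally have "2 * sum (root_prime k) W + 3 * Z \<le> sum (root_prime k) I" by (simp only: of_nat_le_iff)
      hence "t \<in> {sum (root_prime k) W..sum (root_prime k) I - sum (root_prime k) W}"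
        using t unfolding I_def[symmetric] by auto
      thus ?thesis using W unfolding I_def by blast
    qed
    show ?thesis using aZ rep by blast
  qed
  thus ?thesis by blast
qed

section \<open>Choice of the prefix length and assembly\<close>

theorem theorem4p3:
  fixes k :: nat and \<epsilon> :: real
  assumes "k > 0" and "\<epsilon> > 0"
  shows "\<exists>H::int. \<forall>h::int. h \<ge> H \<longrightarrow>
           (\<exists>(n::nat) (J::nat set).
              J \<subseteq> {n+1 .. nat \<lfloor>(1 + \<epsilon>) * real n\<rfloor>} \<and>
              h = (\<Sum>i = 1..n. \<lfloor>root k (real (nth_prime i))\<rfloor>)
                  + (\<Sum>j\<in>J. \<lfloor>root k (real (nth_prime j))\<rfloor>))"
proof -
  \<comment> \<open>The cap at 1 keeps the window inside (n, 2n], where the bounds on the terms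
    hold; enlarging the window back to \<epsilon> only adds admissible indices.\<close>
  define \<eta> where "\<eta> = min \<epsilon> 1"
  have \<eta>: "0 < \<eta>" "\<eta> \<le> 1" "\<eta> \<le> \<epsilon>" using assms by (auto simp: \<eta>_def)
  define M where "M n = nat \<lfloor>(1 + \<eta>) * real n\<rfloor>" for n
  define a where "a = root_prime k"
  define S where "S n = sum a {1..n}" for n
  \<comment> \<open>With T the total of the window, \<open>F n\<close> is 2 S n + T, the doubled
    threshold to be compared with 2 h.\<close>
  define F where "F n = S n + S (M n)" for n
  obtain n1 where n1: "\<And>n. n \<ge> n1 \<Longrightarrow> \<exists>Z. (\<forall>j\<in>{1..2*n+2}. a j \<le> Z) \<and>
    (\<forall>m t. m \<le> 2 * n \<longrightarrow> \<eta> / 2 * real n \<le> real (m - n) \<longrightarrow>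
       sum a {n<..m} \<le> 2 * t \<longrightarrow> 2 * t \<le> sum a {n<..m} + 3 * Z \<longrightarrow>
       t \<in> subset_sums a {n<..m})"
    using root_prime_window[of k "\<eta> / 2"] assms \<eta> unfolding a_def by auto
  \<comment> \<open>From here on \<eta> n \<ge> 2, so the window still has at least \<eta> n / 2
    indices after the rounding in \<open>M\<close>.\<close>
  obtain n2 where n2: "2 / \<eta> \<le> real n2" using real_arch_simple by blast
  define n0 where "n0 = max n1 n2"
  have a_int: "\<lfloor>root k (real (nth_prime i))\<rfloor> = int (a i)" for i
    using assms by (simp add: a_def root_prime_def real_root_ge_zero)
  have a1: "1 \<le> a i" for i
  proof -
    have "1 \<le> real (nth_prime i)" using prime_ge_1_nat[OF prime_nth_prime, of i] by simp
    hence "1 \<le> root k (real (nth_prime i))" using assms by simp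
    thus ?thesis by (simp add: a_def root_prime_def le_nat_iff le_floor_iff)
  qed
  have S_ge: "n \<le> S n" for n
    using sum_mono[of "{1..n}" "\<lambda>_. 1" a] a1 by (simp add: S_def)
  have S_split: "S m = S n + sum a {n<..m}" if "n \<le> m" for n m
  proof -
    have "{1..m} = {1..n} \<union> {n<..m}" using that by auto
    thus ?thesis unfolding S_def by (simp only:) (intro sum.union_disjoint, auto)
  qed
  have M: "n \<le> M n" "M n \<le> 2 * n" "M (Suc n) \<le> M n + 2" "(1 + \<eta>) * real n < real (M n) + 1" for n
  proof -
    have "\<lfloor>real n\<rfloor> \<le> \<lfloor>(1 + \<eta>) * real n\<rfloor>" using \<eta> by (intro floor_mono) (simp add: algebra_simps)
    thus "n \<le> M n" by (simp add: M_def le_nat_iff)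
    have "(1 + \<eta>) * real n \<le> 2 * real n" using \<eta> by (intro mult_right_mono) auto
    thus "M n \<le> 2 * n" unfolding M_def by linarith
    have "(1 + \<eta>) * real (Suc n) \<le> (1 + \<eta>) * real n + 2" using \<eta> by (simp add: algebra_simps)
    thus "M (Suc n) \<le> M n + 2" unfolding M_def by linarith
    show "(1 + \<eta>) * real n < real (M n) + 1" unfolding M_def by linarith
  qed
  have "\<exists>n J. J \<subseteq> {n+1 .. nat \<lfloor>(1 + \<epsilon>) * real n\<rfloor>} \<and>
              h = (\<Sum>i = 1..n. \<lfloor>root k (real (nth_prime i))\<rfloor>) + (\<Sum>j\<in>J. \<lfloor>root k (real (nth_prime j))\<rfloor>)"
    if h: "int (F n0) \<le> h" for h
  proof -
    define h' where "h' = nat h"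
    have h': "h = int h'" "F n0 \<le> h'" using h by (auto simp: h'_def)
    define N where "N = {n. F n \<le> 2 * h'}"
    have "N \<subseteq> {..2 * h'}"
    proof
      fix n assume "n \<in> N"
      thus "n \<in> {..2 * h'}" using S_ge[of n] by (simp add: N_def F_def)
    qed
    hence finN: "finite N" using finite_subset by blast
    have "n0 \<in> N" using h' by (simp add: N_def)
    define n where "n = Max N"
    have "n \<in> N" unfolding n_def using finN \<open>n0 \<in> N\<close> by (intro Max_in) auto
    hence Fn: "F n \<le> 2 * h'" by (simp add: N_def)
    have nn0: "n0 \<le> n" unfolding n_def using finN \<open>n0 \<in> N\<close> by (intro Max_ge)
    have "Suc n \<notin> N" using Max_ge[OF finN, of "Suc n"] by (auto simp: n_def)
    hence FSn: "2 * h' < F (Suc n)" by (simp add: N_def)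
    obtain Z where Z: "\<And>j. j \<in> {1..2*n+2} \<Longrightarrow> a j \<le> Z"
      and rep: "\<And>m t. m \<le> 2 * n \<Longrightarrow> \<eta> / 2 * real n \<le> real (m - n) \<Longrightarrow>
       sum a {n<..m} \<le> 2 * t \<Longrightarrow> 2 * t \<le> sum a {n<..m} + 3 * Z \<Longrightarrow> t \<in> subset_sums a {n<..m}"
      using n1[of n] nn0 unfolding n0_def by (metis max.bounded_iff)
    define T where "T = sum a {n<..M n}"
    have ST: "S (M n) = S n + T" unfolding T_def using M by (intro S_split)
    \<comment> \<open>Increasing n by one adds one term to \<open>S n\<close> and at most two to
      \<open>S (M n)\<close>, each at most \<open>Z\<close>; hence the 3 Z in
      \<open>root_prime_window\<close>.\<close>
    have "F (Suc n) \<le> F n + 3 * Z"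
    proof -
      have "S (Suc n) = S n + a (Suc n)" by (simp add: S_def)
      moreover have "a (Suc n) \<le> Z" by (intro Z) auto
      moreover have "S (M (Suc n)) \<le> S (M n + 2)" unfolding S_def using M(3)[of n] by (intro sum_mono2) auto
      moreover have "S (M n + 2) = S (M n) + a (M n + 1) + a (M n + 2)" by (simp add: S_def)
      moreover have "a (M n + 1) \<le> Z" "a (M n + 2) \<le> Z" using M(2)[of n] by (auto intro!: Z)
      ultimately show ?thesis by (simp add: F_def)
    qed
    hence up: "2 * h' \<le> 2 * S n + T + 3 * Z" using FSn ST by (simp add: F_def)
    have lo: "2 * S n + T \<le> 2 * h'" using Fn ST by (simp add: F_def)
    have "h' - S n \<in> subset_sums a {n<..M n}"
    proof (rule rep)
      have "2 / \<eta> \<le> real n" using n2 nn0 by (simp add: n0_def)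
      hence "2 \<le> \<eta> * real n" using \<eta> by (simp add: field_simps)
      hence "\<eta> / 2 * real n \<le> real (M n) - real n" using M(4)[of n] by (simp add: algebra_simps)
      thus "\<eta> / 2 * real n \<le> real (M n - n)" using M(1)[of n] by (simp add: of_nat_diff)
    qed (use M(2)[of n] lo up in \<open>auto simp: T_def\<close>)
    then obtain J where J: "J \<subseteq> {n<..M n}" "h' - S n = sum a J" by (auto simp: subset_sums_def)
    have "M n \<le> nat \<lfloor>(1 + \<epsilon>) * real n\<rfloor>"
      unfolding M_def using \<eta> by (intro nat_mono floor_mono mult_right_mono) auto
    hence "J \<subseteq> {n+1..nat \<lfloor>(1 + \<epsilon>) * real n\<rfloor>}" using J by fastforce
    moreover have "h = (\<Sum>i = 1..n. \<lfloor>root k (real (nth_prime i))\<rfloor>) + (\<Sum>j\<in>J. \<lfloor>root k (real (nth_prime j))\<rfloor>)"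
    proof -
      have "S n \<le> h'" using lo by linarith
      hence "h' = S n + sum a J" using J(2) by linarith
      thus ?thesis by (simp only: a_int h' S_def of_nat_add of_nat_sum)
    qed
    ultimately show ?thesis by blast
  qed
  thus ?thesis by (intro exI[of _ "int (F n0)"]) blast
qed

end
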